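(* Let $\Lambda$ be an action operad. 1. The category $\Lambda\text{-}\mathbf{Coll}$ of $\Lambda$-collections has a monoidal structure with tensor product given by the substitution product $\circ$ and unit given by the collection $I$ with $I(n)=\emptyset$ when $n\ne1$ and $I(1)=\Lambda(1)$. 2. The category $\mathbf{Mon}(\Lambda\text{-}\mathbf{Coll})$ of monoids in $\Lambda\text{-}\mathbf{Coll}$ (for this monoidal structure) is equivalent to the category of $\Lambda$-operads.
   Context: $\mathbb N\ni 0$; $e_n$ is the identity of $\Lambda(n)$; permutations compose as functions. A (non-symmetric) operad $O$ in sets: sets $O(n)$ ($n\in\mathbb N$), $\mathrm{id}\in O(1)$, functions $\mu:O(n)\times O(k_1)\times\cdots\times O(k_n)\to O(k_1+\cdots+k_n)$, unital and associative in the usual sense; maps preserve $\mathrm{id}$ and $\mu$. The operad $\Sigma$ of symmetric groups has $\mu(\sigma;\tau_1,\dots,\tau_n)=\delta(\sigma)\cdot\beta(\tau_1,\dots,\tau_n)$, with $\beta$ the block sum of the permutations $\tau_i\in\Sigma_{k_i}$ and $\delta(\sigma)=\delta_{n;k_1,\dots,k_n}(\sigma)$ sending $k_1+\cdots+k_{i-1}+a$ ($1\le a\le k_i$) to $(\sum_{\sigma(i')<\sigma(i)}k_{i'})+a$. An action operad $(\Lambda,\pi)$: an operad $\Lambda$ in sets with a group structure on each $\Lambda(n)$ and a map of operads $\pi:\Lambda\to\Sigma$ whose components are group homomorphisms, such that, writing $g(i)=\pi_n(g)(i)$ and $g^{-1}(i)=\pi_n(g)^{-1}(i)$, $\mu(g';f_1',\dots,f_n')\mu(g;f_1,\dots,f_n)=\mu(g'g;f'_{g(1)}f_1,\dots,f'_{g(n)}f_n)$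 for $g,g'\in\Lambda(n)$, $f_i\in\Lambda(k_i)$, $f_i'\in\Lambda(k_{g^{-1}(i)})$. Put $\beta(g_1,\dots,g_n)=\mu(e_n;g_1,\dots,g_n)$ and $\delta_{n;k_1,\dots,k_n}(g)=\mu(g;e_{k_1},\dots,e_{k_n})$. A $\Lambda$-operad $P$ (in sets): a non-symmetric operad $P$ with a right action of $\Lambda(n)$ on $P(n)$ for each $n$ such that $\mu(p;q_1\cdot g_1,\dots,q_n\cdot g_n)=\mu(p;q_1,\dots,q_n)\cdot\beta(g_1,\dots,g_n)$ and $\mu(p\cdot g;q_1,\dots,q_n)=\mu(p;q_{g^{-1}(1)},\dots,q_{g^{-1}(n)})\cdot\delta_{n;k_1,\dots,k_n}(g)$ for $p\in P(n)$, $q_i\in P(k_i)$, $g_i\in\Lambda(k_i)$, $g\in\Lambda(n)$. Morphisms are operad maps that are levelwise $\Lambda(n)$-equivariant. $B\Lambda$ is the groupoid with objects the natural numbers, $B\Lambda(n,n)=\Lambda(n)$ and no morphisms $m\to n$ for $m\neq n$. $\Lambda\text{-}\mathbf{Coll}=[B\Lambda^{\mathrm{op}},\mathbf{Sets}]$: a $\Lambda$-collection is a family of sets $X(n)$ with right $\Lambda(n)$-actions. For $\Lambda$-collections $X,Y$, $$(X\circ Y)(k)=\Big(\Big(\coprod_{k_1+\cdots+k_r=k}X(r)\times Y(k_1)\times\cdots\times Y(k_r)\Big)\times\Lambda(k)\Big)/\sim$$ where $\sim$ is generated by $(xh;y_1,\dots,y_r;g)\sim(x;y_{h^{-1}(1)},\dots,y_{h^{-1}(r)};\delta_{r;k_1,\dots,k_r}(h)g)$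 for $h\in\Lambda(r)$, and $(x;y_1g_1,\dots,y_rg_r;g)\sim(x;y_1,\dots,y_r;\beta(g_1,\dots,g_r)g)$ for $g_i\in\Lambda(k_i)$; $\Lambda(k)$ acts by right multiplication on the last coordinate. *)

theory Defs
  imports "HOL-Algebra.Sym_Groups"
begin

section \<open>Categories\<close>

text \<open>Hom-sets are indexed by source and target and need not be disjoint, so composition takes the
  three objects as arguments: for \<open>f : A \<rightarrow> B\<close> and \<open>g : B \<rightarrow> D\<close>, the composite \<open>g f\<close> is
  \<open>Cmp C A B D g f\<close>.\<close>

record ('o, 'm) cat =
  Ob :: "'o set"
  Hom :: "'o \<Rightarrow> 'o \<Rightarrow> 'm set"
  Idn :: "'o \<Rightarrow> 'm"
  Cmp :: "'o \<Rightarrow> 'o \<Rightarrow> 'o \<Rightarrow> 'm \<Rightarrow> 'm \<Rightarrow> 'm"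

definition category :: "('o, 'm) cat \<Rightarrow> bool" where
  "category C \<longleftrightarrow>
     (\<forall>A\<in>Ob C. Idn C A \<in> Hom C A A) \<and>
     (\<forall>A\<in>Ob C. \<forall>B\<in>Ob C. \<forall>D\<in>Ob C. \<forall>f\<in>Hom C A B. \<forall>g\<in>Hom C B D.
        Cmp C A B D g f \<in> Hom C A D) \<and>
     (\<forall>A\<in>Ob C. \<forall>B\<in>Ob C. \<forall>f\<in>Hom C A B.
        Cmp C A A B f (Idn C A) = f \<and> Cmp C A B B (Idn C B) f = f) \<and>
     (\<forall>A\<in>Ob C. \<forall>B\<in>Ob C. \<forall>D\<in>Ob C. \<forall>E\<in>Ob C.
        \<forall>f\<in>Hom C A B. \<forall>g\<in>Hom C B D. \<forall>h\<in>Hom C D E.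
        Cmp C A D E h (Cmp C A B D g f) = Cmp C A B E (Cmp C B D E h g) f)"

definition is_iso :: "('o, 'm) cat \<Rightarrow> 'o \<Rightarrow> 'o \<Rightarrow> 'm \<Rightarrow> bool" where
  "is_iso C A B f \<longleftrightarrow> f \<in> Hom C A B \<and>
     (\<exists>g\<in>Hom C B A. Cmp C A B A g f = Idn C A \<and> Cmp C B A B f g = Idn C B)"

definition prod_cat :: "('o, 'm) cat \<Rightarrow> ('p, 'n) cat \<Rightarrow> ('o \<times> 'p, 'm \<times> 'n) cat" where
  "prod_cat C D = \<lparr>
     Ob = Ob C \<times> Ob D,
     Hom = (\<lambda>(A, B) (A', B'). Hom C A A' \<times> Hom D B B'),
     Idn = (\<lambda>(A, B). (Idn C A, Idn D B)),
     Cmp = (\<lambda>(A, B) (A', B') (A'', B'') (g, g') (f, f'). (Cmp C A A' A'' g f, Cmp D B B' B'' g' f'))\<rparr>"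

record ('o, 'm, 'p, 'n) fctr =
  fob :: "'o \<Rightarrow> 'p"
  far :: "'o \<Rightarrow> 'o \<Rightarrow> 'm \<Rightarrow> 'n"

definition is_functor :: "('o, 'm) cat \<Rightarrow> ('p, 'n) cat \<Rightarrow> ('o, 'm, 'p, 'n) fctr \<Rightarrow> bool" where
  "is_functor C D F \<longleftrightarrow>
     (\<forall>A\<in>Ob C. fob F A \<in> Ob D) \<and>
     (\<forall>A\<in>Ob C. \<forall>B\<in>Ob C. \<forall>f\<in>Hom C A B. far F A B f \<in> Hom D (fob F A) (fob F B)) \<and>
     (\<forall>A\<in>Ob C. far F A A (Idn C A) = Idn D (fob F A)) \<and>
     (\<forall>A\<in>Ob C. \<forall>B\<in>Ob C. \<forall>E\<in>Ob C. \<forall>f\<in>Hom C A B. \<forall>g\<in>Hom C B E.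
        far F A E (Cmp C A B E g f) =
        Cmp D (fob F A) (fob F B) (fob F E) (far F B E g) (far F A B f))"

definition id_fctr :: "('o, 'm, 'o, 'm) fctr" where
  "id_fctr = \<lparr>fob = (\<lambda>A. A), far = (\<lambda>A B f. f)\<rparr>"

definition comp_fctr ::
  "('p, 'n, 'q, 'k) fctr \<Rightarrow> ('o, 'm, 'p, 'n) fctr \<Rightarrow> ('o, 'm, 'q, 'k) fctr" where
  "comp_fctr G F =
     \<lparr>fob = (\<lambda>A. fob G (fob F A)), far = (\<lambda>A B f. far G (fob F A) (fob F B) (far F A B f))\<rparr>"

definition nat_iso :: "('o, 'm) cat \<Rightarrow> ('p, 'n) cat \<Rightarrow>
    ('o, 'm, 'p, 'n) fctr \<Rightarrow> ('o, 'm, 'p, 'n) fctr \<Rightarrow> ('o \<Rightarrow> 'n) \<Rightarrow> bool" where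
  "nat_iso C D F G \<eta> \<longleftrightarrow>
     (\<forall>A\<in>Ob C. is_iso D (fob F A) (fob G A) (\<eta> A)) \<and>
     (\<forall>A\<in>Ob C. \<forall>B\<in>Ob C. \<forall>f\<in>Hom C A B.
        Cmp D (fob F A) (fob G A) (fob G B) (far G A B f) (\<eta> A) =
        Cmp D (fob F A) (fob F B) (fob G B) (\<eta> B) (far F A B f))"

definition equivalent_categories :: "('o, 'm) cat \<Rightarrow> ('p, 'n) cat \<Rightarrow> bool" where
  "equivalent_categories C D \<longleftrightarrow> category C \<and> category D \<and>
     (\<exists>F G \<eta> \<epsilon>. is_functor C D F \<and> is_functor D C G \<and>
        nat_iso C C id_fctr (comp_fctr G F) \<eta> \<and> nat_iso D D (comp_fctr F G) id_fctr \<epsilon>)"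


section \<open>Monoidal categories and monoids\<close>

type_synonym ('o, 'm) tensor = "('o \<times> 'o, 'm \<times> 'm, 'o, 'm) fctr"

definition tens0 :: "('o, 'm) tensor \<Rightarrow> 'o \<Rightarrow> 'o \<Rightarrow> 'o" where
  "tens0 T A B = fob T (A, B)"

text \<open>\<open>tens1 T A A' B B' f g\<close> is \<open>f \<otimes> g : A \<otimes> B \<rightarrow> A' \<otimes> B'\<close> for \<open>f : A \<rightarrow> A'\<close> and \<open>g : B \<rightarrow> B'\<close>.\<close>

definition tens1 :: "('o, 'm) tensor \<Rightarrow> 'o \<Rightarrow> 'o \<Rightarrow> 'o \<Rightarrow> 'o \<Rightarrow> 'm \<Rightarrow> 'm \<Rightarrow> 'm" where
  "tens1 T A A' B B' f g = far T (A, B) (A', B') (f, g)"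

definition tens_left :: "('o, 'm) tensor \<Rightarrow> (('o \<times> 'o) \<times> 'o, ('m \<times> 'm) \<times> 'm, 'o, 'm) fctr" where
  "tens_left T = \<lparr>
     fob = (\<lambda>((A, B), D). tens0 T (tens0 T A B) D),
     far = (\<lambda>((A, B), D) ((A', B'), D') ((f, g), h).
              tens1 T (tens0 T A B) (tens0 T A' B') D D' (tens1 T A A' B B' f g) h)\<rparr>"

definition tens_right :: "('o, 'm) tensor \<Rightarrow> (('o \<times> 'o) \<times> 'o, ('m \<times> 'm) \<times> 'm, 'o, 'm) fctr" where
  "tens_right T = \<lparr>
     fob = (\<lambda>((A, B), D). tens0 T A (tens0 T B D)),
     far = (\<lambda>((A, B), D) ((A', B'), D') ((f, g), h).
              tens1 T A A' (tens0 T B D) (tens0 T B' D') f (tens1 T B B' D D' g h))\<rparr>"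

definition unit_left :: "('o, 'm) cat \<Rightarrow> ('o, 'm) tensor \<Rightarrow> 'o \<Rightarrow> ('o, 'm, 'o, 'm) fctr" where
  "unit_left C T J = \<lparr>fob = (\<lambda>A. tens0 T J A), far = (\<lambda>A B f. tens1 T J J A B (Idn C J) f)\<rparr>"

definition unit_right :: "('o, 'm) cat \<Rightarrow> ('o, 'm) tensor \<Rightarrow> 'o \<Rightarrow> ('o, 'm, 'o, 'm) fctr" where
  "unit_right C T J = \<lparr>fob = (\<lambda>A. tens0 T A J), far = (\<lambda>A B f. tens1 T A B J J f (Idn C J))\<rparr>"

text \<open>Monoidal structure with tensor functor \<open>T\<close>, unit object \<open>J\<close>, associator
  \<open>a ((A, B), D) : (A \<otimes> B) \<otimes> D \<rightarrow> A \<otimes> (B \<otimes> D)\<close> and unitors \<open>l A : J \<otimes> A \<rightarrow> A\<close>,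
  \<open>r A : A \<otimes> J \<rightarrow> A\<close>; the last two conjuncts are the pentagon and the triangle.\<close>

definition monoidal_category :: "('o, 'm) cat \<Rightarrow> ('o, 'm) tensor \<Rightarrow> 'o \<Rightarrow>
    (('o \<times> 'o) \<times> 'o \<Rightarrow> 'm) \<Rightarrow> ('o \<Rightarrow> 'm) \<Rightarrow> ('o \<Rightarrow> 'm) \<Rightarrow> bool" where
  "monoidal_category C T J a l r \<longleftrightarrow>
     category C \<and> is_functor (prod_cat C C) C T \<and> J \<in> Ob C \<and>
     nat_iso (prod_cat (prod_cat C C) C) C (tens_left T) (tens_right T) a \<and>
     nat_iso C C (unit_left C T J) id_fctr l \<and>
     nat_iso C C (unit_right C T J) id_fctr r \<and>
     (\<forall>A\<in>Ob C. \<forall>B\<in>Ob C. \<forall>D\<in>Ob C. \<forall>E\<in>Ob C.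
        let AB = tens0 T A B; BD = tens0 T B D; DE = tens0 T D E;
            S = tens0 T (tens0 T AB D) E;
            U = tens0 T A (tens0 T B DE)
        in Cmp C S (tens0 T A (tens0 T BD E)) U
             (tens1 T A A (tens0 T BD E) (tens0 T B DE) (Idn C A) (a ((B, D), E)))
             (Cmp C S (tens0 T (tens0 T A BD) E) (tens0 T A (tens0 T BD E))
               (a ((A, BD), E))
               (tens1 T (tens0 T AB D) (tens0 T A BD) E E (a ((A, B), D)) (Idn C E)))
           = Cmp C S (tens0 T AB DE) U (a ((A, B), DE)) (a ((AB, D), E))) \<and>
     (\<forall>A\<in>Ob C. \<forall>B\<in>Ob C.
        Cmp C (tens0 T (tens0 T A J) B) (tens0 T A (tens0 T J B)) (tens0 T A B)
          (tens1 T A A (tens0 T J B) B (Idn C A) (l B)) (a ((A, J), B))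
        = tens1 T (tens0 T A J) A B B (r A) (Idn C B))"

type_synonym ('o, 'm) mon_obj = "'o \<times> 'm \<times> 'm"

definition is_monoid :: "('o, 'm) cat \<Rightarrow> ('o, 'm) tensor \<Rightarrow> 'o \<Rightarrow>
    (('o \<times> 'o) \<times> 'o \<Rightarrow> 'm) \<Rightarrow> ('o \<Rightarrow> 'm) \<Rightarrow> ('o \<Rightarrow> 'm) \<Rightarrow> ('o, 'm) mon_obj \<Rightarrow> bool" where
  "is_monoid C T J a l r = (\<lambda>(X, m, u).
     X \<in> Ob C \<and> m \<in> Hom C (tens0 T X X) X \<and> u \<in> Hom C J X \<and>
     Cmp C (tens0 T (tens0 T X X) X) (tens0 T X X) X
        m (tens1 T (tens0 T X X) X X X m (Idn C X))
     = Cmp C (tens0 T (tens0 T X X) X) (tens0 T X X) X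
        m (Cmp C (tens0 T (tens0 T X X) X) (tens0 T X (tens0 T X X)) (tens0 T X X)
             (tens1 T X X (tens0 T X X) X (Idn C X) m) (a ((X, X), X))) \<and>
     Cmp C (tens0 T J X) (tens0 T X X) X m (tens1 T J X X X u (Idn C X)) = l X \<and>
     Cmp C (tens0 T X J) (tens0 T X X) X m (tens1 T X X J X (Idn C X) u) = r X)"

definition mon_hom :: "('o, 'm) cat \<Rightarrow> ('o, 'm) tensor \<Rightarrow> 'o \<Rightarrow>
    ('o, 'm) mon_obj \<Rightarrow> ('o, 'm) mon_obj \<Rightarrow> 'm set" where
  "mon_hom C T J = (\<lambda>(X, m, u) (X', m', u').
     {f \<in> Hom C X X'.
        Cmp C (tens0 T X X) X X' f m
        = Cmp C (tens0 T X X) (tens0 T X' X') X' m' (tens1 T X X' X X' f f) \<and>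
        Cmp C J X X' f u = u'})"

definition mon_cat :: "('o, 'm) cat \<Rightarrow> ('o, 'm) tensor \<Rightarrow> 'o \<Rightarrow>
    (('o \<times> 'o) \<times> 'o \<Rightarrow> 'm) \<Rightarrow> ('o \<Rightarrow> 'm) \<Rightarrow> ('o \<Rightarrow> 'm) \<Rightarrow> (('o, 'm) mon_obj, 'm) cat" where
  "mon_cat C T J a l r = \<lparr>
     Ob = {M. is_monoid C T J a l r M},
     Hom = mon_hom C T J,
     Idn = (\<lambda>(X, m, u). Idn C X),
     Cmp = (\<lambda>(X, _, _) (X', _, _) (X'', _, _) g f. Cmp C X X' X'' g f)\<rparr>"


section \<open>Universes of sets\<close>

text \<open>A type \<open>'u\<close> playing the role of the class of all sets: \<open>small A\<close> says that the class
  \<open>A :: 'u set\<close> is a set, and \<open>code A\<close> is that set regarded as an element of \<open>'u\<close>.  Every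
  uncountable Grothendieck universe provides an instance.  Power sets are not needed and not
  assumed; so a type with as many elements as it has countable subsets, with \<open>small = countable\<close>,
  is an instance as well.\<close>

locale set_universe =
  fixes small :: "'u set \<Rightarrow> bool"
    and code :: "'u set \<Rightarrow> 'u"
  assumes inj_code: "inj_on code {A. small A}"
    and small_subset: "small A \<Longrightarrow> B \<subseteq> A \<Longrightarrow> small B"
    and small_image: "small A \<Longrightarrow> small ((f :: 'u \<Rightarrow> 'u) ` A)"
    and small_UN: "small A \<Longrightarrow> (\<And>x. x \<in> A \<Longrightarrow> small (F x)) \<Longrightarrow> small (\<Union>x\<in>A. F (x :: 'u))"
    and small_infinite: "\<exists>A. small A \<and> infinite A"

text \<open>Set-theoretic coding of naturals (Zermelo), pairs (Kuratowski) and lists.\<close>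

primrec code_nat :: "('u set \<Rightarrow> 'u) \<Rightarrow> nat \<Rightarrow> 'u" where
  "code_nat code 0 = code {}"
| "code_nat code (Suc n) = code {code_nat code n}"

definition code_pair :: "('u set \<Rightarrow> 'u) \<Rightarrow> 'u \<Rightarrow> 'u \<Rightarrow> 'u" where
  "code_pair code x y = code {code {x}, code {x, y}}"

primrec code_list :: "('u set \<Rightarrow> 'u) \<Rightarrow> 'u list \<Rightarrow> 'u" where
  "code_list code [] = code {}"
| "code_list code (x # xs) = code_pair code x (code_list code xs)"


section \<open>Operads\<close>

text \<open>A family \<open>y\<^sub>1 \<in> X(k\<^sub>1), \<dots>, y\<^sub>n \<in> X(k\<^sub>n)\<close> is a list; positions are counted from 1, to fit
  \<^const>\<open>sym_group\<close>, which consists of permutations of \<open>{1..n}\<close>.\<close>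

definition tuples :: "(nat \<Rightarrow> 'a set) \<Rightarrow> nat list \<Rightarrow> 'a list set" where
  "tuples X ks = {ys. list_all2 (\<lambda>y k. y \<in> X k) ys ks}"

definition map3 :: "('a \<Rightarrow> 'b \<Rightarrow> 'c \<Rightarrow> 'd) \<Rightarrow> 'a list \<Rightarrow> 'b list \<Rightarrow> 'c list \<Rightarrow> 'd list" where
  "map3 f xs ys zs = map (\<lambda>(x, y, z). f x y z) (zip xs (zip ys zs))"

definition nth1 :: "'a list \<Rightarrow> nat \<Rightarrow> 'a" where
  "nth1 xs i = xs ! (i - 1)"

text \<open>\<open>permute \<sigma> [x\<^sub>1, \<dots>, x\<^sub>n]\<close> is \<open>(x\<^bsub>\<sigma>\<^sup>-\<^sup>1(1)\<^esub>, \<dots>, x\<^bsub>\<sigma>\<^sup>-\<^sup>1(n)\<^esub>)\<close>.\<close>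

definition permute :: "(nat \<Rightarrow> nat) \<Rightarrow> 'a list \<Rightarrow> 'a list" where
  "permute \<sigma> xs = map (\<lambda>i. nth1 xs (inv' \<sigma> i)) [1..<length xs + 1]"

text \<open>The sets \<open>ops P n\<close> need not be disjoint, so multiplication carries the arities of the inputs:
  \<open>mu P [k\<^sub>1, \<dots>, k\<^sub>n]\<close> is \<open>\<mu> : P(n) \<times> P(k\<^sub>1) \<times> \<dots> \<times> P(k\<^sub>n) \<rightarrow> P(k\<^sub>1 + \<dots> + k\<^sub>n)\<close>.\<close>

record 'a operad =
  ops :: "nat \<Rightarrow> 'a set"
  oid :: "'a"
  mu :: "nat list \<Rightarrow> 'a \<Rightarrow> 'a list \<Rightarrow> 'a"

text \<open>In the associativity law the \<open>i\<close>-th entry of \<open>kss\<close> lists the arities of the operations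
  plugged into the \<open>i\<close>-th entry of \<open>qs\<close>.\<close>

definition operad :: "('a, 'z) operad_scheme \<Rightarrow> bool" where
  "operad P \<longleftrightarrow>
     oid P \<in> ops P 1 \<and>
     (\<forall>ks. \<forall>p\<in>ops P (length ks). \<forall>qs\<in>tuples (ops P) ks. mu P ks p qs \<in> ops P (sum_list ks)) \<and>
     (\<forall>n. \<forall>p\<in>ops P n. mu P [n] (oid P) [p] = p \<and>
        mu P (replicate n 1) p (replicate n (oid P)) = p) \<and>
     (\<forall>kss. \<forall>p\<in>ops P (length kss). \<forall>qs\<in>tuples (ops P) (map length kss).
        \<forall>rss. list_all2 (\<lambda>rs ks. rs \<in> tuples (ops P) ks) rss kss \<longrightarrow>
          mu P (concat kss) (mu P (map length kss) p qs) (concat rss)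
          = mu P (map sum_list kss) p (map3 (mu P) kss qs rss))"

definition operad_map ::
  "('a, 'z) operad_scheme \<Rightarrow> ('b, 'y) operad_scheme \<Rightarrow> (nat \<Rightarrow> 'a \<Rightarrow> 'b) \<Rightarrow> bool" where
  "operad_map P Q f \<longleftrightarrow>
     (\<forall>n. f n \<in> ops P n \<rightarrow> ops Q n) \<and>
     f 1 (oid P) = oid Q \<and>
     (\<forall>ks. \<forall>p\<in>ops P (length ks). \<forall>qs\<in>tuples (ops P) ks.
        f (sum_list ks) (mu P ks p qs) = mu Q ks (f (length ks) p) (map2 f ks qs))"


section \<open>The operad of symmetric groups\<close>

text \<open>\<open>block_of ks m\<close> is the block \<open>i\<close> with \<open>k\<^sub>1 + \<dots> + k\<^bsub>i-1\<^esub> < m \<le> k\<^sub>1 + \<dots> + k\<^sub>i\<close>.\<close>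

definition offset :: "nat list \<Rightarrow> nat \<Rightarrow> nat" where
  "offset ks i = sum_list (take (i - 1) ks)"

definition block_of :: "nat list \<Rightarrow> nat \<Rightarrow> nat" where
  "block_of ks m = (LEAST i. m \<le> sum_list (take i ks))"

definition block_sum :: "nat list \<Rightarrow> (nat \<Rightarrow> nat) list \<Rightarrow> nat \<Rightarrow> nat" where
  "block_sum ks \<tau>s m =
     (if m \<in> {1..sum_list ks}
      then let i = block_of ks m in offset ks i + nth1 \<tau>s i (m - offset ks i)
      else m)"

definition block_perm :: "nat list \<Rightarrow> (nat \<Rightarrow> nat) \<Rightarrow> nat \<Rightarrow> nat" where
  "block_perm ks \<sigma> m =
     (if m \<in> {1..sum_list ks}
      then let i = block_of ks m
           in (\<Sum>j\<in>{j\<in>{1..length ks}. \<sigma> j < \<sigma> i}. nth1 ks j) + (m - offset ks i)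
      else m)"

definition sym_operad :: "(nat \<Rightarrow> nat) operad" where
  "sym_operad = \<lparr>
     ops = (\<lambda>n. carrier (sym_group n)),
     oid = id,
     mu = (\<lambda>ks \<sigma> \<tau>s. block_perm ks \<sigma> \<circ> block_sum ks \<tau>s)\<rparr>"


section \<open>Action operads\<close>

record 'a group_operad = "'a operad" +
  gr :: "nat \<Rightarrow> 'a monoid"
  pr :: "nat \<Rightarrow> 'a \<Rightarrow> nat \<Rightarrow> nat"

definition action_operad :: "('a, 'z) group_operad_scheme \<Rightarrow> bool" where
  "action_operad L \<longleftrightarrow>
     operad L \<and>
     (\<forall>n. group (gr L n) \<and> carrier (gr L n) = ops L n) \<and>
     operad_map L sym_operad (pr L) \<and>
     (\<forall>n. pr L n \<in> hom (gr L n) (sym_group n)) \<and>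
     (\<forall>ks. \<forall>g\<in>ops L (length ks). \<forall>g'\<in>ops L (length ks).
        \<forall>fs\<in>tuples (ops L) ks. \<forall>fs'\<in>tuples (ops L) (permute (pr L (length ks) g) ks).
          mu L (permute (pr L (length ks) g) ks) g' fs' \<otimes>\<^bsub>gr L (sum_list ks)\<^esub> mu L ks g fs
          = mu L ks (g' \<otimes>\<^bsub>gr L (length ks)\<^esub> g)
              (map (\<lambda>i. nth1 fs' (pr L (length ks) g i) \<otimes>\<^bsub>gr L (nth1 ks i)\<^esub> nth1 fs i)
                 [1..<length ks + 1]))"

definition beta :: "('a, 'z) group_operad_scheme \<Rightarrow> nat list \<Rightarrow> 'a list \<Rightarrow> 'a" where
  "beta L ks gs = mu L ks \<one>\<^bsub>gr L (length ks)\<^esub> gs"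

definition delta :: "('a, 'z) group_operad_scheme \<Rightarrow> nat list \<Rightarrow> 'a \<Rightarrow> 'a" where
  "delta L ks g = mu L ks g (map (\<lambda>k. \<one>\<^bsub>gr L k\<^esub>) ks)"


section \<open>The category of collections\<close>

definition right_action :: "'g monoid \<Rightarrow> 'x set \<Rightarrow> ('x \<Rightarrow> 'g \<Rightarrow> 'x) \<Rightarrow> bool" where
  "right_action G S ac \<longleftrightarrow>
     (\<forall>x\<in>S. \<forall>g\<in>carrier G. ac x g \<in> S) \<and>
     (\<forall>x\<in>S. ac x \<one>\<^bsub>G\<^esub> = x) \<and>
     (\<forall>x\<in>S. \<forall>g\<in>carrier G. \<forall>h\<in>carrier G. ac (ac x g) h = ac x (g \<otimes>\<^bsub>G\<^esub> h))"

record 'u collection =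
  cset :: "nat \<Rightarrow> 'u set"
  cact :: "nat \<Rightarrow> 'u \<Rightarrow> 'u \<Rightarrow> 'u"

text \<open>Here and for operads below, structure maps are required to be undefined outside their domain,
  so that equality of objects and of morphisms is the intended one.\<close>

definition is_coll :: "('u set \<Rightarrow> bool) \<Rightarrow> 'u group_operad \<Rightarrow> 'u collection \<Rightarrow> bool" where
  "is_coll small L X \<longleftrightarrow>
     (\<forall>n. small (cset X n) \<and> right_action (gr L n) (cset X n) (cact X n)) \<and>
     (\<forall>n x g. \<not> (x \<in> cset X n \<and> g \<in> ops L n) \<longrightarrow> cact X n x g = undefined)"

definition coll_hom ::
  "'u group_operad \<Rightarrow> 'u collection \<Rightarrow> 'u collection \<Rightarrow> (nat \<Rightarrow> 'u \<Rightarrow> 'u) set" where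
  "coll_hom L X Y = {f. \<forall>n. f n \<in> cset X n \<rightarrow>\<^sub>E cset Y n \<and>
     (\<forall>x\<in>cset X n. \<forall>g\<in>ops L n. f n (cact X n x g) = cact Y n (f n x) g)}"

definition coll_cat ::
  "('u set \<Rightarrow> bool) \<Rightarrow> 'u group_operad \<Rightarrow> ('u collection, nat \<Rightarrow> 'u \<Rightarrow> 'u) cat" where
  "coll_cat small L = \<lparr>
     Ob = {X. is_coll small L X},
     Hom = coll_hom L,
     Idn = (\<lambda>X n. \<lambda>x\<in>cset X n. x),
     Cmp = (\<lambda>X Y Z g f n. compose (cset X n) (g n) (f n))\<rparr>"

definition unit_coll :: "'u group_operad \<Rightarrow> 'u collection" where
  "unit_coll L = \<lparr>
     cset = (\<lambda>n. if n = 1 then ops L 1 else {}),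
     cact = (\<lambda>n x g. if n = 1 \<and> x \<in> ops L 1 \<and> g \<in> ops L 1 then x \<otimes>\<^bsub>gr L 1\<^esub> g else undefined)\<rparr>"


section \<open>The substitution product\<close>

text \<open>\<open>([k\<^sub>1, \<dots>, k\<^sub>r], x, [y\<^sub>1, \<dots>, y\<^sub>r], g)\<close> is the element \<open>(x; y\<^sub>1, \<dots>, y\<^sub>r; g)\<close> of the summand of
  index \<open>(k\<^sub>1, \<dots>, k\<^sub>r)\<close>.\<close>

type_synonym 'u raw = "nat list \<times> 'u \<times> 'u list \<times> 'u"

definition raws ::
  "'u group_operad \<Rightarrow> 'u collection \<Rightarrow> 'u collection \<Rightarrow> nat \<Rightarrow> 'u raw set" where
  "raws L X Y k = {(ks, x, ys, g).
     sum_list ks = k \<and> x \<in> cset X (length ks) \<and> ys \<in> tuples (cset Y) ks \<and> g \<in> ops L k}"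

inductive subst_step ::
    "'u group_operad \<Rightarrow> 'u collection \<Rightarrow> 'u collection \<Rightarrow> 'u raw \<Rightarrow> 'u raw \<Rightarrow> bool"
  for L X Y where
    outer: "\<lbrakk>x \<in> cset X (length ks); h \<in> ops L (length ks); ys \<in> tuples (cset Y) ks;
             g \<in> ops L (sum_list ks)\<rbrakk> \<Longrightarrow>
           subst_step L X Y
             (ks, cact X (length ks) x h, ys, g)
             (permute (pr L (length ks) h) ks, x, permute (pr L (length ks) h) ys,
              delta L ks h \<otimes>\<^bsub>gr L (sum_list ks)\<^esub> g)"
  | inner: "\<lbrakk>x \<in> cset X (length ks); ys \<in> tuples (cset Y) ks; gs \<in> tuples (ops L) ks;
             g \<in> ops L (sum_list ks)\<rbrakk> \<Longrightarrow>
           subst_step L X Y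
             (ks, x, map3 (cact Y) ks ys gs, g)
             (ks, x, ys, beta L ks gs \<otimes>\<^bsub>gr L (sum_list ks)\<^esub> g)"

definition code_raw :: "('u set \<Rightarrow> 'u) \<Rightarrow> 'u raw \<Rightarrow> 'u" where
  "code_raw code = (\<lambda>(ks, x, ys, g).
     code_list code [code_list code (map (code_nat code) ks), x, code_list code ys, g])"

text \<open>The equivalence class of \<open>t\<close>, as an element of the universe.\<close>

definition subst_class ::
  "('u set \<Rightarrow> 'u) \<Rightarrow> 'u group_operad \<Rightarrow> 'u collection \<Rightarrow> 'u collection \<Rightarrow> 'u raw \<Rightarrow> 'u" where
  "subst_class code L X Y t = code (code_raw code ` {s. equivclp (subst_step L X Y) t s})"

definition subst_set ::
  "('u set \<Rightarrow> 'u) \<Rightarrow> 'u group_operad \<Rightarrow> 'u collection \<Rightarrow> 'u collection \<Rightarrow> nat \<Rightarrow> 'u set" where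
  "subst_set code L X Y k = subst_class code L X Y ` raws L X Y k"

text \<open>An arbitrary representative of a class; the action and the functoriality below do not depend
  on its choice.\<close>

definition subst_rep ::
  "('u set \<Rightarrow> 'u) \<Rightarrow> 'u group_operad \<Rightarrow> 'u collection \<Rightarrow> 'u collection \<Rightarrow> nat \<Rightarrow> 'u \<Rightarrow> 'u raw" where
  "subst_rep code L X Y k c = (SOME t. t \<in> raws L X Y k \<and> subst_class code L X Y t = c)"

definition subst_coll ::
  "('u set \<Rightarrow> 'u) \<Rightarrow> 'u group_operad \<Rightarrow> 'u collection \<Rightarrow> 'u collection \<Rightarrow> 'u collection" where
  "subst_coll code L X Y = \<lparr>
     cset = subst_set code L X Y,
     cact = (\<lambda>k c h.
       if c \<in> subst_set code L X Y k \<and> h \<in> ops L k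
       then case subst_rep code L X Y k c of (ks, x, ys, g) \<Rightarrow>
              subst_class code L X Y (ks, x, ys, g \<otimes>\<^bsub>gr L k\<^esub> h)
       else undefined)\<rparr>"

definition subst_map :: "('u set \<Rightarrow> 'u) \<Rightarrow> 'u group_operad \<Rightarrow>
    'u collection \<Rightarrow> 'u collection \<Rightarrow> 'u collection \<Rightarrow> 'u collection \<Rightarrow>
    (nat \<Rightarrow> 'u \<Rightarrow> 'u) \<Rightarrow> (nat \<Rightarrow> 'u \<Rightarrow> 'u) \<Rightarrow> (nat \<Rightarrow> 'u \<Rightarrow> 'u)" where
  "subst_map code L X Y X' Y' f f' = (\<lambda>k. \<lambda>c\<in>subst_set code L X Y k.
     case subst_rep code L X Y k c of (ks, x, ys, g) \<Rightarrow>
       subst_class code L X' Y' (ks, f (length ks) x, map2 f' ks ys, g))"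

definition subst_tensor ::
  "('u set \<Rightarrow> 'u) \<Rightarrow> 'u group_operad \<Rightarrow> ('u collection, nat \<Rightarrow> 'u \<Rightarrow> 'u) tensor" where
  "subst_tensor code L = \<lparr>
     fob = (\<lambda>(X, Y). subst_coll code L X Y),
     far = (\<lambda>(X, Y) (X', Y') (f, f'). subst_map code L X Y X' Y' f f')\<rparr>"


section \<open>The category of operads over an action operad\<close>

record 'u acted_operad = "'u operad" +
  oact :: "nat \<Rightarrow> 'u \<Rightarrow> 'u \<Rightarrow> 'u"

definition is_lambda_operad ::
  "('u set \<Rightarrow> bool) \<Rightarrow> 'u group_operad \<Rightarrow> 'u acted_operad \<Rightarrow> bool" where
  "is_lambda_operad small L P \<longleftrightarrow>
     operad P \<and>
     (\<forall>n. small (ops P n) \<and> right_action (gr L n) (ops P n) (oact P n)) \<and>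
     (\<forall>ks. \<forall>p\<in>ops P (length ks). \<forall>qs\<in>tuples (ops P) ks. \<forall>gs\<in>tuples (ops L) ks.
        mu P ks p (map3 (oact P) ks qs gs) = oact P (sum_list ks) (mu P ks p qs) (beta L ks gs)) \<and>
     (\<forall>ks. \<forall>p\<in>ops P (length ks). \<forall>qs\<in>tuples (ops P) ks. \<forall>g\<in>ops L (length ks).
        mu P ks (oact P (length ks) p g) qs
        = oact P (sum_list ks)
            (mu P (permute (pr L (length ks) g) ks) p (permute (pr L (length ks) g) qs))
            (delta L ks g)) \<and>
     (\<forall>ks p qs. \<not> (p \<in> ops P (length ks) \<and> qs \<in> tuples (ops P) ks) \<longrightarrow> mu P ks p qs = undefined) \<and>
     (\<forall>n p g. \<not> (p \<in> ops P n \<and> g \<in> ops L n) \<longrightarrow> oact P n p g = undefined)"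

definition lambda_operad_hom ::
  "'u group_operad \<Rightarrow> 'u acted_operad \<Rightarrow> 'u acted_operad \<Rightarrow> (nat \<Rightarrow> 'u \<Rightarrow> 'u) set" where
  "lambda_operad_hom L P Q = {f. operad_map P Q f \<and>
     (\<forall>n. f n \<in> extensional (ops P n) \<and>
        (\<forall>p\<in>ops P n. \<forall>g\<in>ops L n. f n (oact P n p g) = oact Q n (f n p) g))}"

definition lambda_operad_cat ::
  "('u set \<Rightarrow> bool) \<Rightarrow> 'u group_operad \<Rightarrow> ('u acted_operad, nat \<Rightarrow> 'u \<Rightarrow> 'u) cat" where
  "lambda_operad_cat small L = \<lparr>
     Ob = {P. is_lambda_operad small L P},
     Hom = lambda_operad_hom L,
     Idn = (\<lambda>P n. \<lambda>p\<in>ops P n. p),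
     Cmp = (\<lambda>P Q R g f n. compose (ops P n) (g n) (f n))\<rparr>"

end

theory Submission
  imports Defs
begin

text \<open>Maps of collections \<open>X \<circ> Y \<rightarrow> W\<close> correspond to families of functions
  \<open>X(r) \<times> Y(k\<^sub>1) \<times> \<dots> \<times> Y(k\<^sub>r) \<rightarrow> W(k\<^sub>1 + \<dots> + k\<^sub>r)\<close> that are balanced: the group elements acting on the
  arguments come out as \<open>\<delta>(h)\<close> and \<open>\<beta>(g\<^sub>1, \<dots>, g\<^sub>r)\<close>. So a map out of \<open>X \<circ> Y\<close> is determined by its
  values on the classes of \<open>(x; y\<^sub>1, \<dots>, y\<^sub>r; e)\<close>, and a map out of an iterated product by its values on
  nested classes of this form. The associator and unitors are given by their values on these, where
  naturality and coherence are evident; that these values are balanced follows from the identities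
  between \<open>\<beta>\<close>, \<open>\<delta>\<close> and permutations of lists that hold in an action operad. The axioms relating the
  composition of a \<open>\<Lambda>\<close>-operad \<open>P\<close> to the actions say that it is balanced, so it is the same as a map
  \<open>P \<circ> P \<rightarrow> P\<close>, and the monoid axioms, tested on the classes above, are the operad axioms; hence the two
  categories are in fact isomorphic.\<close>

section \<open>Permutations of lists\<close>

text \<open>The elements of X \<circ> Y are equivalence classes, so every map out of it is first
  given on representatives, and the work lies in independence of their choice. For the associator,
  the group coordinate g of (x; y; g) is moved onto z, which is permuted by g before it is cut into
  blocks; the generating steps multiply g by \<delta>(h) or \<beta>(g_1, ..., g_r), which permute
  whole blocks or the insides of blocks. This is why permutations of concatenated lists are settled
  first. The inverse associator is harder: its argument contains a list of classes, so a whole list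
  of representatives may change, and they are exchanged one entry at a time.

  Classes are coded as elements of the universe, and the coding is injective only on small sets;
  hence the representatives of a given arity must be shown to form a small set before equality of
  codes can be read as equivalence. Finally, J is free on the element e_1 of \<Lambda>(1), and e_1
  is the operadic identity, so a unit J \<rightarrow> X is the same as an element of X(1).\<close>

lemma tuples_iff:
  "ys \<in> tuples X ks \<longleftrightarrow> length ys = length ks \<and> (\<forall>i<length ks. ys ! i \<in> X (ks ! i))"
  by (auto simp: tuples_def list_all2_conv_all_nth)

lemma tuples_Nil [simp]: "ys \<in> tuples X [] \<longleftrightarrow> ys = []"
  by (simp add: tuples_def)

lemma tuples_Cons [simp]:
  "ys \<in> tuples X (k # ks) \<longleftrightarrow> (\<exists>y ys'. ys = y # ys' \<and> y \<in> X k \<and> ys' \<in> tuples X ks)"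
  by (auto simp: tuples_def list_all2_Cons2)

lemma length_tuples: "ys \<in> tuples X ks \<Longrightarrow> length ys = length ks"
  by (simp add: tuples_iff)

abbreviation tuple_lists :: "(nat \<Rightarrow> 'a set) \<Rightarrow> 'a list list \<Rightarrow> nat list list \<Rightarrow> bool" where
  "tuple_lists Z \<equiv> list_all2 (\<lambda>zs ks. zs \<in> tuples Z ks)"

lemma length_map3 [simp]: "length (map3 f xs ys zs) = min (length xs) (min (length ys) (length zs))"
  by (simp add: map3_def)

lemma nth_map3 [simp]:
  "i < length xs \<Longrightarrow> i < length ys \<Longrightarrow> i < length zs \<Longrightarrow>
   map3 f xs ys zs ! i = f (xs ! i) (ys ! i) (zs ! i)"
  by (simp add: map3_def)

lemma map3_Cons [simp]: "map3 f (x # xs) (y # ys) (z # zs) = f x y z # map3 f xs ys zs"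
  by (simp add: map3_def)

lemma map3_Nil [simp]: "map3 f [] ys zs = []"
  by (simp add: map3_def)

lemma tuples_map3:
  assumes "xs \<in> tuples X ks" "ys \<in> tuples Y ks"
    and "\<And>k x y. x \<in> X k \<Longrightarrow> y \<in> Y k \<Longrightarrow> f k x y \<in> Z k"
  shows "map3 f ks xs ys \<in> tuples Z ks"
  using assms by (simp add: tuples_iff)

lemma tuples_map2:
  assumes "xs \<in> tuples X ks" and "\<And>k x. x \<in> X k \<Longrightarrow> f k x \<in> Z k"
  shows "map2 f ks xs \<in> tuples Z ks"
  using assms by (simp add: tuples_iff)

lemma tuples_map:
  assumes "\<And>k. k \<in> set ks \<Longrightarrow> f k \<in> Z k"
  shows "map f ks \<in> tuples Z ks"
  using assms by (simp add: tuples_iff)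

lemma length_permute [simp]: "length (permute \<sigma> xs) = length xs"
  by (simp add: permute_def del: upt_Suc)

lemma nth_permute: "i < length xs \<Longrightarrow> permute \<sigma> xs ! i = xs ! (inv' \<sigma> (Suc i) - Suc 0)"
  by (simp add: permute_def nth1_def del: upt_Suc)

lemma permutes_index_less:
  assumes "\<sigma> permutes {Suc 0..n}" "i < n"
  shows "inv' \<sigma> (Suc i) - Suc 0 < n"
proof -
  have "inv' \<sigma> (Suc i) \<in> {Suc 0..n}"
    using permutes_in_image[OF permutes_inv[OF assms(1)], of "Suc i"] assms(2) by simp
  then show ?thesis by auto
qed

text \<open>\<open>permute\<close> is defined through the inverse; in this form position i is
  carried to \<sigma> i and no inverse appears. \<open>permute_eqI\<close> is the matching
  criterion, used for composites and for concatenations.\<close>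

lemma nth1_permute:
  assumes "\<sigma> permutes {1..length xs}" "i \<in> {1..length xs}"
  shows "nth1 (permute \<sigma> xs) (\<sigma> i) = nth1 xs i"
proof -
  have "\<sigma> i \<in> {1..length xs}"
    using assms permutes_in_image by metis
  then show ?thesis
    using permutes_inverses(2)[OF assms(1), of i] by (cases "\<sigma> i") (simp_all add: nth1_def nth_permute)
qed

lemma permute_eqI:
  assumes "\<sigma> permutes {1..length xs}" "length ys = length xs"
    and "\<And>i. i \<in> {1..length xs} \<Longrightarrow> nth1 ys (\<sigma> i) = nth1 xs i"
  shows "permute \<sigma> xs = ys"
proof (rule nth_equalityI)
  fix j assume "j < length (permute \<sigma> xs)"
  then have j: "Suc j \<in> {1..length xs}" by simp
  then have "inv' \<sigma> (Suc j) \<in> {1..length xs}"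
    using permutes_in_image[OF permutes_inv[OF assms(1)]] by blast
  from assms(3)[OF this] show "permute \<sigma> xs ! j = ys ! j"
    using j permutes_inverses(1)[OF assms(1)] by (simp add: nth_permute nth1_def)
qed (simp add: assms)

lemma permute_id [simp]: "permute id xs = xs"
  by (rule nth_equalityI) (simp_all add: nth_permute)

lemma permute_comp:
  assumes "\<sigma> permutes {1..length xs}" "\<tau> permutes {1..length xs}"
  shows "permute (\<sigma> \<circ> \<tau>) xs = permute \<sigma> (permute \<tau> xs)"
proof (rule permute_eqI)
  show "(\<sigma> \<circ> \<tau>) permutes {1..length xs}"
    using assms permutes_compose by blast
  fix i assume i: "i \<in> {1..length xs}"
  then have "\<tau> i \<in> {1..length xs}" using assms permutes_in_image by metis
  then show "nth1 (permute \<sigma> (permute \<tau> xs)) ((\<sigma> \<circ> \<tau>) i) = nth1 xs i"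
    using i assms by (simp add: nth1_permute)
qed simp

lemma permute_map:
  assumes "\<sigma> permutes {1..length xs}"
  shows "permute \<sigma> (map f xs) = map f (permute \<sigma> xs)"
  using assms by (intro nth_equalityI) (simp_all add: nth_permute permutes_index_less)

lemma permute_map2:
  assumes "\<sigma> permutes {1..length xs}" "length ys = length xs"
  shows "permute \<sigma> (map2 f xs ys) = map2 f (permute \<sigma> xs) (permute \<sigma> ys)"
  using assms by (intro nth_equalityI) (simp_all add: nth_permute permutes_index_less)

lemma permute_map3:
  assumes "\<sigma> permutes {1..length xs}" "length ys = length xs" "length zs = length xs"
  shows "permute \<sigma> (map3 f xs ys zs) = map3 f (permute \<sigma> xs) (permute \<sigma> ys) (permute \<sigma> zs)"
  using assms by (intro nth_equalityI) (simp_all add: nth_permute permutes_index_less)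

lemma permute_replicate:
  assumes "\<sigma> permutes {1..n}"
  shows "permute \<sigma> (replicate n x) = replicate n x"
  using assms by (intro nth_equalityI) (simp_all add: nth_permute permutes_index_less)

lemma permute_singleton: "\<sigma> permutes {Suc 0} \<Longrightarrow> permute \<sigma> [x] = [x]"
  using permute_replicate[of \<sigma> 1 x] by simp

lemma permute_tuples:
  assumes "\<sigma> permutes {1..length ks}" "ys \<in> tuples X ks"
  shows "permute \<sigma> ys \<in> tuples X (permute \<sigma> ks)"
  using assms by (simp add: tuples_iff nth_permute permutes_index_less)

text \<open>Needed for sums: permuting the arities of the inputs leaves the total arity
  unchanged.\<close>

lemma mset_permute:
  assumes "\<sigma> permutes {1..length xs}"
  shows "mset (permute \<sigma> xs) = mset xs"
proof -
  have "mset (permute \<sigma> xs) = image_mset (nth1 xs) (image_mset (inv' \<sigma>) (mset_set {1..length xs}))"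
    unfolding permute_def
    by (simp add: multiset.map_comp o_def atLeastLessThanSuc_atLeastAtMost del: upt_Suc)
  also have "image_mset (inv' \<sigma>) (mset_set {1..length xs}) = mset_set {1..length xs}"
    using permutes_image_mset[OF permutes_inv[OF assms]] by simp
  also have "image_mset (nth1 xs) (mset_set {1..length xs}) = mset (map (nth1 xs) [1..<length xs + 1])"
    by (simp add: atLeastLessThanSuc_atLeastAtMost del: upt_Suc)
  also have "map (nth1 xs) [1..<length xs + 1] = xs"
    by (rule nth_equalityI) (simp_all add: nth1_def del: upt_Suc)
  finally show ?thesis .
qed

lemma sum_list_permute:
  "\<sigma> permutes {1..length xs} \<Longrightarrow> sum_list (permute \<sigma> xs) = sum_list (xs :: nat list)"
  by (metis mset_permute sum_mset_sum_list)

section \<open>Positions in a concatenation as pairs of a block and a place in it\<close>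

lemma offset_Suc: "i \<ge> 1 \<Longrightarrow> i \<le> length ks \<Longrightarrow> offset ks (Suc i) = offset ks i + nth1 ks i"
  by (cases i) (simp_all add: offset_def nth1_def take_Suc_conv_app_nth)

text \<open>Partial sums increase weakly and the first \<open>i - 1\<close> blocks end at the
  offset, so no smaller index reaches a position beyond it. Empty blocks are never selected because
  a lies between 1 and the length of its block.\<close>

lemma block_of_offset:
  assumes "i \<in> {1..length ks}" "a \<in> {1..nth1 ks i}"
  shows "block_of ks (offset ks i + a) = i"
  unfolding block_of_def
proof (rule Least_equality)
  show "offset ks i + a \<le> sum_list (take i ks)"
    using assms offset_Suc[of i ks] by (simp add: offset_def)
next
  fix j assume j: "offset ks i + a \<le> sum_list (take j ks)"
  show "i \<le> j"
  proof (rule ccontr)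
    assume "\<not> i \<le> j"
    then have "j \<le> i - 1" by simp
    then obtain d where d: "i - 1 = j + d" using le_Suc_ex by blast
    have "sum_list (take j ks) \<le> offset ks i"
      unfolding offset_def d take_add by simp
    with j assms show False by simp
  qed
qed

lemma ex_offset:
  assumes "m \<in> {1..sum_list ks}"
  obtains i a where "i \<in> {1..length ks}" "a \<in> {1..nth1 ks i}" "m = offset ks i + a"
proof -
  have "\<exists>i a. i \<in> {1..length ks} \<and> a \<in> {1..nth1 ks i} \<and> m = offset ks i + a"
    using assms
  proof (induction ks arbitrary: m)
    case (Cons k ks)
    show ?case
    proof (cases "m \<le> k")
      case True
      then show ?thesis using Cons.prems
        by (intro exI[of _ 1] exI[of _ m]) (simp add: nth1_def offset_def)
    next
      case False
      then have "m - k \<in> {1..sum_list ks}" using Cons.prems by auto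
      from Cons.IH[OF this] obtain i a where ia: "i \<in> {1..length ks}" "a \<in> {1..nth1 ks i}"
        "m - k = offset ks i + a" by blast
      \<comment> \<open>Putting k in front raises block numbers by one and offsets by k.\<close>
      have "offset (k # ks) (Suc i) = k + offset ks i" "nth1 (k # ks) (Suc i) = nth1 ks i"
        using ia(1) by (cases i; simp add: offset_def nth1_def)+
      then show ?thesis using ia False
        by (intro exI[of _ "Suc i"] exI[of _ a]) auto
    qed
  qed simp
  then show ?thesis using that by blast
qed

lemma offset_le:
  assumes "i \<in> {1..length ks}" "a \<in> {1..nth1 ks i}"
  shows "offset ks i + a \<in> {1..sum_list ks}"
proof -
  have "offset ks (Suc i) \<le> sum_list ks"
    by (simp add: offset_def) (metis append_take_drop_id le_add1 sum_list_append)
  then show ?thesis using assms offset_Suc[of i ks] by simp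
qed

lemma nth1_concat:
  assumes "i \<in> {1..length xss}" "a \<in> {1..length (nth1 xss i)}"
  shows "nth1 (concat xss) (offset (map length xss) i + a) = nth1 (nth1 xss i) a"
  using assms
proof (induction xss arbitrary: i)
  case (Cons xs xss)
  show ?case
  proof (cases "i = 1")
    case True
    then show ?thesis using Cons.prems by (auto simp: nth1_def offset_def nth_append)
  next
    case False
    with Cons.prems(1) obtain j where j: "i = Suc j" "j \<in> {1..length xss}"
      by (cases i) auto
    have o: "offset (map length (xs # xss)) i = length xs + offset (map length xss) j"
      and n: "nth1 (xs # xss) i = nth1 xss j"
      using j by (cases j; simp add: offset_def nth1_def)+
    have "nth1 (concat xss) (offset (map length xss) j + a) = nth1 (nth1 xss j) a"
      using Cons j n by simp
    moreover obtain b where "a = Suc b" using Cons.prems(2) by (cases a) auto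
    ultimately show ?thesis unfolding o n by (simp add: nth1_def nth_append)
  qed
qed simp

lemma length_nth1: "i \<in> {1..length xss} \<Longrightarrow> nth1 (map length xss) i = length (nth1 xss i)"
  by (cases i) (simp_all add: nth1_def)

text \<open>The sum in \<open>block_perm\<close> runs over the blocks that \<sigma> places before
  block i. These are the blocks to the left of position \<sigma> i in the permuted list, listed
  there in a different order.\<close>

lemma offset_permute:
  assumes s: "\<sigma> permutes {1..length ks}" and i: "i \<in> {1..length ks}"
  shows "offset (permute \<sigma> ks) (\<sigma> i) = (\<Sum>j\<in>{j\<in>{1..length ks}. \<sigma> j < \<sigma> i}. nth1 ks j)"
proof -
  have si: "\<sigma> i \<in> {1..length ks}" using i permutes_in_image[OF s] by blast
  have "offset (permute \<sigma> ks) (\<sigma> i) = (\<Sum>l<\<sigma> i - 1. permute \<sigma> ks ! l)"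
    unfolding offset_def using si by (subst sum_list_sum_nth) (auto simp: atLeast0LessThan min_def)
  \<comment> \<open>Shift from list indices, which start at 0, to positions, which start at
    1.\<close>
  also have "\<dots> = (\<Sum>l\<in>{1..<\<sigma> i}. nth1 (permute \<sigma> ks) l)"
    by (rule sum.reindex_bij_witness[of _ "\<lambda>l. l - 1" Suc]) (auto simp: nth1_def)
  also have "\<dots> = (\<Sum>j\<in>{j\<in>{1..length ks}. \<sigma> j < \<sigma> i}. nth1 (permute \<sigma> ks) (\<sigma> j))"
  proof (rule sum.reindex_bij_witness[of _ \<sigma> "inv' \<sigma>"])
    fix l assume l: "l \<in> {1..<\<sigma> i}"
    then have "l \<in> {1..length ks}" using si by simp
    then have "inv' \<sigma> l \<in> {1..length ks}"
      using permutes_in_image[OF permutes_inv[OF s]] by blast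
    then show "inv' \<sigma> l \<in> {j\<in>{1..length ks}. \<sigma> j < \<sigma> i}"
      using l permutes_inverses(1)[OF s] by simp
  next
    fix j assume "j \<in> {j\<in>{1..length ks}. \<sigma> j < \<sigma> i}"
    then have "\<sigma> j \<in> {1..length ks}" "\<sigma> j < \<sigma> i" using permutes_in_image[OF s] by blast+
    then show "\<sigma> j \<in> {1..<\<sigma> i}" by simp
  qed (simp_all add: permutes_inverses[OF s])
  also have "\<dots> = (\<Sum>j\<in>{j\<in>{1..length ks}. \<sigma> j < \<sigma> i}. nth1 ks j)"
    using nth1_permute[OF s] by (intro sum.cong) auto
  finally show ?thesis .
qed

lemma block_perm_offset:
  assumes "\<sigma> permutes {1..length ks}" "i \<in> {1..length ks}" "a \<in> {1..nth1 ks i}"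
  shows "block_perm ks \<sigma> (offset ks i + a) = offset (permute \<sigma> ks) (\<sigma> i) + a"
  using offset_le[OF assms(2,3)] assms(3)
  by (simp add: block_perm_def Let_def block_of_offset[OF assms(2,3)] offset_permute[OF assms(1,2)])

lemma block_sum_offset:
  assumes "i \<in> {1..length ks}" "a \<in> {1..nth1 ks i}"
  shows "block_sum ks \<tau>s (offset ks i + a) = offset ks i + nth1 \<tau>s i a"
  using offset_le[OF assms] assms(2)
  by (simp add: block_sum_def Let_def block_of_offset[OF assms])

text \<open>The only property of the operad of symmetric groups that the theorem depends on.\<close>

lemma permute_concat:
  assumes s: "\<sigma> permutes {1..length xss}"
    and l: "length \<tau>s = length xss"
    and t: "\<And>i. i < length xss \<Longrightarrow> \<tau>s ! i permutes {1..length (xss ! i)}"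
    and perm: "(block_perm (map length xss) \<sigma> \<circ> block_sum (map length xss) \<tau>s)
      permutes {1..length (concat xss)}"
  shows "permute (block_perm (map length xss) \<sigma> \<circ> block_sum (map length xss) \<tau>s) (concat xss)
    = concat (permute \<sigma> (map2 permute \<tau>s xss))"
proof (rule permute_eqI[OF perm])
  let ?ks = "map length xss" and ?yss = "map2 permute \<tau>s xss"
  have lk: "map length ?yss = ?ks"
    using l by (intro nth_equalityI) simp_all
  have ly: "length ?yss = length xss" using l by simp
  have s': "\<sigma> permutes {1..length ?yss}" "\<sigma> permutes {1..length ?ks}" using s ly by simp_all
  have lp: "map length (permute \<sigma> ?yss) = permute \<sigma> ?ks"
    using permute_map[OF s'(1), of length] lk by simp
  show "length (concat (permute \<sigma> ?yss)) = length (concat xss)"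
    using sum_list_permute[OF s'(2)] by (simp add: length_concat lp)
  fix m assume "m \<in> {1..length (concat xss)}"
  then have "m \<in> {1..sum_list ?ks}" by (simp add: length_concat)
  then obtain i a where i: "i \<in> {1..length ?ks}" and a: "a \<in> {1..nth1 ?ks i}" and m: "m = offset ?ks i + a"
    by (rule ex_offset)
  have i': "i \<in> {1..length xss}" using i by simp
  have a': "a \<in> {1..length (nth1 xss i)}" using a length_nth1[OF i'] by simp
  have ti: "nth1 \<tau>s i permutes {1..length (nth1 xss i)}"
    using t[of "i - 1"] i' by (auto simp: nth1_def)
  then have ta: "nth1 \<tau>s i a \<in> {1..length (nth1 xss i)}" using a' permutes_in_image by metis
  then have ta': "nth1 \<tau>s i a \<in> {1..nth1 ?ks i}" using length_nth1[OF i'] by simp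
  have si: "\<sigma> i \<in> {1..length (permute \<sigma> ?yss)}" using i' permutes_in_image[OF s] ly by auto
  have yi: "nth1 ?yss i = permute (nth1 \<tau>s i) (nth1 xss i)"
    using i' l by (auto simp: nth1_def)
  have pi: "nth1 (permute \<sigma> ?yss) (\<sigma> i) = nth1 ?yss i"
    by (rule nth1_permute[OF s'(1)]) (use i' l in simp)
  \<comment> \<open>\<open>block_sum\<close> moves the place a to \<tau>_i(a) inside block i, and
    \<open>block_perm\<close> then moves the block to position \<sigma> i without disturbing its
    order.\<close>
  have "(block_perm ?ks \<sigma> \<circ> block_sum ?ks \<tau>s) m = offset (permute \<sigma> ?ks) (\<sigma> i) + nth1 \<tau>s i a"
    unfolding m using block_sum_offset[OF i a] block_perm_offset[OF s'(2) i ta'] by simp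
  moreover have "nth1 (concat (permute \<sigma> ?yss)) (offset (permute \<sigma> ?ks) (\<sigma> i) + nth1 \<tau>s i a)
      = nth1 (nth1 ?yss i) (nth1 \<tau>s i a)"
    using nth1_concat[OF si, of "nth1 \<tau>s i a"] ta unfolding pi lp by (simp add: yi)
  moreover have "\<dots> = nth1 (nth1 xss i) a"
    unfolding yi by (rule nth1_permute[OF ti a'])
  moreover have "nth1 (concat xss) m = nth1 (nth1 xss i) a"
    unfolding m by (rule nth1_concat[OF i' a'])
  ultimately show "nth1 (concat (permute \<sigma> ?yss)) ((block_perm ?ks \<sigma> \<circ> block_sum ?ks \<tau>s) m)
      = nth1 (concat xss) m"
    by simp
qed

section \<open>Cutting lists into consecutive blocks\<close>

fun split :: "nat list \<Rightarrow> 'a list \<Rightarrow> 'a list list" where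
  "split [] xs = []"
| "split (k # ks) xs = take k xs # split ks (drop k xs)"

lemma split_concat: "split (map length xss) (concat xss) = xss"
  by (induction xss) simp_all

lemma concat_split: "length xs = sum_list ks \<Longrightarrow> concat (split ks xs) = xs"
  by (induction ks arbitrary: xs) simp_all

lemma map_length_split: "length xs = sum_list ks \<Longrightarrow> map length (split ks xs) = ks"
  by (induction ks arbitrary: xs) simp_all

lemma list_all2_tuples_concat:
  "tuple_lists Z zss kss \<Longrightarrow> concat zss \<in> tuples Z (concat kss)"
  by (induction rule: list_all2_induct) (auto simp: tuples_def intro: list_all2_appendI)

lemma list_all2_tuples_length:
  "tuple_lists Z zss kss \<Longrightarrow> map length zss = map length kss"
  by (induction rule: list_all2_induct) (auto simp: tuples_def list_all2_lengthD)

text \<open>When operations are plugged into a composite (x; y) whose inputs have arities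
  \<open>ks\<close>, the plugged tuple falls into blocks, the i-th of which feeds the i-th entry of
  y.\<close>

lemma ex_split_tuples:
  assumes "zs \<in> tuples Z ls" "length ls = sum_list ks"
  obtains kss zss where "ls = concat kss" "map length kss = ks" "zs = concat zss"
    "tuple_lists Z zss kss"
proof -
  have "tuple_lists Z (split ks zs) (split ks ls)"
    using assms
  proof (induction ks arbitrary: zs ls)
    case (Cons k ks)
    then have "drop k zs \<in> tuples Z (drop k ls)" "take k zs \<in> tuples Z (take k ls)"
      by (simp_all add: tuples_def list_all2_dropI list_all2_takeI)
    with Cons show ?case by simp
  qed simp
  moreover have "length zs = sum_list ks" using assms by (simp add: tuples_iff)
  ultimately show ?thesis
    using that assms(2) by (metis concat_split map_length_split)
qed

lemma sum_list_concat: "sum_list (concat kss) = sum_list (map sum_list kss)" for kss :: "nat list list"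
  by (induction kss) simp_all

lemma map3_append:
  "length xs = length ys \<Longrightarrow> length ys = length zs \<Longrightarrow>
   map3 f (xs @ xs') (ys @ ys') (zs @ zs') = map3 f xs ys zs @ map3 f xs' ys' zs'"
  by (simp add: map3_def)

lemma ex_tuple_lists:
  assumes "zs \<in> tuples Z (concat kss)"
  obtains zss where "zs = concat zss" "tuple_lists Z zss kss"
proof -
  have "\<exists>zss. zs = concat zss \<and> tuple_lists Z zss kss"
    using assms
  proof (induction kss arbitrary: zs)
    case (Cons ks kss)
    then obtain us vs where zs: "zs = us @ vs" "us \<in> tuples Z ks" "vs \<in> tuples Z (concat kss)"
      by (auto simp: tuples_def list_all2_append2)
    from Cons.IH[OF zs(3)] obtain zss where "vs = concat zss" "tuple_lists Z zss kss" by blast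
    then show ?case using zs by (intro exI[of _ "us # zss"]) simp
  qed simp
  then show ?thesis using that by blast
qed

lemma concat_map3_length:
  assumes "list_all2 (\<lambda>ys xs. length ys = length xs) yss xss"
    and "list_all2 (\<lambda>zs xs. length zs = length xs) zss xss"
  shows "concat (map3 (map3 f) xss yss zss) = map3 f (concat xss) (concat yss) (concat zss)"
  using assms
proof (induction arbitrary: zss rule: list_all2_induct)
  case (Cons ys yss xs xss)
  then show ?case by (auto simp: list_all2_Cons2 map3_append)
qed simp

lemma concat_map3:
  assumes "tuple_lists Y yss kss" "tuple_lists Z zss kss"
  shows "concat (map3 (map3 f) kss yss zss) = map3 f (concat kss) (concat yss) (concat zss)"
  using concat_map3_length[OF list_all2_mono[OF assms(1) length_tuples] list_all2_mono[OF assms(2) length_tuples]] .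

lemma tuple_lists_iff:
  "tuple_lists Z zss kss \<longleftrightarrow> length zss = length kss \<and> (\<forall>i<length kss. zss ! i \<in> tuples Z (kss ! i))"
  by (auto simp: list_all2_conv_all_nth)

lemma tuple_lists_permute:
  assumes "\<sigma> permutes {1..length kss}" "tuple_lists Z zss kss"
  shows "tuple_lists Z (permute \<sigma> zss) (permute \<sigma> kss)"
  using assms by (simp add: tuple_lists_iff nth_permute permutes_index_less)

text \<open>Counterpart of \<open>ex_tuple_lists\<close> one level of nesting higher, for the
  fourfold products of the pentagon.\<close>

lemma list_all2_concat_right:
  assumes "list_all2 P xs (concat yss)"
  obtains xss where "xs = concat xss" "list_all2 (list_all2 P) xss yss"
proof -
  have "\<exists>xss. xs = concat xss \<and> list_all2 (list_all2 P) xss yss"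
    using assms
  proof (induction yss arbitrary: xs)
    case (Cons ys yss)
    then obtain us vs where xs: "xs = us @ vs" "list_all2 P us ys" "list_all2 P vs (concat yss)"
      by (auto simp: list_all2_append2)
    from Cons.IH[OF xs(3)] obtain xss where "vs = concat xss" "list_all2 (list_all2 P) xss yss" by blast
    then show ?case using xs by (intro exI[of _ "us # xss"]) simp
  qed simp
  then show ?thesis using that by blast
qed

lemma map2_concat:
  assumes "list_all2 (\<lambda>ys xs. length ys = length xs) yss xss"
  shows "concat (map2 (map2 f) xss yss) = map2 f (concat xss) (concat yss)"
  using assms by (induction rule: list_all2_induct) simp_all

lemma list_all2_concat_lists:
  "list_all2 (list_all2 P) xss yss \<Longrightarrow> list_all2 P (concat xss) (concat yss)"
  by (induction rule: list_all2_induct) (auto intro: list_all2_appendI)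

lemma concat_map_concat: "concat (map concat xsss) = concat (concat xsss)"
  by (induction xsss) simp_all

section \<open>Smallness and coding\<close>

context set_universe
begin

text \<open>An infinite small set contains a copy of the naturals, and subsets and images of small
  sets are small. Singletons, pairs and countable unions are obtained from this.\<close>

lemma small_range_nat: "small (range (f :: nat \<Rightarrow> 'u))"
proof -
  obtain A where "small A" "infinite A" using small_infinite by blast
  then obtain i :: "nat \<Rightarrow> 'u" where i: "inj i" "range i \<subseteq> A"
    using infinite_countable_subset by blast
  have "small ((\<lambda>x. f (inv' i x)) ` range i)"
    using small_image small_subset[OF \<open>small A\<close> i(2)] by blast
  then show ?thesis using i(1) by (simp add: image_image)
qed

lemma small_pair: "small {x, y}"
proof -
  have "{x, y} = range (\<lambda>n :: nat. if n = 0 then x else y)"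
    by (force split: if_splits)
  then show ?thesis by (metis small_range_nat)
qed

lemma small_singleton: "small {x}"
  using small_pair[of x x] by simp

lemma small_empty: "small {}"
  using small_subset[OF small_singleton] by blast

lemma code_eq_iff: "small A \<Longrightarrow> small B \<Longrightarrow> code A = code B \<longleftrightarrow> A = B"
  using inj_code by (auto simp: inj_on_def)

lemma code_nat_eq_iff: "code_nat code m = code_nat code n \<longleftrightarrow> m = n"
proof (induction m arbitrary: n)
  case 0
  show ?case by (cases n) (simp_all add: code_eq_iff small_empty small_singleton)
next
  case (Suc m)
  show ?case by (cases n) (simp_all add: code_eq_iff small_empty small_singleton Suc.IH)
qed

lemma code_pair_eq_iff: "code_pair code x y = code_pair code x' y' \<longleftrightarrow> x = x' \<and> y = y'"
  by (auto simp: code_pair_def code_eq_iff small_pair small_singleton doubleton_eq_iff)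

lemma code_pair_neq: "code_pair code x y \<noteq> code {}"
  by (simp add: code_pair_def code_eq_iff small_pair small_empty)

lemma code_list_eq_iff: "code_list code xs = code_list code ys \<longleftrightarrow> xs = ys"
proof (induction xs arbitrary: ys)
  case Nil
  show ?case by (cases ys) (simp_all add: code_pair_neq[symmetric])
next
  case (Cons x xs)
  show ?case by (cases ys) (simp_all add: code_pair_neq code_pair_eq_iff Cons.IH)
qed

lemma code_raw_eq_iff: "code_raw code t = code_raw code t' \<longleftrightarrow> t = t'"
proof -
  obtain ks x ys g ks' x' ys' g' where t: "t = (ks, x, ys, g)" "t' = (ks', x', ys', g')"
    using prod_cases4 by metis
  have "inj (code_nat code)" by (simp add: inj_def code_nat_eq_iff)
  then have "map (code_nat code) ks = map (code_nat code) ks' \<longleftrightarrow> ks = ks'"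
    by (rule inj_map_eq_map)
  then show ?thesis unfolding t code_raw_def prod.case code_list_eq_iff by (simp add: code_list_eq_iff)
qed

text \<open>\<open>small_UN\<close> takes its index set inside \<open>'u\<close>, so the naturals
  enter through their codes.\<close>

lemma small_UN_nat:
  assumes "\<And>n :: nat. small (F n)"
  shows "small (\<Union>n. F n)"
proof -
  have i: "inj (code_nat code)" by (simp add: inj_def code_nat_eq_iff)
  have "small (\<Union>x\<in>range (code_nat code). F (inv' (code_nat code) x))"
    by (rule small_UN[OF small_range_nat assms])
  then show ?thesis using i by simp
qed

lemma small_Un:
  assumes "small A" "small B"
  shows "small (A \<union> B)"
proof -
  have "small (\<Union>n :: nat. if n = 0 then A else B)"
    using assms by (intro small_UN_nat) simp
  moreover have "(\<Union>n :: nat. if n = 0 then A else B) = A \<union> B"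
    by (force split: if_splits)
  ultimately show ?thesis by simp
qed

text \<open>A countable union over the length; each length comes from the previous one by a union
  over the heads in A.\<close>

lemma small_code_list:
  assumes "small A"
  shows "small (code_list code ` lists A)"
proof -
  have "small (code_list code ` {xs \<in> lists A. length xs = n})" for n
  proof (induction n)
    case 0
    have "{xs \<in> lists A. length xs = 0} = {[]}" by auto
    then show ?case by (simp add: small_singleton)
  next
    case (Suc n)
    have "{xs \<in> lists A. length xs = Suc n} = (\<Union>x\<in>A. (#) x ` {xs \<in> lists A. length xs = n})"
      by (auto simp: length_Suc_conv intro!: UN_I imageI)
    then have "code_list code ` {xs \<in> lists A. length xs = Suc n}
      = (\<Union>x\<in>A. code_pair code x ` code_list code ` {xs \<in> lists A. length xs = n})"
      by (simp add: image_UN image_image)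
    then show ?case using small_UN[OF assms] small_image[OF Suc] by simp
  qed
  then have "small (\<Union>n. code_list code ` {xs \<in> lists A. length xs = n})"
    by (rule small_UN_nat)
  then show ?thesis by (rule small_subset) auto
qed

lemma small_raws:
  assumes "\<And>n. small (ops L n)" "\<And>n. small (cset X n)" "\<And>n. small (cset Y n)"
  shows "small (code_raw code ` raws L X Y k)"
proof -
  \<comment> \<open>U contains everything that can be one of the four coordinates in
    \<open>code_raw\<close>, so a raw element is coded by a list over U.\<close>
  define U where "U = code_list code ` lists (range (code_nat code)) \<union> (\<Union>n. cset X n)
    \<union> (code_list code ` lists (\<Union>n. cset Y n) \<union> ops L k)"
  have "small U"
    unfolding U_def using assms
    by (intro small_Un small_code_list small_UN_nat small_range_nat)
  moreover have "code_raw code ` raws L X Y k \<subseteq> code_list code ` lists U"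
  proof
    fix c assume "c \<in> code_raw code ` raws L X Y k"
    then obtain ks x ys g where c: "c = code_raw code (ks, x, ys, g)"
      and t: "(ks, x, ys, g) \<in> raws L X Y k" by auto
    have "ys \<in> lists (\<Union>n. cset Y n)"
      using t by (fastforce simp: raws_def tuples_iff in_set_conv_nth)
    moreover have "map (code_nat code) ks \<in> lists (range (code_nat code))"
      by auto
    ultimately have "[code_list code (map (code_nat code) ks), x, code_list code ys, g] \<in> lists U"
      using t unfolding U_def raws_def by (auto simp del: in_listsI)
    then show "c \<in> code_list code ` lists U"
      unfolding c code_raw_def by (simp del: code_list.simps)
  qed
  ultimately show ?thesis using small_code_list small_subset by blast
qed

end

section \<open>Calculus in an action operad\<close>

locale action_op =
  fixes L :: "('a, 'z) group_operad_scheme"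
  assumes action_operad: "action_operad L"
begin

abbreviation e :: "nat \<Rightarrow> 'a" where "e n \<equiv> \<one>\<^bsub>gr L n\<^esub>"

abbreviation muls :: "nat list \<Rightarrow> 'a list \<Rightarrow> 'a list \<Rightarrow> 'a list" where
  "muls \<equiv> map3 (\<lambda>k. mult (gr L k))"

abbreviation pm :: "nat \<Rightarrow> 'a \<Rightarrow> 'b list \<Rightarrow> 'b list" where "pm n g \<equiv> permute (pr L n g)"

lemma group_gr: "group (gr L n)" and carrier_gr: "carrier (gr L n) = ops L n"
  using action_operad by (simp_all add: action_operad_def)

lemma operad_L: "operad L"
  using action_operad by (simp add: action_operad_def)

lemma operad_map_pr: "operad_map L sym_operad (pr L)"
  using action_operad by (simp add: action_operad_def)

lemma e_in [simp]: "e n \<in> ops L n"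
  using monoid.one_closed[OF group.is_monoid[OF group_gr]] by (simp add: carrier_gr)

lemma mult_in [simp]: "g \<in> ops L n \<Longrightarrow> h \<in> ops L n \<Longrightarrow> g \<otimes>\<^bsub>gr L n\<^esub> h \<in> ops L n"
  using monoid.m_closed[OF group.is_monoid[OF group_gr]] by (simp add: carrier_gr)

lemma mult_assoc:
  "f \<in> ops L n \<Longrightarrow> g \<in> ops L n \<Longrightarrow> h \<in> ops L n \<Longrightarrow>
   f \<otimes>\<^bsub>gr L n\<^esub> g \<otimes>\<^bsub>gr L n\<^esub> h = f \<otimes>\<^bsub>gr L n\<^esub> (g \<otimes>\<^bsub>gr L n\<^esub> h)"
  using monoid.m_assoc[OF group.is_monoid[OF group_gr]] by (simp add: carrier_gr)

lemma e_mult [simp]: "g \<in> ops L n \<Longrightarrow> e n \<otimes>\<^bsub>gr L n\<^esub> g = g"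
  using monoid.l_one[OF group.is_monoid[OF group_gr]] by (simp add: carrier_gr)

lemma mult_e [simp]: "g \<in> ops L n \<Longrightarrow> g \<otimes>\<^bsub>gr L n\<^esub> e n = g"
  using monoid.r_one[OF group.is_monoid[OF group_gr]] by (simp add: carrier_gr)

lemma idem_eq_e: "g \<in> ops L n \<Longrightarrow> g \<otimes>\<^bsub>gr L n\<^esub> g = g \<Longrightarrow> g = e n"
  using group.l_cancel_one'[OF group_gr] by (metis carrier_gr)

lemma pr_hom: "pr L n \<in> hom (gr L n) (sym_group n)"
  using action_operad by (simp add: action_operad_def)

lemma pr_permutes [simp]: "g \<in> ops L n \<Longrightarrow> pr L n g permutes {Suc 0..n}"
  using pr_hom[of n] by (auto simp: hom_def carrier_gr sym_group_def)

lemma pr_mult: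
  "g \<in> ops L n \<Longrightarrow> h \<in> ops L n \<Longrightarrow> pr L n (g \<otimes>\<^bsub>gr L n\<^esub> h) = pr L n g \<circ> pr L n h"
  using pr_hom[of n] by (auto simp: hom_def carrier_gr sym_group_def)

lemma pr_e [simp]: "pr L n (e n) = id"
  using group_hom.hom_one[OF group_hom.intro[OF group_gr sym_group_is_group group_hom_axioms.intro[OF pr_hom]]]
  by (simp add: sym_group_one)

lemma pm_mult:
  "g \<in> ops L (length xs) \<Longrightarrow> h \<in> ops L (length xs) \<Longrightarrow>
   pm (length xs) (g \<otimes>\<^bsub>gr L (length xs)\<^esub> h) xs = pm (length xs) g (pm (length xs) h xs)"
  by (simp add: pr_mult permute_comp)

lemma pm_tuples [simp]:
  "g \<in> ops L (length ks) \<Longrightarrow> ys \<in> tuples X ks \<Longrightarrow> pm (length ks) g ys \<in> tuples X (pm (length ks) g ks)"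
  by (rule permute_tuples) simp_all

lemma sum_list_pm [simp]:
  "g \<in> ops L (length ks) \<Longrightarrow> sum_list (pm (length ks) g ks) = sum_list (ks :: nat list)"
  by (rule sum_list_permute) simp

lemma es_in [simp]: "map e ks \<in> tuples (ops L) ks"
  by (rule tuples_map) simp

lemma mu_in [simp]:
  "g \<in> ops L (length ks) \<Longrightarrow> fs \<in> tuples (ops L) ks \<Longrightarrow> mu L ks g fs \<in> ops L (sum_list ks)"
  using operad_L by (simp add: operad_def)

lemma delta_in [simp]: "g \<in> ops L (length ks) \<Longrightarrow> delta L ks g \<in> ops L (sum_list ks)"
  by (simp add: delta_def)

lemma beta_in [simp]: "gs \<in> tuples (ops L) ks \<Longrightarrow> beta L ks gs \<in> ops L (sum_list ks)"
  by (simp add: beta_def)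

text \<open>The interchange axiom indexes the left tuple by permuted positions. Writing that tuple
  as \<open>pm (length ks) g fs'\<close> aligns it with \<open>fs\<close> entry by entry. The
  product rules for \<beta> and \<delta> below arise by making some of the arguments
  neutral.\<close>

lemma mu_mult:
  assumes g: "g \<in> ops L (length ks)" and g': "g' \<in> ops L (length ks)"
    and fs: "fs \<in> tuples (ops L) ks" and fs': "fs' \<in> tuples (ops L) ks"
  shows "mu L (pm (length ks) g ks) g' (pm (length ks) g fs') \<otimes>\<^bsub>gr L (sum_list ks)\<^esub> mu L ks g fs
    = mu L ks (g' \<otimes>\<^bsub>gr L (length ks)\<^esub> g) (muls ks fs' fs)"
proof -
  let ?n = "length ks" and ?\<sigma> = "pr L (length ks) g"
  have "mu L (permute ?\<sigma> ks) g' (permute ?\<sigma> fs') \<otimes>\<^bsub>gr L (sum_list ks)\<^esub> mu L ks g fs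
      = mu L ks (g' \<otimes>\<^bsub>gr L ?n\<^esub> g)
          (map (\<lambda>i. nth1 (permute ?\<sigma> fs') (?\<sigma> i) \<otimes>\<^bsub>gr L (nth1 ks i)\<^esub> nth1 fs i) [1..<?n + 1])"
    using action_operad g g' fs pm_tuples[OF g fs'] unfolding action_operad_def by blast
  also have "map (\<lambda>i. nth1 (permute ?\<sigma> fs') (?\<sigma> i) \<otimes>\<^bsub>gr L (nth1 ks i)\<^esub> nth1 fs i) [1..<?n + 1]
      = muls ks fs' fs"
    using g fs fs' nth1_permute[of ?\<sigma> fs']
    by (intro nth_equalityI) (simp_all add: tuples_iff nth1_def del: upt_Suc)
  finally show ?thesis .
qed

text \<open>By interchange this element is idempotent, and a group has only one idempotent.\<close>

lemma mu_e: "mu L ks (e (length ks)) (map e ks) = e (sum_list ks)"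
proof (rule idem_eq_e)
  have "muls ks (map e ks) (map e ks) = map e ks"
    by (intro nth_equalityI) simp_all
  then show "mu L ks (e (length ks)) (map e ks) \<otimes>\<^bsub>gr L (sum_list ks)\<^esub> mu L ks (e (length ks)) (map e ks)
      = mu L ks (e (length ks)) (map e ks)"
    using mu_mult[of "e (length ks)" ks "e (length ks)" "map e ks" "map e ks"] by simp
qed simp

lemma delta_e [simp]: "delta L ks (e (length ks)) = e (sum_list ks)"
  by (simp add: delta_def mu_e)

lemma beta_e [simp]: "beta L ks (map e ks) = e (sum_list ks)"
  by (simp add: beta_def mu_e)

lemma mu_oid:
  "g \<in> ops L n \<Longrightarrow> mu L [n] (oid L) [g] = g"
  "g \<in> ops L n \<Longrightarrow> mu L (replicate n (Suc 0)) g (replicate n (oid L)) = g"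
  using operad_L by (simp_all add: operad_def)

text \<open>Eckmann--Hilton: by the interchange law \<open>\<mu> : \<Lambda>(1) \<times> \<Lambda>(1) \<rightarrow> \<Lambda>(1)\<close> is a homomorphism
  with unit \<open>id\<close>.\<close>

lemma oid_eq: "oid L = e (Suc 0)"
proof -
  have o: "oid L \<in> ops L (Suc 0)" using operad_L by (simp add: operad_def)
  have "mu L [Suc 0] (e (Suc 0)) [oid L] \<otimes>\<^bsub>gr L (Suc 0)\<^esub> mu L [Suc 0] (oid L) [e (Suc 0)]
      = mu L [Suc 0] (oid L) [oid L]"
    using mu_mult[of "oid L" "[Suc 0]" "e (Suc 0)" "[e (Suc 0)]" "[oid L]"] o
    using permute_singleton[of "pr L (Suc 0) (oid L)"] pr_permutes[OF o] by simp
  then show ?thesis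
    using mu_oid(1)[OF o] mu_oid(1)[OF e_in] mu_oid(2)[OF e_in, of "Suc 0"] by simp
qed

text \<open>As e_1 is the operadic identity, this is the operad's right unit law. It makes the right
  unitor work.\<close>

lemma delta_ones [simp]: "g \<in> ops L n \<Longrightarrow> delta L (replicate n (Suc 0)) g = g"
  by (simp add: delta_def map_replicate_const mu_oid flip: oid_eq)

lemma beta_single [simp]: "g \<in> ops L n \<Longrightarrow> beta L [n] [g] = g"
  by (simp add: beta_def mu_oid flip: oid_eq)

lemma delta_mult:
  assumes "g \<in> ops L (length ks)" "h \<in> ops L (length ks)"
  shows "delta L (pm (length ks) h ks) g \<otimes>\<^bsub>gr L (sum_list ks)\<^esub> delta L ks h
    = delta L ks (g \<otimes>\<^bsub>gr L (length ks)\<^esub> h)"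
proof -
  have "muls ks (map e ks) (map e ks) = map e ks"
    by (intro nth_equalityI) simp_all
  then show ?thesis
    using mu_mult[of h ks g "map e ks" "map e ks"] assms
    by (simp add: delta_def permute_map)
qed

lemma beta_mult:
  assumes "gs \<in> tuples (ops L) ks" "hs \<in> tuples (ops L) ks"
  shows "beta L ks gs \<otimes>\<^bsub>gr L (sum_list ks)\<^esub> beta L ks hs
    = beta L ks (muls ks gs hs)"
  using mu_mult[of "e (length ks)" ks "e (length ks)" hs gs] assms by (simp add: beta_def)

text \<open>Two factorisations of \<mu>(h; gs), by interchange with neutral elements in one factor.
  Equated, they move \<beta> past \<delta>(h) at the price of permuting the entries; both directions
  of the associator rely on this.\<close>

lemma delta_beta:
  assumes "h \<in> ops L (length ks)" "gs \<in> tuples (ops L) ks"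
  shows "delta L ks h \<otimes>\<^bsub>gr L (sum_list ks)\<^esub> beta L ks gs = mu L ks h gs"
    and "beta L (pm (length ks) h ks) (pm (length ks) h gs) \<otimes>\<^bsub>gr L (sum_list ks)\<^esub> delta L ks h
      = mu L ks h gs"
proof -
  have "muls ks (map e ks) gs = gs"
    "muls ks gs (map e ks) = gs"
    using assms by (auto intro!: nth_equalityI simp: tuples_iff)
  then show "delta L ks h \<otimes>\<^bsub>gr L (sum_list ks)\<^esub> beta L ks gs = mu L ks h gs"
    "beta L (pm (length ks) h ks) (pm (length ks) h gs) \<otimes>\<^bsub>gr L (sum_list ks)\<^esub> delta L ks h
      = mu L ks h gs"
    using mu_mult[of "e (length ks)" ks h gs "map e ks"] mu_mult[of h ks "e (length ks)" "map e ks" gs] assms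
    by (simp_all add: delta_def beta_def)
qed

lemma mu_assoc:
  assumes "g \<in> ops L (length kss)" "hs \<in> tuples (ops L) (map length kss)"
    and "tuple_lists (ops L) fss kss"
  shows "mu L (concat kss) (mu L (map length kss) g hs) (concat fss)
    = mu L (map sum_list kss) g (map3 (mu L) kss hs fss)"
  using operad_L assms unfolding operad_def by blast

lemma list_all2_es: "tuple_lists (ops L) (map (map e) kss) kss"
  by (simp add: list_all2_conv_all_nth)

text \<open>This and the next two are operad associativity with neutral elements on two of the three
  levels: only the outermost operation is kept here, then only the middle ones, then only the
  innermost ones.\<close>

lemma delta_delta:
  assumes "g \<in> ops L (length kss)"
  shows "delta L (concat kss) (delta L (map length kss) g) = delta L (map sum_list kss) g"
proof -
  have "map3 (mu L) kss (map e (map length kss)) (map (map e) kss) = map e (map sum_list kss)"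
    by (intro nth_equalityI) (simp_all add: mu_e)
  then show ?thesis
    using mu_assoc[OF assms _ list_all2_es, of "map e (map length kss)"]
    by (simp add: delta_def map_concat del: map_map)
qed

lemma delta_beta_concat:
  assumes "hs \<in> tuples (ops L) (map length kss)"
  shows "delta L (concat kss) (beta L (map length kss) hs)
    = beta L (map sum_list kss) (map2 (delta L) kss hs)"
proof -
  have "map3 (mu L) kss hs (map (map e) kss) = map2 (delta L) kss hs"
    using assms by (intro nth_equalityI) (simp_all add: tuples_iff delta_def)
  then show ?thesis
    using mu_assoc[OF e_in assms list_all2_es]
    by (simp add: delta_def beta_def map_concat del: map_map)
qed

lemma beta_concat:
  assumes "tuple_lists (ops L) fss kss"
  shows "beta L (concat kss) (concat fss) = beta L (map sum_list kss) (map2 (beta L) kss fss)"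
proof -
  have "map3 (mu L) kss (map e (map length kss)) fss = map2 (beta L) kss fss"
    using assms by (intro nth_equalityI) (simp_all add: list_all2_conv_all_nth beta_def)
  then show ?thesis
    using mu_assoc[OF e_in _ assms, of "map e (map length kss)"] mu_e[of "map length kss"]
    by (simp add: beta_def length_concat del: map_map)
qed

lemma pm_mu:
  assumes "g \<in> ops L (length xss)" "hs \<in> tuples (ops L) (map length xss)"
  shows "pm (length (concat xss)) (mu L (map length xss) g hs) (concat xss)
    = concat (pm (length xss) g (map2 (\<lambda>h xs. pm (length xs) h xs) hs xss))"
proof -
  let ?ks = "map length xss"
  have pr: "pr L (sum_list ?ks) (mu L ?ks g hs)
      = block_perm ?ks (pr L (length ?ks) g) \<circ> block_sum ?ks (map2 (pr L) ?ks hs)"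
    using operad_map_pr assms unfolding operad_map_def by (simp add: sym_operad_def)
  have "map2 permute (map2 (pr L) ?ks hs) xss = map2 (\<lambda>h xs. pm (length xs) h xs) hs xss"
    using assms(2) by (intro nth_equalityI) (simp_all add: tuples_iff)
  \<comment> \<open>That the composite permutes the positions of the concatenation needs no
    inspection of blocks: it is the image under \<open>pr\<close> of an element of the action
    operad.\<close>
  moreover have "permute (block_perm ?ks (pr L (length ?ks) g) \<circ> block_sum ?ks (map2 (pr L) ?ks hs)) (concat xss)
      = concat (permute (pr L (length xss) g) (map2 permute (map2 (pr L) ?ks hs) xss))"
    unfolding length_map
    using assms pr pr_permutes[of "mu L ?ks g hs" "sum_list ?ks"]
    by (intro permute_concat) (simp_all add: tuples_iff length_concat)
  ultimately show ?thesis by (simp add: pr length_concat)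
qed

lemma pm_delta:
  assumes "g \<in> ops L (length xss)"
  shows "pm (length (concat xss)) (delta L (map length xss) g) (concat xss)
    = concat (pm (length xss) g xss)"
proof -
  have "map2 (\<lambda>h xs. pm (length xs) h xs) (map e (map length xss)) xss = xss"
    by (intro nth_equalityI) simp_all
  then show ?thesis
    using pm_mu[OF assms, of "map e (map length xss)"] by (simp add: delta_def del: map_map)
qed

lemma pm_beta:
  assumes "hs \<in> tuples (ops L) (map length xss)"
  shows "pm (length (concat xss)) (beta L (map length xss) hs) (concat xss)
    = concat (map2 (\<lambda>h xs. pm (length xs) h xs) hs xss)"
proof -
  have "pm (length xss) (e (length xss)) (map2 (\<lambda>h xs. pm (length xs) h xs) hs xss)
      = map2 (\<lambda>h xs. pm (length xs) h xs) hs xss" by simp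
  then show ?thesis using pm_mu[OF e_in assms] by (simp add: beta_def)
qed

end

section \<open>Isomorphisms of categories\<close>

text \<open>Both functors leave arrows unchanged and are mutually inverse on objects, so the natural
  isomorphisms are identities. The category laws of C are inherited from D.\<close>

lemma equivalent_categoriesI:
  fixes C :: "('o, 'm) cat" and D :: "('p, 'm) cat"
  assumes D: "category D"
    and F: "\<And>A. A \<in> Ob C \<Longrightarrow> F A \<in> Ob D \<and> G (F A) = A"
    and G: "\<And>B. B \<in> Ob D \<Longrightarrow> G B \<in> Ob C \<and> F (G B) = B"
    and Hom: "\<And>A B. A \<in> Ob C \<Longrightarrow> B \<in> Ob C \<Longrightarrow> Hom C A B = Hom D (F A) (F B)"
    and Idn: "\<And>A. A \<in> Ob C \<Longrightarrow> Idn C A = Idn D (F A)"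
    and Cmp: "\<And>A B E g f. A \<in> Ob C \<Longrightarrow> B \<in> Ob C \<Longrightarrow> E \<in> Ob C \<Longrightarrow>
      Cmp C A B E g f = Cmp D (F A) (F B) (F E) g f"
  shows "equivalent_categories C D"
proof -
  let ?F = "\<lparr>fob = F, far = \<lambda>A B f. f\<rparr> :: ('o, 'm, 'p, 'm) fctr"
  let ?G = "\<lparr>fob = G, far = \<lambda>A B f. f\<rparr> :: ('p, 'm, 'o, 'm) fctr"
  have C: "category C"
    unfolding category_def
  proof (intro conjI ballI)
    fix A B A' B' f g h
    assume o: "A \<in> Ob C" "B \<in> Ob C" "A' \<in> Ob C" "B' \<in> Ob C"
    note o' = o F[OF o(1)] F[OF o(2)] F[OF o(3)] F[OF o(4)]
    show "Idn C A \<in> Hom C A A" using D o' unfolding category_def by (simp add: Hom Idn)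
    assume f: "f \<in> Hom C A B"
    then show "Cmp C A A B f (Idn C A) = f" "Cmp C A B B (Idn C B) f = f"
      using D o' unfolding category_def by (simp_all add: Hom Idn Cmp)
    assume g: "g \<in> Hom C B A'"
    show "Cmp C A B A' g f \<in> Hom C A A'"
      using D o' f g unfolding category_def by (simp add: Hom Cmp)
    assume h: "h \<in> Hom C A' B'"
    show "Cmp C A A' B' h (Cmp C A B A' g f) = Cmp C A B B' (Cmp C B A' B' h g) f"
      using D o' f g h unfolding category_def by (simp add: Hom Cmp)
  qed
  have "is_functor C D ?F" unfolding is_functor_def by (simp add: F Hom Idn Cmp)
  moreover have "is_functor D C ?G" unfolding is_functor_def by (simp add: G Hom Idn Cmp)
  moreover have "nat_iso C C id_fctr (comp_fctr ?G ?F) (Idn C)"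
    unfolding nat_iso_def is_iso_def id_fctr_def comp_fctr_def
    using C F unfolding category_def by simp
  moreover have "nat_iso D D (comp_fctr ?F ?G) id_fctr (Idn D)"
    unfolding nat_iso_def is_iso_def id_fctr_def comp_fctr_def
    using D G unfolding category_def by simp
  ultimately show ?thesis unfolding equivalent_categories_def using C D by blast
qed

section \<open>The universal property of the substitution product\<close>

locale action_op_universe = set_universe small code + action_op L
  for small :: "'u set \<Rightarrow> bool" and code :: "'u set \<Rightarrow> 'u" and L :: "'u group_operad" +
  assumes small_ops: "small (ops L n)"
begin

abbreviation coll :: "'u collection \<Rightarrow> bool" where "coll \<equiv> is_coll small L"

abbreviation sub :: "'u collection \<Rightarrow> 'u collection \<Rightarrow> 'u collection" (infixr "\<odot>" 75)
  where "X \<odot> Y \<equiv> subst_coll code L X Y"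

abbreviation cls :: "'u collection \<Rightarrow> 'u collection \<Rightarrow> 'u raw \<Rightarrow> 'u"
  where "cls \<equiv> subst_class code L"

definition gen :: "'u collection \<Rightarrow> 'u collection \<Rightarrow> nat list \<Rightarrow> 'u \<Rightarrow> 'u list \<Rightarrow> 'u"
  where "gen X Y ks x ys = cls X Y (ks, x, ys, e (sum_list ks))"

lemma right_action_coll: "coll X \<Longrightarrow> right_action (gr L n) (cset X n) (cact X n)"
  by (simp add: is_coll_def)

lemma act_in [simp]: "coll X \<Longrightarrow> x \<in> cset X n \<Longrightarrow> g \<in> ops L n \<Longrightarrow> cact X n x g \<in> cset X n"
  using right_action_coll[of X n] by (simp add: right_action_def carrier_gr)

lemma act_e [simp]: "coll X \<Longrightarrow> x \<in> cset X n \<Longrightarrow> cact X n x (e n) = x"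
  using right_action_coll[of X n] by (simp add: right_action_def)

lemma act_act: "coll X \<Longrightarrow> x \<in> cset X n \<Longrightarrow> g \<in> ops L n \<Longrightarrow> h \<in> ops L n \<Longrightarrow>
    cact X n (cact X n x g) h = cact X n x (g \<otimes>\<^bsub>gr L n\<^esub> h)"
  using right_action_coll[of X n] by (simp add: right_action_def carrier_gr)

lemma acts_in [simp]:
  "coll Y \<Longrightarrow> ys \<in> tuples (cset Y) ks \<Longrightarrow> gs \<in> tuples (ops L) ks \<Longrightarrow>
   map3 (cact Y) ks ys gs \<in> tuples (cset Y) ks"
  by (erule (1) tuples_map3) simp

lemma subst_step_raws:
  assumes "coll X" "coll Y" "subst_step L X Y s t"
  shows "s \<in> raws L X Y k \<longleftrightarrow> t \<in> raws L X Y k"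
  using assms(3)
  by cases (use assms(1,2) in \<open>auto simp: raws_def\<close>)

lemma equivclp_raws:
  assumes "coll X" "coll Y" "equivclp (subst_step L X Y) s t" "s \<in> raws L X Y k"
  shows "t \<in> raws L X Y k"
  using assms(3,4) by induction (use subst_step_raws[OF assms(1,2)] in blast)+

text \<open>\<open>code\<close> separates only small sets. A class lies within the raw elements of a
  single arity, since the steps preserve the arity, and these form a small set by
  \<open>small_raws\<close>.\<close>

lemma cls_eq_iff:
  assumes "coll X" "coll Y" "s \<in> raws L X Y k" "t \<in> raws L X Y k"
  shows "cls X Y s = cls X Y t \<longleftrightarrow> equivclp (subst_step L X Y) s t"
proof -
  have sm: "small (code_raw code ` {r. equivclp (subst_step L X Y) s r})" if "s \<in> raws L X Y k" for s
  proof (rule small_subset)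
    show "small (code_raw code ` raws L X Y k)"
      using assms(1,2) by (intro small_raws small_ops) (simp_all add: is_coll_def)
    show "code_raw code ` {r. equivclp (subst_step L X Y) s r} \<subseteq> code_raw code ` raws L X Y k"
      using equivclp_raws[OF assms(1,2) _ that] by blast
  qed
  have inj: "inj (code_raw code)" by (rule injI) (simp add: code_raw_eq_iff)
  have "cls X Y s = cls X Y t \<longleftrightarrow>
      {r. equivclp (subst_step L X Y) s r} = {r. equivclp (subst_step L X Y) t r}"
    unfolding subst_class_def
    by (simp only: code_eq_iff[OF sm[OF assms(3)] sm[OF assms(4)]] inj_image_eq_iff[OF inj])
  also have "\<dots> \<longleftrightarrow> equivclp (subst_step L X Y) s t"
  proof
    assume st: "{r. equivclp (subst_step L X Y) s r} = {r. equivclp (subst_step L X Y) t r}"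
    have "t \<in> {r. equivclp (subst_step L X Y) s r}" unfolding st by simp
    then show "equivclp (subst_step L X Y) s t" by simp
  next
    assume st: "equivclp (subst_step L X Y) s t"
    have "equivclp (subst_step L X Y) s r \<longleftrightarrow> equivclp (subst_step L X Y) t r" for r
      using st equivclp_trans[OF st] equivclp_trans[OF equivclp_sym[OF st]] by blast
    then show "{r. equivclp (subst_step L X Y) s r} = {r. equivclp (subst_step L X Y) t r}" by simp
  qed
  finally show ?thesis .
qed

text \<open>The common form of all arguments for independence of representatives: the action,
  \<open>lift\<close>, the associator, and a single entry in the inverse associator. It suffices to
  compare values across the two generating steps, and only for raw elements of arity k.\<close>

lemma raw_invariant:
  assumes XY: "coll X" "coll Y"
    and outer: "\<And>ks x h ys g. sum_list ks = k \<Longrightarrow> x \<in> cset X (length ks) \<Longrightarrow> h \<in> ops L (length ks) \<Longrightarrow>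
      ys \<in> tuples (cset Y) ks \<Longrightarrow> g \<in> ops L k \<Longrightarrow>
      F (ks, cact X (length ks) x h, ys, g)
      = F (pm (length ks) h ks, x, pm (length ks) h ys, delta L ks h \<otimes>\<^bsub>gr L k\<^esub> g)"
    and inner: "\<And>ks x gs ys g. sum_list ks = k \<Longrightarrow> x \<in> cset X (length ks) \<Longrightarrow> gs \<in> tuples (ops L) ks \<Longrightarrow>
      ys \<in> tuples (cset Y) ks \<Longrightarrow> g \<in> ops L k \<Longrightarrow>
      F (ks, x, map3 (cact Y) ks ys gs, g) = F (ks, x, ys, beta L ks gs \<otimes>\<^bsub>gr L k\<^esub> g)"
    and s: "s \<in> raws L X Y k" and st: "equivclp (subst_step L X Y) s t"
  shows "F s = F t"
proof -
  have invariant: "F a = F b" if "subst_step L X Y a b" "a \<in> raws L X Y k" for a b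
    using that(1)
  proof cases
    case (outer x ks h ys g)
    then show ?thesis using assms(3)[of ks x h ys g] that(2) by (simp add: raws_def)
  next
    case (inner x ks ys gs g)
    then show ?thesis using assms(4)[of ks x gs ys g] that(2) by (simp add: raws_def)
  qed
  show ?thesis
    using st
  proof induction
    case (step y z)
    have y: "y \<in> raws L X Y k" by (rule equivclp_raws[OF XY step.hyps(1) s])
    show ?case
    proof (cases "subst_step L X Y y z")
      case True
      then show ?thesis using invariant y step.IH by simp
    next
      \<comment> \<open>The generated equivalence also runs steps backwards. Membership in
        \<open>raws\<close> is preserved in both directions, so invariance applies to the reversed
        step too.\<close>
      case False
      then have zy: "subst_step L X Y z y" using step.hyps(2) by simp
      then have "z \<in> raws L X Y k" using subst_step_raws[OF XY] y by blast
      then show ?thesis using invariant zy step.IH by simp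
    qed
  qed simp
qed

lemma cset_sub: "cset (X \<odot> Y) k = cls X Y ` raws L X Y k"
  by (simp add: subst_coll_def subst_set_def)

lemma subst_rep:
  assumes "c \<in> cset (X \<odot> Y) k"
  shows "subst_rep code L X Y k c \<in> raws L X Y k" "cls X Y (subst_rep code L X Y k c) = c"
  using assms someI_ex[of "\<lambda>t. t \<in> raws L X Y k \<and> cls X Y t = c"]
  by (auto simp: cset_sub subst_rep_def)

lemma subst_rep_cls:
  assumes "coll X" "coll Y" "t \<in> raws L X Y k"
  shows "equivclp (subst_step L X Y) t (subst_rep code L X Y k (cls X Y t))"
  using subst_rep[of "cls X Y t" X Y k] assms cls_eq_iff[OF assms(1,2,3)] by (metis cset_sub imageI)

lemma cls_outer:
  assumes "coll X" "coll Y" "x \<in> cset X (length ks)" "h \<in> ops L (length ks)" "ys \<in> tuples (cset Y) ks"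
    "g \<in> ops L (sum_list ks)"
  shows "cls X Y (ks, cact X (length ks) x h, ys, g) = cls X Y
    (pm (length ks) h ks, x, pm (length ks) h ys, delta L ks h \<otimes>\<^bsub>gr L (sum_list ks)\<^esub> g)"
  using assms subst_step.outer[OF assms(3,4,5,6)]
  by (subst cls_eq_iff) (auto simp: raws_def)

lemma cls_inner:
  assumes "coll X" "coll Y" "x \<in> cset X (length ks)" "gs \<in> tuples (ops L) ks" "ys \<in> tuples (cset Y) ks"
    "g \<in> ops L (sum_list ks)"
  shows "cls X Y (ks, x, map3 (cact Y) ks ys gs, g)
    = cls X Y (ks, x, ys, beta L ks gs \<otimes>\<^bsub>gr L (sum_list ks)\<^esub> g)"
  using assms subst_step.inner[OF assms(3,5,4,6)]
  by (subst cls_eq_iff) (auto simp: raws_def)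

text \<open>The generating steps multiply the last coordinate from the left, and this commutes with
  multiplication by h from the right.\<close>

lemma act_cls:
  assumes XY: "coll X" "coll Y" and t: "(ks, x, ys, g) \<in> raws L X Y k" and h: "h \<in> ops L k"
  shows "cact (X \<odot> Y) k (cls X Y (ks, x, ys, g)) h = cls X Y (ks, x, ys, g \<otimes>\<^bsub>gr L k\<^esub> h)"
proof -
  define F where "F = (\<lambda>(ks, x, ys, g). cls X Y (ks, x, ys, g \<otimes>\<^bsub>gr L k\<^esub> h))"
  have "F (ks, x, ys, g) = F (subst_rep code L X Y k (cls X Y (ks, x, ys, g)))"
    by (rule raw_invariant[OF XY _ _ t subst_rep_cls[OF XY t]])
      (use XY h in \<open>auto simp: F_def cls_outer cls_inner mult_assoc\<close>)
  moreover have "cls X Y (ks, x, ys, g) \<in> subst_set code L X Y k"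
    using t by (simp add: subst_set_def)
  ultimately show ?thesis using h by (simp add: subst_coll_def F_def)
qed

lemma coll_sub [simp]:
  assumes XY: "coll X" "coll Y"
  shows "coll (X \<odot> Y)"
proof -
  have "small (cset (X \<odot> Y) k)" for k
  proof -
    have inj: "inj (code_raw code)" by (rule injI) (simp add: code_raw_eq_iff)
    \<comment> \<open>\<open>small_image\<close> concerns functions from \<open>'u\<close> to
      itself, so classes are presented as images of coded raw elements.\<close>
    have "small ((\<lambda>c. cls X Y (inv' (code_raw code) c)) ` code_raw code ` raws L X Y k)"
      using XY by (intro small_image small_raws small_ops) (simp_all add: is_coll_def)
    then show ?thesis by (simp add: cset_sub image_image inj)
  qed
  moreover have "right_action (gr L k) (cset (X \<odot> Y) k) (cact (X \<odot> Y) k)" for k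
  proof -
    have "cact (X \<odot> Y) k c g \<in> cset (X \<odot> Y) k \<and> cact (X \<odot> Y) k c (e k) = c \<and>
        cact (X \<odot> Y) k (cact (X \<odot> Y) k c g) h = cact (X \<odot> Y) k c (g \<otimes>\<^bsub>gr L k\<^esub> h)"
      if c: "c \<in> cset (X \<odot> Y) k" and gh: "g \<in> ops L k" "h \<in> ops L k" for c g h
    proof -
      obtain ks x ys f where t: "(ks, x, ys, f) \<in> raws L X Y k" and c: "c = cls X Y (ks, x, ys, f)"
        using c by (auto simp: cset_sub)
      moreover from t have f: "f \<in> ops L k" and "(ks, x, ys, f \<otimes>\<^bsub>gr L k\<^esub> g) \<in> raws L X Y k"
        using gh by (auto simp: raws_def)
      ultimately show ?thesis using gh XY
        by (auto simp: act_cls mult_assoc cset_sub)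
    qed
    then show ?thesis unfolding right_action_def carrier_gr by (metis e_in)
  qed
  moreover have "cact (X \<odot> Y) k c g = undefined" if "\<not> (c \<in> cset (X \<odot> Y) k \<and> g \<in> ops L k)" for k c g
    using that by (auto simp: subst_coll_def)
  ultimately show ?thesis unfolding is_coll_def by blast
qed

lemma gen_in [simp]:
  "x \<in> cset X (length ks) \<Longrightarrow> ys \<in> tuples (cset Y) ks \<Longrightarrow> gen X Y ks x ys \<in> cset (X \<odot> Y) (sum_list ks)"
  by (auto simp: gen_def cset_sub raws_def)

lemma cls_gen:
  assumes "coll X" "coll Y" "(ks, x, ys, g) \<in> raws L X Y k"
  shows "cls X Y (ks, x, ys, g) = cact (X \<odot> Y) k (gen X Y ks x ys) g"
  using assms unfolding gen_def by (subst act_cls) (auto simp: raws_def)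

text \<open>This and \<open>gen_inner\<close> restate the two generating relations for classes with
  neutral last coordinate: the group element that the relation puts there becomes an action on the
  class.\<close>

lemma gen_outer:
  assumes "coll X" "coll Y" "x \<in> cset X (length ks)" "h \<in> ops L (length ks)" "ys \<in> tuples (cset Y) ks"
  shows "gen X Y ks (cact X (length ks) x h) ys
    = cact (X \<odot> Y) (sum_list ks) (gen X Y (pm (length ks) h ks) x (pm (length ks) h ys)) (delta L ks h)"
proof -
  have "gen X Y ks (cact X (length ks) x h) ys
      = cls X Y (pm (length ks) h ks, x, pm (length ks) h ys, delta L ks h)"
    unfolding gen_def using assms by (simp add: cls_outer)
  then show ?thesis using assms by (simp add: cls_gen raws_def)
qed

lemma gen_inner:
  assumes "coll X" "coll Y" "x \<in> cset X (length ks)" "gs \<in> tuples (ops L) ks" "ys \<in> tuples (cset Y) ks"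
  shows "gen X Y ks x (map3 (cact Y) ks ys gs)
    = cact (X \<odot> Y) (sum_list ks) (gen X Y ks x ys) (beta L ks gs)"
proof -
  have "gen X Y ks x (map3 (cact Y) ks ys gs) = cls X Y (ks, x, ys, beta L ks gs)"
    unfolding gen_def using assms by (simp add: cls_inner)
  then show ?thesis using assms by (simp add: cls_gen raws_def)
qed

lemma sub_cases:
  assumes "coll X" "coll Y" "c \<in> cset (X \<odot> Y) k"
  obtains ks x ys g where "k = sum_list ks" "x \<in> cset X (length ks)" "ys \<in> tuples (cset Y) ks"
    "g \<in> ops L (sum_list ks)" "c = cact (X \<odot> Y) (sum_list ks) (gen X Y ks x ys) g"
proof -
  obtain ks x ys g where t: "(ks, x, ys, g) \<in> raws L X Y k" "c = cls X Y (ks, x, ys, g)"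
    using assms by (auto simp: cset_sub)
  show ?thesis
    by (rule that[of ks x ys g]) (use t cls_gen[OF assms(1,2) t(1)] in \<open>auto simp: raws_def\<close>)
qed

section \<open>Morphisms out of a substitution product\<close>

abbreviation chom :: "'u collection \<Rightarrow> 'u collection \<Rightarrow> (nat \<Rightarrow> 'u \<Rightarrow> 'u) set" where "chom \<equiv> coll_hom L"

lemma hom_in: "f \<in> chom X Y \<Longrightarrow> x \<in> cset X n \<Longrightarrow> f n x \<in> cset Y n"
  by (auto simp: coll_hom_def)

lemma hom_act: "f \<in> chom X Y \<Longrightarrow> x \<in> cset X n \<Longrightarrow> g \<in> ops L n \<Longrightarrow> f n (cact X n x g) = cact Y n (f n x) g"
  by (auto simp: coll_hom_def)

lemma homs_in: "f \<in> chom X Y \<Longrightarrow> xs \<in> tuples (cset X) ks \<Longrightarrow> map2 f ks xs \<in> tuples (cset Y) ks"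
  by (erule tuples_map2) (simp add: hom_in)

lemma hom_eqI:
  assumes "f \<in> chom X Y" "g \<in> chom X Y" "\<And>n x. x \<in> cset X n \<Longrightarrow> f n x = g n x"
  shows "f = g"
proof
  fix n
  have "f n \<in> cset X n \<rightarrow>\<^sub>E cset Y n" "g n \<in> cset X n \<rightarrow>\<^sub>E cset Y n"
    using assms(1,2) by (auto simp: coll_hom_def)
  then show "f n = g n" using assms(3) by (rule PiE_ext)
qed

lemma hom_sub_eqI:
  assumes "coll X" "coll Y" "f \<in> chom (X \<odot> Y) W" "g \<in> chom (X \<odot> Y) W"
    and "\<And>ks x ys. x \<in> cset X (length ks) \<Longrightarrow> ys \<in> tuples (cset Y) ks \<Longrightarrow>
      f (sum_list ks) (gen X Y ks x ys) = g (sum_list ks) (gen X Y ks x ys)"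
  shows "f = g"
proof (rule hom_eqI[OF assms(3,4)])
  fix n c assume "c \<in> cset (X \<odot> Y) n"
  then show "f n c = g n c"
    by (rule sub_cases[OF assms(1,2)]) (use assms in \<open>simp add: hom_act\<close>)
qed

definition balanced :: "'u collection \<Rightarrow> 'u collection \<Rightarrow> 'u collection \<Rightarrow>
    (nat list \<Rightarrow> 'u \<Rightarrow> 'u list \<Rightarrow> 'u) \<Rightarrow> bool" where
  "balanced X Y W \<phi> \<longleftrightarrow> (\<forall>ks. \<forall>x\<in>cset X (length ks). \<forall>ys\<in>tuples (cset Y) ks.
     \<phi> ks x ys \<in> cset W (sum_list ks) \<and>
     (\<forall>h\<in>ops L (length ks). \<phi> ks (cact X (length ks) x h) ys
       = cact W (sum_list ks) (\<phi> (pm (length ks) h ks) x (pm (length ks) h ys)) (delta L ks h)) \<and>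
     (\<forall>gs\<in>tuples (ops L) ks. \<phi> ks x (map3 (cact Y) ks ys gs)
       = cact W (sum_list ks) (\<phi> ks x ys) (beta L ks gs)))"

text \<open>Equivariance forces this formula, as (x; y; g) is (x; y; e) acted on by g.\<close>

definition lift :: "'u collection \<Rightarrow> 'u collection \<Rightarrow> 'u collection \<Rightarrow>
    (nat list \<Rightarrow> 'u \<Rightarrow> 'u list \<Rightarrow> 'u) \<Rightarrow> nat \<Rightarrow> 'u \<Rightarrow> 'u" where
  "lift X Y W \<phi> = (\<lambda>k. \<lambda>c\<in>cset (X \<odot> Y) k.
     case subst_rep code L X Y k c of (ks, x, ys, g) \<Rightarrow> cact W k (\<phi> ks x ys) g)"

lemma lift_cls:
  assumes XY: "coll X" "coll Y" and W: "coll W" and b: "balanced X Y W \<phi>"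
    and t: "(ks, x, ys, g) \<in> raws L X Y k"
  shows "lift X Y W \<phi> k (cls X Y (ks, x, ys, g)) = cact W k (\<phi> ks x ys) g"
proof -
  define F where "F = (\<lambda>(ks, x, ys, g). cact W k (\<phi> ks x ys) g)"
  \<comment> \<open>The permuted arities have the same sum, so this value lies in the arity in which
    two successive actions can be combined.\<close>
  have in': "\<phi> (pm (length ks) h ks) x (pm (length ks) h ys) \<in> cset W (sum_list ks)"
    if "x \<in> cset X (length ks)" "h \<in> ops L (length ks)" "ys \<in> tuples (cset Y) ks" for ks x h ys
  proof -
    have "pm (length ks) h ys \<in> tuples (cset Y) (pm (length ks) h ks)" using that by simp
    then show ?thesis
      using b that unfolding balanced_def by (metis length_permute sum_list_pm)
  qed
  have "F (ks, x, ys, g) = F (subst_rep code L X Y k (cls X Y (ks, x, ys, g)))"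
    by (rule raw_invariant[OF XY _ _ t subst_rep_cls[OF XY t]])
      (use W b in' in \<open>auto simp: F_def act_act balanced_def\<close>)
  moreover have "cls X Y (ks, x, ys, g) \<in> cset (X \<odot> Y) k"
    using t by (simp add: cset_sub)
  ultimately show ?thesis by (simp add: lift_def F_def)
qed

lemma balanced_in: "balanced X Y W \<phi> \<Longrightarrow> x \<in> cset X (length ks) \<Longrightarrow> ys \<in> tuples (cset Y) ks \<Longrightarrow>
    \<phi> ks x ys \<in> cset W (sum_list ks)"
  by (simp add: balanced_def)

lemma lift_gen:
  assumes "coll X" "coll Y" "coll W" "balanced X Y W \<phi>" "x \<in> cset X (length ks)" "ys \<in> tuples (cset Y) ks"
  shows "lift X Y W \<phi> (sum_list ks) (gen X Y ks x ys) = \<phi> ks x ys"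
  using assms unfolding gen_def by (subst lift_cls) (simp_all add: raws_def balanced_in)

lemma lift_hom:
  assumes XY: "coll X" "coll Y" and W: "coll W" and b: "balanced X Y W \<phi>"
  shows "lift X Y W \<phi> \<in> chom (X \<odot> Y) W"
proof -
  have "lift X Y W \<phi> k c \<in> cset W k \<and> lift X Y W \<phi> k (cact (X \<odot> Y) k c h) = cact W k (lift X Y W \<phi> k c) h"
    if c: "c \<in> cset (X \<odot> Y) k" and h: "h \<in> ops L k" for k c h
  proof -
    obtain ks x ys g where t: "(ks, x, ys, g) \<in> raws L X Y k" and c: "c = cls X Y (ks, x, ys, g)"
      using c by (auto simp: cset_sub)
    then have g: "g \<in> ops L k" and "(ks, x, ys, g \<otimes>\<^bsub>gr L k\<^esub> h) \<in> raws L X Y k"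
      "\<phi> ks x ys \<in> cset W k"
      using h b by (auto simp: raws_def balanced_in)
    then show ?thesis using t h by (simp add: c act_cls[OF XY] lift_cls[OF XY W b] act_act[OF W] act_in[OF W])
  qed
  moreover have "lift X Y W \<phi> k \<in> extensional (cset (X \<odot> Y) k)" for k
    by (simp add: lift_def)
  ultimately show ?thesis unfolding coll_hom_def PiE_def Pi_def using e_in by blast
qed

lemma lift_unique:
  assumes "coll X" "coll Y" "coll W" "balanced X Y W \<phi>" "f \<in> chom (X \<odot> Y) W"
    and "\<And>ks x ys. x \<in> cset X (length ks) \<Longrightarrow> ys \<in> tuples (cset Y) ks \<Longrightarrow>
      f (sum_list ks) (gen X Y ks x ys) = \<phi> ks x ys"
  shows "f = lift X Y W \<phi>"
  using assms by (intro hom_sub_eqI[OF assms(1,2,5) lift_hom[OF assms(1-4)]]) (simp add: lift_gen)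

text \<open>Converse of \<open>lift_hom\<close>: restricting a morphism to generators gives a
  balanced family. It yields the equivariance axioms for the operad of a monoid.\<close>

lemma balanced_hom:
  assumes "coll X" "coll Y" "f \<in> chom (X \<odot> Y) W"
  shows "balanced X Y W (\<lambda>ks x ys. f (sum_list ks) (gen X Y ks x ys))"
proof -
  have "gen X Y (pm (length ks) h ks) x (pm (length ks) h ys) \<in> cset (X \<odot> Y) (sum_list ks)"
    if "x \<in> cset X (length ks)" "h \<in> ops L (length ks)" "ys \<in> tuples (cset Y) ks" for ks x h ys
    using that gen_in[of x X "pm (length ks) h ks" "pm (length ks) h ys" Y] by simp
  then show ?thesis
    using assms hom_act[OF assms(3)]
    by (simp add: balanced_def hom_in gen_outer gen_inner)
qed

lemma balanced_map:
  assumes "coll X" "coll Y" "coll X'" "coll Y'" "f \<in> chom X X'" "f' \<in> chom Y Y'"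
  shows "balanced X Y (X' \<odot> Y') (\<lambda>ks x ys. gen X' Y' ks (f (length ks) x) (map2 f' ks ys))"
proof -
  have "map2 f' ks (map3 (cact Y) ks ys gs) = map3 (cact Y') ks (map2 f' ks ys) gs"
    if "ys \<in> tuples (cset Y) ks" "gs \<in> tuples (ops L) ks" for ks ys gs
    using that assms by (intro nth_equalityI) (auto simp: tuples_iff hom_act)
  moreover have "map2 f' (pm (length ks) h ks) (pm (length ks) h ys) = pm (length ks) h (map2 f' ks ys)"
    if "ys \<in> tuples (cset Y) ks" "h \<in> ops L (length ks)" for ks ys h
    using that by (simp add: permute_map2 tuples_iff)
  ultimately show ?thesis
    using assms by (simp add: balanced_def hom_in hom_act homs_in gen_outer gen_inner)
qed

text \<open>\<open>subst_map\<close> is defined by choosing representatives. Recognising it as the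
  lift of a balanced family shows at once that it is well defined and equivariant and what it does
  to generators.\<close>

lemma subst_map_eq_lift:
  assumes "coll X" "coll Y" "coll X'" "coll Y'" "f \<in> chom X X'" "f' \<in> chom Y Y'"
  shows "subst_map code L X Y X' Y' f f'
    = lift X Y (X' \<odot> Y') (\<lambda>ks x ys. gen X' Y' ks (f (length ks) x) (map2 f' ks ys))"
proof (intro ext)
  fix k c
  show "subst_map code L X Y X' Y' f f' k c
    = lift X Y (X' \<odot> Y') (\<lambda>ks x ys. gen X' Y' ks (f (length ks) x) (map2 f' ks ys)) k c"
  proof (cases "c \<in> cset (X \<odot> Y) k")
    case True
    obtain ks x ys g where t: "subst_rep code L X Y k c = (ks, x, ys, g)"
      using prod_cases4 by metis
    then have "(ks, x, ys, g) \<in> raws L X Y k" using subst_rep(1)[OF True] by simp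
    then have "(ks, f (length ks) x, map2 f' ks ys, g) \<in> raws L X' Y' k"
      using assms by (auto simp: raws_def hom_in homs_in)
    from cls_gen[OF assms(3,4) this] show ?thesis
      using True t by (simp add: subst_map_def lift_def) (simp add: subst_coll_def)
  next
    case False
    then show ?thesis by (simp add: subst_map_def lift_def) (simp add: subst_coll_def)
  qed
qed

lemma subst_map_hom:
  assumes "coll X" "coll Y" "coll X'" "coll Y'" "f \<in> chom X X'" "f' \<in> chom Y Y'"
  shows "subst_map code L X Y X' Y' f f' \<in> chom (X \<odot> Y) (X' \<odot> Y')"
  using assms by (simp add: subst_map_eq_lift lift_hom balanced_map)

lemma subst_map_gen:
  assumes "coll X" "coll Y" "coll X'" "coll Y'" "f \<in> chom X X'" "f' \<in> chom Y Y'"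
    "x \<in> cset X (length ks)" "ys \<in> tuples (cset Y) ks"
  shows "subst_map code L X Y X' Y' f f' (sum_list ks) (gen X Y ks x ys)
    = gen X' Y' ks (f (length ks) x) (map2 f' ks ys)"
  using assms by (simp add: subst_map_eq_lift lift_gen balanced_map)

section \<open>Generators of threefold products\<close>

lemma gen_tuples_cases:
  assumes YZ: "coll Y" "coll Z" and "qs \<in> tuples (cset (Y \<odot> Z)) ms"
  obtains kss ys zss gs where "ms = map sum_list kss" "ys \<in> tuples (cset Y) (map length kss)"
    "tuple_lists (cset Z) zss kss" "gs \<in> tuples (ops L) ms"
    "qs = map3 (cact (Y \<odot> Z)) ms (map3 (gen Y Z) kss ys zss) gs"
proof -
  have "\<exists>kss ys zss gs. ms = map sum_list kss \<and> ys \<in> tuples (cset Y) (map length kss) \<and>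
    tuple_lists (cset Z) zss kss \<and> gs \<in> tuples (ops L) ms \<and>
    qs = map3 (cact (Y \<odot> Z)) ms (map3 (gen Y Z) kss ys zss) gs"
    using assms(3)
  proof (induction ms arbitrary: qs)
    case Nil
    then show ?case by (intro exI[of _ "[]"]) simp
  next
    case (Cons m ms)
    then obtain q qs' where q: "qs = q # qs'" "q \<in> cset (Y \<odot> Z) m" "qs' \<in> tuples (cset (Y \<odot> Z)) ms"
      by auto
    obtain ks y zs g where g: "m = sum_list ks" "y \<in> cset Y (length ks)" "zs \<in> tuples (cset Z) ks"
      "g \<in> ops L (sum_list ks)" "q = cact (Y \<odot> Z) (sum_list ks) (gen Y Z ks y zs) g"
      by (rule sub_cases[OF YZ q(2)])
    obtain kss ys zss gs where h: "ms = map sum_list kss" "ys \<in> tuples (cset Y) (map length kss)"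
      "tuple_lists (cset Z) zss kss" "gs \<in> tuples (ops L) ms"
      "qs' = map3 (cact (Y \<odot> Z)) ms (map3 (gen Y Z) kss ys zss) gs"
      using Cons.IH[OF q(3)] by blast
    show ?case
      by (rule exI[of _ "ks # kss"], rule exI[of _ "y # ys"], rule exI[of _ "zs # zss"],
          rule exI[of _ "g # gs"]) (use q g h in simp)
  qed
  then show ?thesis using that by blast
qed

lemma gens_in:
  assumes "ys \<in> tuples (cset Y) (map length kss)" "tuple_lists (cset Z) zss kss"
  shows "map3 (gen Y Z) kss ys zss \<in> tuples (cset (Y \<odot> Z)) (map sum_list kss)"
  using assms by (simp add: tuples_iff[of _ _ "map sum_list kss"] tuples_iff[of ys] list_all2_conv_all_nth)

text \<open>Common data for the two nested forms below. The i-th entry of \<open>kss\<close> lists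
  the arities of the operations plugged into the i-th entry of \<open>ys\<close>; its sum is
  therefore the arity of that inner composite.\<close>

definition gen_args :: "'u collection \<Rightarrow> 'u collection \<Rightarrow> 'u collection \<Rightarrow>
    nat list list \<Rightarrow> 'u \<Rightarrow> 'u list \<Rightarrow> 'u list list \<Rightarrow> bool" where
  "gen_args X Y Z kss x ys zss \<longleftrightarrow> x \<in> cset X (length kss) \<and>
     ys \<in> tuples (cset Y) (map length kss) \<and> tuple_lists (cset Z) zss kss"

definition left_gen :: "'u collection \<Rightarrow> 'u collection \<Rightarrow> 'u collection \<Rightarrow>
    nat list list \<Rightarrow> 'u \<Rightarrow> 'u list \<Rightarrow> 'u list list \<Rightarrow> 'u" where
  "left_gen X Y Z kss x ys zss
    = gen (X \<odot> Y) Z (concat kss) (gen X Y (map length kss) x ys) (concat zss)"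

definition right_gen :: "'u collection \<Rightarrow> 'u collection \<Rightarrow> 'u collection \<Rightarrow>
    nat list list \<Rightarrow> 'u \<Rightarrow> 'u list \<Rightarrow> 'u list list \<Rightarrow> 'u" where
  "right_gen X Y Z kss x ys zss = gen X (Y \<odot> Z) (map sum_list kss) x (map3 (gen Y Z) kss ys zss)"

lemma gen_args_inner_in:
  "gen_args X Y Z kss x ys zss \<Longrightarrow> gen X Y (map length kss) x ys \<in> cset (X \<odot> Y) (length (concat kss))"
  using gen_in[of x X "map length kss" ys Y] by (simp add: gen_args_def length_concat)

lemma left_gen_in [simp]:
  assumes "gen_args X Y Z kss x ys zss"
  shows "left_gen X Y Z kss x ys zss \<in> cset ((X \<odot> Y) \<odot> Z) (sum_list (map sum_list kss))"
  using gen_in[OF gen_args_inner_in[OF assms] list_all2_tuples_concat] assms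
  by (simp add: gen_args_def left_gen_def sum_list_concat)

lemma right_gen_in [simp]:
  "gen_args X Y Z kss x ys zss \<Longrightarrow>
   right_gen X Y Z kss x ys zss \<in> cset (X \<odot> (Y \<odot> Z)) (sum_list (map sum_list kss))"
  using gens_in[of ys Y kss Z zss] unfolding gen_args_def right_gen_def by (intro gen_in) auto

text \<open>A general tuple of classes of Y \<circ> Z carries a group element in each entry; these
  leave together as \<beta>(gs) by \<open>gen_inner\<close>, and equivariance disposes of
  them.\<close>

lemma right_gen_eqI:
  assumes "coll X" "coll Y" "coll Z" "f \<in> chom (X \<odot> (Y \<odot> Z)) W" "g \<in> chom (X \<odot> (Y \<odot> Z)) W"
    and eq: "\<And>kss x ys zss. gen_args X Y Z kss x ys zss \<Longrightarrow>
      f (sum_list (map sum_list kss)) (right_gen X Y Z kss x ys zss)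
      = g (sum_list (map sum_list kss)) (right_gen X Y Z kss x ys zss)"
  shows "f = g"
proof (rule hom_sub_eqI[OF assms(1) coll_sub[OF assms(2,3)] assms(4,5)])
  fix ms x qs assume x: "x \<in> cset X (length ms)" and qs: "qs \<in> tuples (cset (Y \<odot> Z)) ms"
  obtain kss ys zss gs where h: "ms = map sum_list kss" "ys \<in> tuples (cset Y) (map length kss)"
    "tuple_lists (cset Z) zss kss" "gs \<in> tuples (ops L) ms"
    "qs = map3 (cact (Y \<odot> Z)) ms (map3 (gen Y Z) kss ys zss) gs"
    by (rule gen_tuples_cases[OF assms(2,3) qs])
  have a: "gen_args X Y Z kss x ys zss" using x h by (simp add: gen_args_def)
  have "gen X (Y \<odot> Z) ms x qs
      = cact (X \<odot> (Y \<odot> Z)) (sum_list ms) (right_gen X Y Z kss x ys zss) (beta L ms gs)"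
    unfolding h(5) right_gen_def using gens_in[OF h(2,3)] x h(1,4) assms by (simp add: gen_inner)
  then show "f (sum_list ms) (gen X (Y \<odot> Z) ms x qs) = g (sum_list ms) (gen X (Y \<odot> Z) ms x qs)"
    using eq[OF a] right_gen_in[OF a] h(4) assms by (simp add: hom_act flip: h(1))
qed

text \<open>Here the first coordinate carries one group element h. By \<open>gen_outer\<close> it
  leaves as \<delta>(h) and permutes \<open>zs\<close>.\<close>

lemma left_gen_eqI:
  assumes XYZ: "coll X" "coll Y" "coll Z" and fg: "f \<in> chom ((X \<odot> Y) \<odot> Z) W" "g \<in> chom ((X \<odot> Y) \<odot> Z) W"
    and eq: "\<And>kss x ys zss. gen_args X Y Z kss x ys zss \<Longrightarrow>
      f (sum_list (map sum_list kss)) (left_gen X Y Z kss x ys zss)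
      = g (sum_list (map sum_list kss)) (left_gen X Y Z kss x ys zss)"
  shows "f = g"
proof (rule hom_sub_eqI[OF coll_sub[OF XYZ(1,2)] XYZ(3) fg])
  fix ls p zs assume p: "p \<in> cset (X \<odot> Y) (length ls)" and zs: "zs \<in> tuples (cset Z) ls"
  obtain ks x ys h where t: "length ls = sum_list ks" "x \<in> cset X (length ks)" "ys \<in> tuples (cset Y) ks"
    "h \<in> ops L (sum_list ks)" "p = cact (X \<odot> Y) (sum_list ks) (gen X Y ks x ys) h"
    by (rule sub_cases[OF XYZ(1,2) p])
  have h: "h \<in> ops L (length ls)" and q: "gen X Y ks x ys \<in> cset (X \<odot> Y) (length ls)" using t by simp_all
  \<comment> \<open>The permuted lists are cut, not the original ones: only after h has been moved
    do the inputs appear in the order of the generator (x; y).\<close>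
  have "length (pm (length ls) h ls) = sum_list ks" using t by simp
  then obtain kss zss where s: "pm (length ls) h ls = concat kss" "map length kss = ks"
    "pm (length ls) h zs = concat zss" "tuple_lists (cset Z) zss kss"
    by (rule ex_split_tuples[OF pm_tuples[OF h zs]])
  have "length ks = length kss" using s(2) by auto
  then have a: "gen_args X Y Z kss x ys zss" using t s by (simp add: gen_args_def)
  have sl: "sum_list (map sum_list kss) = sum_list ls"
    using s(1) h by (metis sum_list_concat sum_list_pm)
  have "gen (X \<odot> Y) Z ls p zs = cact ((X \<odot> Y) \<odot> Z) (sum_list ls) (left_gen X Y Z kss x ys zss) (delta L ls h)"
    using gen_outer[OF coll_sub[OF XYZ(1,2)] XYZ(3) q h zs] t s by (simp add: left_gen_def)
  then show "f (sum_list ls) (gen (X \<odot> Y) Z ls p zs) = g (sum_list ls) (gen (X \<odot> Y) Z ls p zs)"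
    using eq[OF a] left_gen_in[OF a] sl h hom_act[OF fg(1)] hom_act[OF fg(2)] by simp
qed

section \<open>The associator\<close>

text \<open>The effect of \<beta>(hs) on the concatenation, block by block; see
  \<open>pm_beta\<close>.\<close>

abbreviation pms :: "'u list \<Rightarrow> 'b list list \<Rightarrow> 'b list list" where
  "pms \<equiv> map2 (\<lambda>h xs. pm (length xs) h xs)"

lemma pms_tuple_lists [simp]:
  assumes "hs \<in> tuples (ops L) (map length kss)" "tuple_lists Z zss kss"
  shows "tuple_lists Z (pms hs zss) (pms hs kss)"
proof -
  have l: "length hs = length kss" "length zss = length kss"
    using assms by (simp_all add: tuple_lists_iff length_tuples)
  have "pms hs zss ! i \<in> tuples Z (pms hs kss ! i)" if i: "i < length kss" for i
  proof -
    have h: "hs ! i \<in> ops L (length (kss ! i))" and z: "zss ! i \<in> tuples Z (kss ! i)"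
      using assms i by (simp_all add: tuple_lists_iff tuples_iff[of hs])
    from pm_tuples[OF h z] show ?thesis using i l length_tuples[OF z] by simp
  qed
  then show ?thesis unfolding tuple_lists_iff using l by simp
qed

lemma map_sum_list_pms:
  fixes kss :: "nat list list"
  assumes "hs \<in> tuples (ops L) (map length kss)"
  shows "map sum_list (pms hs kss) = map sum_list kss"
  using assms by (intro nth_equalityI) (simp_all add: tuples_iff)

lemma map_length_pms:
  assumes "hs \<in> tuples (ops L) (map length kss)"
  shows "map length (pms hs kss) = map length kss"
  using assms by (intro nth_equalityI) (simp_all add: tuples_iff)

lemma deltas_in [simp]:
  "hs \<in> tuples (ops L) (map length kss) \<Longrightarrow> map2 (delta L) kss hs \<in> tuples (ops L) (map sum_list kss)"
  by (simp add: tuples_iff)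

lemma betas_in [simp]:
  "tuple_lists (ops L) css kss \<Longrightarrow> map2 (beta L) kss css \<in> tuples (ops L) (map sum_list kss)"
  by (simp add: tuple_lists_iff tuples_iff[of _ _ "map sum_list kss"])

lemma mults_in [simp]:
  "gs \<in> tuples (ops L) ks \<Longrightarrow> hs \<in> tuples (ops L) ks \<Longrightarrow> muls ks gs hs \<in> tuples (ops L) ks"
  by (erule (1) tuples_map3) simp

lemma acts_es [simp]: "coll Y \<Longrightarrow> ys \<in> tuples (cset Y) ks \<Longrightarrow> map3 (cact Y) ks ys (map e ks) = ys"
  by (intro nth_equalityI) (simp_all add: tuples_iff)

lemma acts_acts:
  assumes "coll Y" "ys \<in> tuples (cset Y) ks" "gs \<in> tuples (ops L) ks" "hs \<in> tuples (ops L) ks"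
  shows "map3 (cact Y) ks (map3 (cact Y) ks ys gs) hs
    = map3 (cact Y) ks ys (muls ks gs hs)"
  using assms by (intro nth_equalityI) (simp_all add: tuples_iff act_act)

lemma gens_outer:
  assumes YZ: "coll Y" "coll Z" and ys: "ys \<in> tuples (cset Y) (map length kss)"
    and zss: "tuple_lists (cset Z) zss kss" and hs: "hs \<in> tuples (ops L) (map length kss)"
  shows "map3 (gen Y Z) kss (map3 (cact Y) (map length kss) ys hs) zss
    = map3 (cact (Y \<odot> Z)) (map sum_list kss) (map3 (gen Y Z) (pms hs kss) ys (pms hs zss)) (map2 (delta L) kss hs)"
    (is "?l = ?r")
proof (rule nth_equalityI)
  fix i assume "i < length ?l"
  then have i: "i < length kss" by simp
  have l: "length ys = length kss" "length zss = length kss" "length hs = length kss"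
    using assms(3-) by (simp_all add: tuple_lists_iff length_tuples)
  have "ys ! i \<in> cset Y (length (kss ! i))" "zss ! i \<in> tuples (cset Z) (kss ! i)"
    "hs ! i \<in> ops L (length (kss ! i))"
    using i assms(3-) by (simp_all add: tuple_lists_iff tuples_iff[of ys] tuples_iff[of hs])
  from gen_outer[OF YZ this(1,3,2)] length_tuples[OF this(2)]
  show "?l ! i = ?r ! i"
    using i l by simp
qed (use ys zss hs in \<open>simp add: tuple_lists_iff tuples_iff\<close>)

lemma gens_inner:
  assumes YZ: "coll Y" "coll Z" and ys: "ys \<in> tuples (cset Y) (map length kss)"
    and zss: "tuple_lists (cset Z) zss kss" and css: "tuple_lists (ops L) css kss"
  shows "map3 (gen Y Z) kss ys (map3 (map3 (cact Z)) kss zss css)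
    = map3 (cact (Y \<odot> Z)) (map sum_list kss) (map3 (gen Y Z) kss ys zss) (map2 (beta L) kss css)"
    (is "?l = ?r")
proof (rule nth_equalityI)
  fix i assume "i < length ?l"
  then have i: "i < length kss" by simp
  have l: "length ys = length kss" "length zss = length kss" "length css = length kss"
    using assms(3-) by (simp_all add: tuple_lists_iff length_tuples)
  have "ys ! i \<in> cset Y (length (kss ! i))" "zss ! i \<in> tuples (cset Z) (kss ! i)"
    "css ! i \<in> tuples (ops L) (kss ! i)"
    using i assms(3-) by (simp_all add: tuple_lists_iff tuples_iff[of ys])
  from gen_inner[OF YZ this(1,3,2)] show "?l ! i = ?r ! i"
    using i l by simp
qed (use ys zss css in \<open>simp add: tuple_lists_iff tuples_iff\<close>)

context
  fixes X Y Z :: "'u collection"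
  assumes XYZ [simp]: "coll X" "coll Y" "coll Z"
begin

text \<open>Moving \<open>g\<close> past the second factor, \<open>((x; y; g); z; h) = ((x; y; e); g \<cdot> z; \<delta>(g) h)\<close>, and the
  associator should send \<open>((x; y; e); z; e)\<close> to \<open>(x; (y\<^sub>i; z\<^sub>i; e)\<^sub>i; e)\<close> for \<open>z\<close> cut into blocks \<open>z\<^sub>i\<close>.\<close>

definition assoc_raw :: "nat list \<Rightarrow> 'u list \<Rightarrow> 'u raw \<Rightarrow> 'u" where
  "assoc_raw ls zs = (\<lambda>(ks, x, ys, g).
     let kss = split ks (pm (length ls) g ls); zss = split ks (pm (length ls) g zs)
     in cact (X \<odot> (Y \<odot> Z)) (sum_list ls) (right_gen X Y Z kss x ys zss) (delta L ls g))"

text \<open>\<open>split\<close> undoes \<open>concat\<close>, so the value can be computed from any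
  blocks that concatenate to the permuted lists.\<close>

lemma assoc_raw_eq:
  assumes "pm (length ls) g ls = concat kss" "pm (length ls) g zs = concat zss" "map length kss = ks"
    "tuple_lists (cset Z) zss kss"
  shows "assoc_raw ls zs (ks, x, ys, g)
    = cact (X \<odot> (Y \<odot> Z)) (sum_list ls) (right_gen X Y Z kss x ys zss) (delta L ls g)"
  unfolding assoc_raw_def
  using assms(1,2) split_concat[of kss] split_concat[of zss] list_all2_tuples_length[OF assms(4)] assms(3)
  by simp

text \<open>This and the next two lemmas record which group element comes out of the right form when
  x, the entries of \<open>ys\<close> or those of \<open>zss\<close> are acted on. The left form
  yields the same three elements, which is why the two forms can correspond.\<close>

lemma right_gen_outer:
  assumes a: "gen_args X Y Z kss x ys zss" and h: "h \<in> ops L (length kss)"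
  shows "right_gen X Y Z kss (cact X (length kss) x h) ys zss
      = cact (X \<odot> (Y \<odot> Z)) (sum_list (map sum_list kss))
          (right_gen X Y Z (pm (length kss) h kss) x (pm (length kss) h ys) (pm (length kss) h zss))
          (delta L (map sum_list kss) h)"
proof -
  have l: "length ys = length kss" "length zss = length kss"
    using a by (auto simp: gen_args_def dest!: length_tuples list_all2_lengthD)
  have "map3 (gen Y Z) kss ys zss \<in> tuples (cset (Y \<odot> Z)) (map sum_list kss)"
    using a by (simp add: gen_args_def gens_in)
  then show ?thesis
    unfolding right_gen_def
    using gen_outer[of X "Y \<odot> Z" x "map sum_list kss" h "map3 (gen Y Z) kss ys zss"] a h l
      permute_map[of "pr L (length kss) h" kss sum_list] permute_map3[of "pr L (length kss) h" kss ys zss "gen Y Z"]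
    by (simp add: gen_args_def)
qed

lemma right_gen_middle:
  assumes a: "gen_args X Y Z kss x ys zss" and hs: "hs \<in> tuples (ops L) (map length kss)"
  shows "right_gen X Y Z kss x (map3 (cact Y) (map length kss) ys hs) zss
      = cact (X \<odot> (Y \<odot> Z)) (sum_list (map sum_list kss)) (right_gen X Y Z (pms hs kss) x ys (pms hs zss))
          (beta L (map sum_list kss) (map2 (delta L) kss hs))"
    and "gen_args X Y Z (pms hs kss) x ys (pms hs zss)"
proof -
  have x: "x \<in> cset X (length kss)" and ys: "ys \<in> tuples (cset Y) (map length kss)"
    and zss: "tuple_lists (cset Z) zss kss" using a by (simp_all add: gen_args_def)
  show a': "gen_args X Y Z (pms hs kss) x ys (pms hs zss)"
    using x ys length_tuples[OF hs] pms_tuple_lists[OF hs zss] unfolding gen_args_def map_length_pms[OF hs]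
    by simp
  have "map3 (gen Y Z) (pms hs kss) ys (pms hs zss) \<in> tuples (cset (Y \<odot> Z)) (map sum_list kss)"
    using gens_in[of ys Y "pms hs kss" Z "pms hs zss"] a' unfolding gen_args_def map_sum_list_pms[OF hs] by simp
  then show "right_gen X Y Z kss x (map3 (cact Y) (map length kss) ys hs) zss
      = cact (X \<odot> (Y \<odot> Z)) (sum_list (map sum_list kss)) (right_gen X Y Z (pms hs kss) x ys (pms hs zss))
          (beta L (map sum_list kss) (map2 (delta L) kss hs))"
    unfolding right_gen_def gens_outer[OF XYZ(2,3) ys zss hs] map_sum_list_pms[OF hs]
    using x hs by (intro gen_inner) simp_all
qed

lemma right_gen_inner:
  assumes a: "gen_args X Y Z kss x ys zss" and css: "tuple_lists (ops L) css kss"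
  shows "right_gen X Y Z kss x ys (map3 (map3 (cact Z)) kss zss css)
      = cact (X \<odot> (Y \<odot> Z)) (sum_list (map sum_list kss)) (right_gen X Y Z kss x ys zss)
          (beta L (concat kss) (concat css))"
  using a css gens_in[of ys Y kss Z zss]
  by (simp add: gen_args_def right_gen_def gens_inner beta_concat gen_inner)

lemma gen_args_act:
  assumes "gen_args X Y Z kss x ys zss" "h \<in> ops L (length kss)"
  shows "gen_args X Y Z (pm (length kss) h kss) x (pm (length kss) h ys) (pm (length kss) h zss)"
proof -
  have "tuple_lists (cset Z) (pm (length kss) h zss) (pm (length kss) h kss)"
    using assms by (intro tuple_lists_permute) (simp_all add: gen_args_def)
  then show ?thesis
    using assms permute_map[of "pr L (length kss) h" kss length] pm_tuples[of h "map length kss" ys]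
    by (simp add: gen_args_def)
qed

text \<open>A step multiplies g by \<delta>(h) or \<beta>(gs). By \<open>delta_mult\<close>, the
  factor by which \<delta>(g) changes is \<delta> of that element; \<open>delta_delta\<close> and
  \<open>delta_beta_concat\<close> identify it with the element that \<open>right_gen_outer\<close>
  or \<open>right_gen_middle\<close> brings out.\<close>

lemma assoc_raw_invariant:
  assumes zs: "zs \<in> tuples (cset Z) ls" and s: "s \<in> raws L X Y (length ls)"
    and st: "equivclp (subst_step L X Y) s t"
  shows "assoc_raw ls zs s = assoc_raw ls zs t"
proof (rule raw_invariant[OF XYZ(1,2) _ _ s st])
  let ?n = "length ls"
  fix ks x ys g
  assume ks: "sum_list ks = ?n" and x: "x \<in> cset X (length ks)"
    and ys: "ys \<in> tuples (cset Y) ks" and g: "g \<in> ops L ?n"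
  have "length (pm ?n g ls) = sum_list ks" using ks by simp
  then obtain kss zss where kss: "pm ?n g ls = concat kss" "map length kss = ks"
    and zss: "pm ?n g zs = concat zss" "tuple_lists (cset Z) zss kss"
    by (rule ex_split_tuples[OF pm_tuples[OF g zs]])
  have lz: "length zs = ?n" using zs by (rule length_tuples)
  have lc: "length (concat kss) = ?n" "length (concat zss) = ?n"
    using kss(1) zss(1) lz by (metis length_permute)+
  have sc: "sum_list (map sum_list kss) = sum_list ls"
    using kss(1) g by (metis sum_list_pm sum_list_concat)
  have lk: "length kss = length ks" using kss(2) by auto
  have lzk: "length zss = length kss" and mz: "map length zss = map length kss"
    using zss(2) list_all2_lengthD list_all2_tuples_length by blast+
  have a: "gen_args X Y Z kss x ys zss" using x ys zss kss(2) lk by (simp add: gen_args_def)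
  have pm2: "pm ?n (f \<otimes>\<^bsub>gr L ?n\<^esub> g) ls = pm ?n f (concat kss)"
    "pm ?n (f \<otimes>\<^bsub>gr L ?n\<^esub> g) zs = pm ?n f (concat zss)"
    and dm: "delta L ls (f \<otimes>\<^bsub>gr L ?n\<^esub> g) = delta L (concat kss) f \<otimes>\<^bsub>gr L (sum_list ls)\<^esub> delta L ls g"
    if "f \<in> ops L ?n" for f
    using pm_mult[of f ls g] pm_mult[of f zs g] delta_mult[OF that g] that g kss(1) zss(1) lz by simp_all
  {
    fix h assume h: "h \<in> ops L (length ks)"
    let ?h = "delta L ks h"
    have h': "?h \<in> ops L ?n" using h ks delta_in by metis
    \<comment> \<open>\<delta>(h) permutes whole blocks, so the new cutting is the old one with its
      blocks permuted.\<close>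
    have p: "pm ?n (?h \<otimes>\<^bsub>gr L ?n\<^esub> g) ls = concat (pm (length ks) h kss)"
      "pm ?n (?h \<otimes>\<^bsub>gr L ?n\<^esub> g) zs = concat (pm (length ks) h zss)"
      using pm2[OF h'] pm_delta[of h kss] pm_delta[of h zss] h kss(2) lk lzk mz lc by simp_all
    have m: "map length (pm (length ks) h kss) = pm (length ks) h ks"
      using permute_map[of "pr L (length ks) h" kss length] h lk kss(2) by simp
    have d: "delta L ls (?h \<otimes>\<^bsub>gr L ?n\<^esub> g) = delta L (map sum_list kss) h \<otimes>\<^bsub>gr L (sum_list ls)\<^esub> delta L ls g"
      using dm[OF h'] delta_delta[of h kss] kss(2) lk h by simp
    have a': "gen_args X Y Z (pm (length ks) h kss) x (pm (length ks) h ys) (pm (length ks) h zss)"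
      using gen_args_act[OF a] h lk by simp
    have g': "delta L (map sum_list kss) h \<in> ops L (sum_list ls)"
      "sum_list (map sum_list (pm (length ks) h kss)) = sum_list ls"
      using delta_in[of h "map sum_list kss"] sum_list_pm[of h "map sum_list kss"]
        permute_map[of "pr L (length ks) h" kss sum_list] h lk sc by simp_all
    show "assoc_raw ls zs (ks, cact X (length ks) x h, ys, g)
        = assoc_raw ls zs (pm (length ks) h ks, x, pm (length ks) h ys, ?h \<otimes>\<^bsub>gr L ?n\<^esub> g)"
      using assoc_raw_eq[OF kss(1) zss(1) kss(2) zss(2)] assoc_raw_eq[OF p m, of x "pm (length ks) h ys"] d
        right_gen_outer[OF a, of h] right_gen_in[OF a'] a' h lk sc g g'
      by (simp add: act_act gen_args_def)
  next
    fix gs assume gs: "gs \<in> tuples (ops L) ks"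
    let ?h = "beta L ks gs"
    have h': "?h \<in> ops L ?n" using gs ks beta_in by metis
    have gs': "gs \<in> tuples (ops L) (map length kss)" using gs kss(2) by simp
    \<comment> \<open>\<beta>(gs) keeps the blocks in place and permutes inside each of
      them.\<close>
    have p: "pm ?n (?h \<otimes>\<^bsub>gr L ?n\<^esub> g) ls = concat (pms gs kss)"
      "pm ?n (?h \<otimes>\<^bsub>gr L ?n\<^esub> g) zs = concat (pms gs zss)"
      using pm2[OF h'] pm_beta[of gs kss] pm_beta[of gs zss] gs kss(2) lk lzk mz lc by simp_all
    have m: "map length (pms gs kss) = ks" using map_length_pms[OF gs'] kss(2) by simp
    have d: "delta L ls (?h \<otimes>\<^bsub>gr L ?n\<^esub> g)
        = beta L (map sum_list kss) (map2 (delta L) kss gs) \<otimes>\<^bsub>gr L (sum_list ls)\<^esub> delta L ls g"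
      using dm[OF h'] delta_beta_concat[OF gs'] kss(2) by simp
    have g': "beta L (map sum_list kss) (map2 (delta L) kss gs) \<in> ops L (sum_list ls)"
      using beta_in[OF deltas_in[OF gs']] sc by simp
    show "assoc_raw ls zs (ks, x, map3 (cact Y) ks ys gs, g)
        = assoc_raw ls zs (ks, x, ys, ?h \<otimes>\<^bsub>gr L ?n\<^esub> g)"
      unfolding assoc_raw_eq[OF kss(1) zss(1) kss(2) zss(2)] assoc_raw_eq[OF p m pms_tuple_lists[OF gs' zss(2)]] d
      using right_gen_middle(1)[OF a gs'] right_gen_in[OF right_gen_middle(2)[OF a gs']] map_sum_list_pms[OF gs']
        kss(2) sc g g'
      by (simp add: act_act)
  }
qed

definition assoc_fun :: "nat list \<Rightarrow> 'u \<Rightarrow> 'u list \<Rightarrow> 'u" where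
  "assoc_fun ls p zs = assoc_raw ls zs (subst_rep code L X Y (length ls) p)"

lemma assoc_fun_eq:
  assumes a: "gen_args X Y Z kss x ys zss" and zs: "zs \<in> tuples (cset Z) ls"
    and g: "g \<in> ops L (length ls)" and kss: "pm (length ls) g ls = concat kss"
    and zss: "pm (length ls) g zs = concat zss"
  shows "assoc_fun ls (cact (X \<odot> Y) (length ls) (gen X Y (map length kss) x ys) g) zs
    = cact (X \<odot> (Y \<odot> Z)) (sum_list ls) (right_gen X Y Z kss x ys zss) (delta L ls g)"
proof -
  have "sum_list (map length kss) = length ls"
    using kss by (metis length_concat length_permute)
  then have t: "(map length kss, x, ys, g) \<in> raws L X Y (length ls)"
    using a g by (simp add: raws_def gen_args_def)
  show ?thesis
    unfolding assoc_fun_def cls_gen[OF XYZ(1,2) t, symmetric]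
      assoc_raw_invariant[OF zs t subst_rep_cls[OF XYZ(1,2) t], symmetric]
    by (rule assoc_raw_eq) (use a kss zss in \<open>simp_all add: gen_args_def\<close>)
qed

text \<open>Acting by h on p turns its group coordinate g into g h, and \<delta>(g h) factors by
  \<open>delta_mult\<close>. Acting on \<open>zs\<close> produces a \<beta> of permuted entries in
  front of \<delta>(g), which \<open>delta_beta\<close> turns around.\<close>

lemma balanced_assoc_fun: "balanced (X \<odot> Y) Z (X \<odot> (Y \<odot> Z)) assoc_fun"
  unfolding balanced_def
proof (intro allI ballI conjI)
  fix ls p zs assume p: "p \<in> cset (X \<odot> Y) (length ls)" and zs: "zs \<in> tuples (cset Z) ls"
  let ?n = "length ls" and ?act = "cact (X \<odot> (Y \<odot> Z)) (sum_list ls)"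
  obtain ks x ys g where t: "?n = sum_list ks" "x \<in> cset X (length ks)" "ys \<in> tuples (cset Y) ks"
    "g \<in> ops L (sum_list ks)" "p = cact (X \<odot> Y) (sum_list ks) (gen X Y ks x ys) g"
    by (rule sub_cases[OF XYZ(1,2) p])
  have g: "g \<in> ops L ?n" and G: "gen X Y ks x ys \<in> cset (X \<odot> Y) ?n"
    and p': "p = cact (X \<odot> Y) ?n (gen X Y ks x ys) g" using t by simp_all
  \<comment> \<open>The block lengths \<open>ks\<close> belong to the chosen generator, while the
    lists are cut after permuting by f; this is used for g and for g h.\<close>
  have split: "\<exists>kss zss. pm ?n f ls = concat kss \<and> map length kss = ks \<and> pm ?n f zs = concat zss \<and>
      gen_args X Y Z kss x ys zss \<and> sum_list (map sum_list kss) = sum_list ls" if f: "f \<in> ops L ?n" for f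
  proof -
    have "length (pm ?n f ls) = sum_list ks" using t by simp
    then obtain kss zss where k: "pm ?n f ls = concat kss" "map length kss = ks"
      and z: "pm ?n f zs = concat zss" "tuple_lists (cset Z) zss kss"
      by (rule ex_split_tuples[OF pm_tuples[OF f zs]])
    have "length ks = length kss" using k(2) by auto
    then have "gen_args X Y Z kss x ys zss" using t k z by (simp add: gen_args_def)
    moreover have "sum_list (map sum_list kss) = sum_list ls"
      using k(1) f by (metis sum_list_pm sum_list_concat)
    ultimately show ?thesis using k z by blast
  qed
  {
    fix h assume h: "h \<in> ops L ?n"
    have gh: "g \<otimes>\<^bsub>gr L ?n\<^esub> h \<in> ops L ?n" using g h by simp
    obtain kss zss where k: "pm ?n (g \<otimes>\<^bsub>gr L ?n\<^esub> h) ls = concat kss" "map length kss = ks"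
      and z: "pm ?n (g \<otimes>\<^bsub>gr L ?n\<^esub> h) zs = concat zss" and a: "gen_args X Y Z kss x ys zss"
      and sl: "sum_list (map sum_list kss) = sum_list ls"
      using split[OF gh] by blast
    have pm: "pm ?n g (pm ?n h ls) = concat kss" "pm ?n g (pm ?n h zs) = concat zss"
      using pm_mult[of g ls h] pm_mult[of g zs h] k(1) z g h length_tuples[OF zs] by simp_all
    have 1: "assoc_fun ls (cact (X \<odot> Y) ?n p h) zs = ?act (right_gen X Y Z kss x ys zss) (delta L ls (g \<otimes>\<^bsub>gr L ?n\<^esub> h))"
      using assoc_fun_eq[OF a zs gh k(1) z] p' G g h k(2) by (simp add: act_act)
    have 2: "assoc_fun (pm ?n h ls) p (pm ?n h zs) = ?act (right_gen X Y Z kss x ys zss) (delta L (pm ?n h ls) g)"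
      using assoc_fun_eq[OF a pm_tuples[OF h zs], of g] k(2) pm g h p' by simp
    have "delta L (pm ?n h ls) g \<in> ops L (sum_list ls)"
      using delta_in[of g "pm ?n h ls"] g h by simp
    then show "assoc_fun ls (cact (X \<odot> Y) ?n p h) zs
      = ?act (assoc_fun (pm ?n h ls) p (pm ?n h zs)) (delta L ls h)"
      unfolding 1 2 using right_gen_in[OF a] g h sl delta_mult[OF g h] by (simp add: act_act)
  }
  obtain kss zss where kss: "pm ?n g ls = concat kss" "map length kss = ks"
    and zss: "pm ?n g zs = concat zss" and a: "gen_args X Y Z kss x ys zss"
    and sl: "sum_list (map sum_list kss) = sum_list ls"
    using split[OF g] by blast
  have eq: "assoc_fun ls p zs = ?act (right_gen X Y Z kss x ys zss) (delta L ls g)"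
    unfolding p' using assoc_fun_eq[OF a zs g kss(1) zss] kss(2) by simp
  show "assoc_fun ls p zs \<in> cset (X \<odot> (Y \<odot> Z)) (sum_list ls)"
    unfolding eq using right_gen_in[OF a] sl g by simp
  fix cs assume cs: "cs \<in> tuples (ops L) ls"
  have "pm ?n g cs \<in> tuples (ops L) (concat kss)"
    using pm_tuples[OF g cs] kss(1) by simp
  then obtain css where css: "pm ?n g cs = concat css" "tuple_lists (ops L) css kss"
    by (rule ex_tuple_lists)
  have zss': "tuple_lists (cset Z) zss kss" using a by (simp add: gen_args_def)
  have zc: "map3 (cact Z) ls zs cs \<in> tuples (cset Z) ls" using zs cs by simp
  have pz: "pm ?n g (map3 (cact Z) ls zs cs) = concat (map3 (map3 (cact Z)) kss zss css)"
    using permute_map3[of "pr L ?n g" ls zs cs "cact Z"] g zs cs kss(1) zss zss' css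
    by (simp add: concat_map3 length_tuples)
  have a': "gen_args X Y Z kss x ys (map3 (map3 (cact Z)) kss zss css)"
    using a css(2) by (simp add: gen_args_def) (simp add: tuple_lists_iff)
  \<comment> \<open>\<beta>(cs) has to end up on the right of \<delta>(g); both products equal
    \<mu>(g; cs).\<close>
  have "beta L (concat kss) (concat css) \<otimes>\<^bsub>gr L (sum_list ls)\<^esub> delta L ls g
      = delta L ls g \<otimes>\<^bsub>gr L (sum_list ls)\<^esub> beta L ls cs"
    using delta_beta[OF g cs] kss(1) css(1) by simp
  moreover have "beta L (concat kss) (concat css) \<in> ops L (sum_list ls)"
    using beta_in[OF list_all2_tuples_concat[OF css(2)]] sl by (simp add: sum_list_concat)
  ultimately show "assoc_fun ls p (map3 (cact Z) ls zs cs) = ?act (assoc_fun ls p zs) (beta L ls cs)"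
    unfolding eq using assoc_fun_eq[OF a' zc g kss(1) pz] right_gen_inner[OF a css(2)] right_gen_in[OF a]
      p' kss(2) sl g cs by (simp add: act_act)
qed

definition assoc :: "nat \<Rightarrow> 'u \<Rightarrow> 'u" where
  "assoc = lift (X \<odot> Y) Z (X \<odot> (Y \<odot> Z)) assoc_fun"

lemma assoc_hom: "assoc \<in> chom ((X \<odot> Y) \<odot> Z) (X \<odot> (Y \<odot> Z))"
  unfolding assoc_def by (intro lift_hom balanced_assoc_fun coll_sub XYZ)

lemma assoc_left_gen [simp]:
  assumes a: "gen_args X Y Z kss x ys zss"
  shows "assoc (sum_list (map sum_list kss)) (left_gen X Y Z kss x ys zss) = right_gen X Y Z kss x ys zss"
proof -
  note G = gen_args_inner_in[OF a]
  have zs: "concat zss \<in> tuples (cset Z) (concat kss)"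
    using a by (simp add: gen_args_def list_all2_tuples_concat)
  have "assoc (sum_list (map sum_list kss)) (left_gen X Y Z kss x ys zss)
    = assoc_fun (concat kss) (gen X Y (map length kss) x ys) (concat zss)"
    unfolding assoc_def left_gen_def sum_list_concat[symmetric]
    by (intro lift_gen balanced_assoc_fun G zs coll_sub XYZ)
  also have "\<dots> = right_gen X Y Z kss x ys zss"
    using assoc_fun_eq[OF a zs e_in] G right_gen_in[OF a] by (simp add: sum_list_concat)
  finally show ?thesis .
qed

section \<open>The inverse of the associator\<close>

text \<open>The group element leaves in two stages: the action on x becomes \<delta>(h) acting on
  the inner generator, and then \<delta> of \<delta>(h) acting on the whole.
  \<open>delta_delta\<close> makes these one \<delta> over the block totals.\<close>

lemma left_gen_outer:
  assumes a: "gen_args X Y Z kss x ys zss" and h: "h \<in> ops L (length kss)"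
  shows "left_gen X Y Z kss (cact X (length kss) x h) ys zss
    = cact ((X \<odot> Y) \<odot> Z) (sum_list (map sum_list kss))
        (left_gen X Y Z (pm (length kss) h kss) x (pm (length kss) h ys) (pm (length kss) h zss))
        (delta L (map sum_list kss) h)"
proof -
  let ?n = "length kss" and ?ks = "map length kss"
  have x: "x \<in> cset X ?n" and ys: "ys \<in> tuples (cset Y) ?ks" and zss: "tuple_lists (cset Z) zss kss"
    using a by (simp_all add: gen_args_def)
  have m: "map length (pm ?n h kss) = pm ?n h ?ks"
    using permute_map[of "pr L ?n h" kss length] h by simp
  have l: "length (concat kss) = sum_list ?ks" "length (concat zss) = sum_list ?ks" "map length zss = ?ks" "length zss = ?n"
    using list_all2_tuples_length[OF zss] list_all2_lengthD[OF zss] by (simp_all add: length_concat)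
  have p: "gen X Y (pm ?n h ?ks) x (pm ?n h ys) \<in> cset (X \<odot> Y) (length (concat kss))"
    using gen_args_inner_in[OF gen_args_act[OF a h]] sum_list_pm[of h ?ks] h
    by (simp add: m length_concat)
  have dh: "delta L ?ks h \<in> ops L (length (concat kss))" using delta_in[of h ?ks] h l by simp
  have "gen X Y ?ks (cact X ?n x h) ys
      = cact (X \<odot> Y) (length (concat kss)) (gen X Y (pm ?n h ?ks) x (pm ?n h ys)) (delta L ?ks h)"
    using gen_outer[OF XYZ(1,2), of x ?ks h ys] x ys h l by simp
  then show ?thesis
    unfolding left_gen_def m
    using gen_outer[OF coll_sub[OF XYZ(1,2)] XYZ(3) p dh list_all2_tuples_concat[OF zss]]
      pm_delta[of h kss] pm_delta[of h zss] h l delta_delta[of h kss]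
    by (simp add: sum_list_concat)
qed

lemma left_gen_middle:
  assumes a: "gen_args X Y Z kss x ys zss" and hs: "hs \<in> tuples (ops L) (map length kss)"
  shows "left_gen X Y Z kss x (map3 (cact Y) (map length kss) ys hs) zss
    = cact ((X \<odot> Y) \<odot> Z) (sum_list (map sum_list kss)) (left_gen X Y Z (pms hs kss) x ys (pms hs zss))
        (beta L (map sum_list kss) (map2 (delta L) kss hs))"
proof -
  let ?ks = "map length kss"
  have x: "x \<in> cset X (length kss)" and ys: "ys \<in> tuples (cset Y) ?ks" and zss: "tuple_lists (cset Z) zss kss"
    using a by (simp_all add: gen_args_def)
  have l: "length (concat kss) = sum_list ?ks" "length (concat zss) = sum_list ?ks" "map length zss = ?ks"
    using list_all2_tuples_length[OF zss] by (simp_all add: length_concat)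
  have "gen X Y ?ks x (map3 (cact Y) ?ks ys hs)
      = cact (X \<odot> Y) (length (concat kss)) (gen X Y ?ks x ys) (beta L ?ks hs)"
    using gen_inner[OF XYZ(1,2) _ hs ys, of x] x l by simp
  then show ?thesis
    unfolding left_gen_def map_length_pms[OF hs]
    using gen_outer[OF coll_sub[OF XYZ(1,2)] XYZ(3) gen_args_inner_in[OF a] _ list_all2_tuples_concat[OF zss], of "beta L ?ks hs"]
      beta_in[OF hs] pm_beta[of hs kss] pm_beta[of hs zss] hs l delta_beta_concat[OF hs]
    by (simp add: sum_list_concat)
qed

lemma left_gen_inner:
  assumes a: "gen_args X Y Z kss x ys zss" and css: "tuple_lists (ops L) css kss"
  shows "left_gen X Y Z kss x ys (map3 (map3 (cact Z)) kss zss css)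
    = cact ((X \<odot> Y) \<odot> Z) (sum_list (map sum_list kss)) (left_gen X Y Z kss x ys zss)
        (beta L (map sum_list kss) (map2 (beta L) kss css))"
proof -
  have zss: "tuple_lists (cset Z) zss kss" using a by (simp add: gen_args_def)
  show ?thesis
    unfolding left_gen_def
    using gen_inner[OF coll_sub[OF XYZ(1,2)] XYZ(3) gen_args_inner_in[OF a] list_all2_tuples_concat[OF css] list_all2_tuples_concat[OF zss]]
    by (simp add: concat_map3[OF zss css] beta_concat[OF css] sum_list_concat)
qed

text \<open>The value that balancedness forces on x with the tuple of classes (y_i; z_i; g_i): the
  g_i come out together as \<beta>(g_1, ..., g_r).\<close>

definition assoc_inv_val :: "nat list list \<Rightarrow> 'u \<Rightarrow> 'u list \<Rightarrow> 'u list list \<Rightarrow> 'u list \<Rightarrow> 'u" where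
  "assoc_inv_val kss x ys zss gs = cact ((X \<odot> Y) \<odot> Z) (sum_list (map sum_list kss))
     (left_gen X Y Z kss x ys zss) (beta L (map sum_list kss) gs)"

definition assoc_inv_raw :: "'u \<Rightarrow> 'u raw list \<Rightarrow> 'u" where
  "assoc_inv_raw x ts = assoc_inv_val (map fst ts) x (map (\<lambda>t. fst (snd t)) ts)
     (map (\<lambda>t. fst (snd (snd t))) ts) (map (\<lambda>t. snd (snd (snd t))) ts)"

text \<open>The equivalence relation concerns single entries, that is, raw elements, whereas the
  rules for \<beta> and \<delta> need the four coordinates as separate lists.\<close>

definition zip4 :: "nat list list \<Rightarrow> 'u list \<Rightarrow> 'u list list \<Rightarrow> 'u list \<Rightarrow> 'u raw list" where
  "zip4 kss ys zss gs = zip kss (zip ys (zip zss gs))"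

lemma zip4_Cons [simp]: "zip4 (ks # kss) (y # ys) (zs # zss) (g # gs) = (ks, y, zs, g) # zip4 kss ys zss gs"
  by (simp add: zip4_def)

lemma assoc_inv_raw_zip4:
  assumes "length ys = length kss" "length zss = length kss" "length gs = length kss"
  shows "assoc_inv_raw x (zip4 kss ys zss gs) = assoc_inv_val kss x ys zss gs"
proof -
  have "map fst (zip4 kss ys zss gs) = kss" "map (\<lambda>t. fst (snd t)) (zip4 kss ys zss gs) = ys"
    "map (\<lambda>t. fst (snd (snd t))) (zip4 kss ys zss gs) = zss"
    "map (\<lambda>t. snd (snd (snd t))) (zip4 kss ys zss gs) = gs"
    using assms by (auto intro!: nth_equalityI simp: zip4_def)
  then show ?thesis by (simp add: assoc_inv_raw_def)
qed

text \<open>Taking neutral elements shows that both moves are reflexive; hence a move in one entry of a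
  list is a move in all entries simultaneously, and these can be computed with.\<close>

definition outer_move :: "'u raw \<Rightarrow> 'u raw \<Rightarrow> bool" where
  "outer_move t t' \<longleftrightarrow> (\<exists>ks y zs h g. y \<in> cset Y (length ks) \<and> zs \<in> tuples (cset Z) ks \<and>
     h \<in> ops L (length ks) \<and> g \<in> ops L (sum_list ks) \<and> t = (ks, cact Y (length ks) y h, zs, g) \<and>
     t' = (pm (length ks) h ks, y, pm (length ks) h zs, delta L ks h \<otimes>\<^bsub>gr L (sum_list ks)\<^esub> g))"

definition inner_move :: "'u raw \<Rightarrow> 'u raw \<Rightarrow> bool" where
  "inner_move t t' \<longleftrightarrow> (\<exists>ks y zs cs g. y \<in> cset Y (length ks) \<and> zs \<in> tuples (cset Z) ks \<and>
     cs \<in> tuples (ops L) ks \<and> g \<in> ops L (sum_list ks) \<and> t = (ks, y, map3 (cact Z) ks zs cs, g) \<and>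
     t' = (ks, y, zs, beta L ks cs \<otimes>\<^bsub>gr L (sum_list ks)\<^esub> g))"

lemma outer_move_refl:
  assumes "t \<in> raws L Y Z k"
  shows "outer_move t t"
proof -
  obtain ks y zs g where t: "t = (ks, y, zs, g)" using prod_cases4 by metis
  then have "y \<in> cset Y (length ks)" "zs \<in> tuples (cset Z) ks" "g \<in> ops L (sum_list ks)"
    using assms by (auto simp: raws_def)
  then show ?thesis unfolding outer_move_def t
    by (intro exI[of _ ks] exI[of _ y] exI[of _ zs] exI[of _ "e (length ks)"] exI[of _ g]) simp
qed

lemma inner_move_refl:
  assumes "t \<in> raws L Y Z k"
  shows "inner_move t t"
proof -
  obtain ks y zs g where t: "t = (ks, y, zs, g)" using prod_cases4 by metis
  then have "y \<in> cset Y (length ks)" "zs \<in> tuples (cset Z) ks" "g \<in> ops L (sum_list ks)"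
    using assms by (auto simp: raws_def)
  then show ?thesis unfolding inner_move_def t
    by (intro exI[of _ ks] exI[of _ y] exI[of _ zs] exI[of _ "map e ks"] exI[of _ g]) simp
qed

text \<open>The witnesses chosen separately for the entries are collected into lists, to which the
  calculus for nested forms applies.\<close>

lemma outer_moves_zip4:
  assumes "list_all2 outer_move ts ts'"
  shows "\<exists>kss ys zss hs gs. ys \<in> tuples (cset Y) (map length kss) \<and> tuple_lists (cset Z) zss kss \<and>
    hs \<in> tuples (ops L) (map length kss) \<and> gs \<in> tuples (ops L) (map sum_list kss) \<and>
    ts = zip4 kss (map3 (cact Y) (map length kss) ys hs) zss gs \<and>
    ts' = zip4 (pms hs kss) ys (pms hs zss) (muls (map sum_list kss) (map2 (delta L) kss hs) gs)"
  using assms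
proof (induction rule: list_all2_induct)
  case Nil
  show ?case by (intro exI[of _ "[]"]) (simp add: zip4_def)
next
  case (Cons t ts t' ts')
  from Cons.hyps(1) obtain ks y zs h g where t: "y \<in> cset Y (length ks)" "zs \<in> tuples (cset Z) ks"
    "h \<in> ops L (length ks)" "g \<in> ops L (sum_list ks)" "t = (ks, cact Y (length ks) y h, zs, g)"
    "t' = (pm (length ks) h ks, y, pm (length ks) h zs, delta L ks h \<otimes>\<^bsub>gr L (sum_list ks)\<^esub> g)"
    unfolding outer_move_def by blast
  from Cons.IH show ?case
  proof (elim exE, goal_cases)
    case (1 kss ys zss hs gs)
    with t length_tuples[OF t(2)] show ?case
      by (intro exI[of _ "ks # kss"] exI[of _ "y # ys"] exI[of _ "zs # zss"] exI[of _ "h # hs"] exI[of _ "g # gs"])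
        simp
  qed
qed

lemma inner_moves_zip4:
  assumes "list_all2 inner_move ts ts'"
  shows "\<exists>kss ys zss css gs. ys \<in> tuples (cset Y) (map length kss) \<and> tuple_lists (cset Z) zss kss \<and>
    tuple_lists (ops L) css kss \<and> gs \<in> tuples (ops L) (map sum_list kss) \<and>
    ts = zip4 kss ys (map3 (map3 (cact Z)) kss zss css) gs \<and>
    ts' = zip4 kss ys zss (muls (map sum_list kss) (map2 (beta L) kss css) gs)"
  using assms
proof (induction rule: list_all2_induct)
  case Nil
  show ?case by (intro exI[of _ "[]"]) (simp add: zip4_def)
next
  case (Cons t ts t' ts')
  from Cons.hyps(1) obtain ks y zs cs g where t: "y \<in> cset Y (length ks)" "zs \<in> tuples (cset Z) ks"
    "cs \<in> tuples (ops L) ks" "g \<in> ops L (sum_list ks)" "t = (ks, y, map3 (cact Z) ks zs cs, g)"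
    "t' = (ks, y, zs, beta L ks cs \<otimes>\<^bsub>gr L (sum_list ks)\<^esub> g)"
    unfolding inner_move_def by blast
  from Cons.IH show ?case
  proof (elim exE, goal_cases)
    case (1 kss ys zss css gs)
    with t show ?case
      by (intro exI[of _ "ks # kss"] exI[of _ "y # ys"] exI[of _ "zs # zss"] exI[of _ "cs # css"] exI[of _ "g # gs"])
        simp
  qed
qed

text \<open>By \<open>left_gen_middle\<close> the h_i come out as \<beta> of the elements
  \<delta>(h_i), and multiplicativity of \<beta> merges this with \<beta>(gs). The moves multiply
  the last coordinates by the same \<delta>(h_i).\<close>

lemma assoc_inv_raw_outer_moves:
  assumes x: "x \<in> cset X (length ts)" and ts: "list_all2 outer_move ts ts'"
  shows "assoc_inv_raw x ts = assoc_inv_raw x ts'"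
  using outer_moves_zip4[OF ts]
proof (elim exE conjE)
  fix kss :: "nat list list" and ys zss hs gs
  let ?ks = "map length kss" and ?ms = "map sum_list kss"
  assume o: "ys \<in> tuples (cset Y) ?ks" "tuple_lists (cset Z) zss kss" "hs \<in> tuples (ops L) ?ks"
    "gs \<in> tuples (ops L) ?ms" "ts = zip4 kss (map3 (cact Y) ?ks ys hs) zss gs"
    "ts' = zip4 (pms hs kss) ys (pms hs zss) (muls ?ms (map2 (delta L) kss hs) gs)"
  have l: "length ys = length kss" "length zss = length kss" "length hs = length kss" "length gs = length kss"
    using length_tuples[OF o(1)] list_all2_lengthD[OF o(2)] length_tuples[OF o(3)] length_tuples[OF o(4)]
    by simp_all
  have a: "gen_args X Y Z kss x ys zss" using x o(1,2,5) l by (simp add: zip4_def gen_args_def)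
  from left_gen_in[OF right_gen_middle(2)[OF a o(3)]] show ?thesis
    unfolding o(5,6) using o(3,4) l left_gen_middle[OF a o(3)] map_sum_list_pms[OF o(3)]
    by (simp add: assoc_inv_raw_zip4 assoc_inv_val_def act_act beta_mult)
qed

lemma assoc_inv_raw_inner_moves:
  assumes x: "x \<in> cset X (length ts)" and ts: "list_all2 inner_move ts ts'"
  shows "assoc_inv_raw x ts = assoc_inv_raw x ts'"
  using inner_moves_zip4[OF ts]
proof (elim exE conjE)
  fix kss :: "nat list list" and ys zss css gs
  let ?ms = "map sum_list kss"
  assume o: "ys \<in> tuples (cset Y) (map length kss)" "tuple_lists (cset Z) zss kss"
    "tuple_lists (ops L) css kss" "gs \<in> tuples (ops L) ?ms"
    "ts = zip4 kss ys (map3 (map3 (cact Z)) kss zss css) gs"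
    "ts' = zip4 kss ys zss (muls ?ms (map2 (beta L) kss css) gs)"
  have l: "length ys = length kss" "length zss = length kss" "length css = length kss" "length gs = length kss"
    using length_tuples[OF o(1)] list_all2_lengthD[OF o(2)] list_all2_lengthD[OF o(3)] length_tuples[OF o(4)]
    by simp_all
  have a: "gen_args X Y Z kss x ys zss" using x o(1,2,5) l by (simp add: zip4_def gen_args_def)
  from left_gen_in[OF a] show ?thesis
    unfolding o(5,6) using o(3,4) l left_gen_inner[OF a o(3)]
    by (simp add: assoc_inv_raw_zip4 assoc_inv_val_def act_act beta_mult)
qed

lemma assoc_inv_raw_invariant1:
  assumes x: "x \<in> cset X (length (us @ s # vs))"
    and us: "us \<in> tuples (raws L Y Z) ms" and vs: "vs \<in> tuples (raws L Y Z) ns"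
    and s: "s \<in> raws L Y Z k" and st: "equivclp (subst_step L Y Z) s t"
  shows "assoc_inv_raw x (us @ s # vs) = assoc_inv_raw x (us @ t # vs)"
proof (rule raw_invariant[OF XYZ(2,3) _ _ s st])
  have "\<exists>k. a \<in> raws L Y Z k" if "a \<in> set us \<union> set vs" for a
    using that us vs by (auto simp: tuples_iff in_set_conv_nth)
  then have r: "outer_move a a" "inner_move a a" if "a \<in> set us \<union> set vs" for a
    using that outer_move_refl inner_move_refl by blast+
  have o: "list_all2 outer_move (us @ a # vs) (us @ b # vs)" if "outer_move a b" for a b
    using that r by (intro list_all2_appendI) (simp_all add: list_all2_same)
  have i: "list_all2 inner_move (us @ a # vs) (us @ b # vs)" if "inner_move a b" for a b
    using that r by (intro list_all2_appendI) (simp_all add: list_all2_same)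
  fix ks y zs g
  assume a: "sum_list ks = k" "y \<in> cset Y (length ks)" "zs \<in> tuples (cset Z) ks" "g \<in> ops L k"
  show "assoc_inv_raw x (us @ (ks, cact Y (length ks) y h, zs, g) # vs)
      = assoc_inv_raw x (us @ (pm (length ks) h ks, y, pm (length ks) h zs, delta L ks h \<otimes>\<^bsub>gr L k\<^esub> g) # vs)"
    if "h \<in> ops L (length ks)" for h
    by (rule assoc_inv_raw_outer_moves[OF _ o]) (use x a that in \<open>auto simp: outer_move_def\<close>)
  show "assoc_inv_raw x (us @ (ks, y, map3 (cact Z) ks zs cs, g) # vs)
      = assoc_inv_raw x (us @ (ks, y, zs, beta L ks cs \<otimes>\<^bsub>gr L k\<^esub> g) # vs)"
    if "cs \<in> tuples (ops L) ks" for cs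
    by (rule assoc_inv_raw_inner_moves[OF _ i]) (use x a that in \<open>auto simp: inner_move_def\<close>)
qed

text \<open>Entries are exchanged from left to right. The prefix \<open>us\<close> collects those
  already exchanged, so that the list keeps its full length and continues to match the arity of
  x.\<close>

lemma assoc_inv_raw_invariant:
  assumes x: "x \<in> cset X (length ts)"
    and ts: "ts \<in> tuples (raws L Y Z) ms" and eq: "list_all2 (equivclp (subst_step L Y Z)) ts ts'"
  shows "assoc_inv_raw x ts = assoc_inv_raw x ts'"
proof -
  have "assoc_inv_raw x (us @ ts) = assoc_inv_raw x (us @ ts')"
    if "us \<in> tuples (raws L Y Z) ns" "x \<in> cset X (length us + length ts)" for us ns
    using eq that ts
  proof (induction arbitrary: us ns ms rule: list_all2_induct)
    case (Cons t ts t' ts')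
    obtain m ms' where m: "t \<in> raws L Y Z m" "ts \<in> tuples (raws L Y Z) ms'"
      using Cons.prems(3) by (cases ms) auto
    have t': "t' \<in> raws L Y Z m" by (rule equivclp_raws[OF XYZ(2,3) Cons.hyps(1) m(1)])
    have "assoc_inv_raw x (us @ t # ts) = assoc_inv_raw x (us @ t' # ts)"
      by (rule assoc_inv_raw_invariant1[OF _ Cons.prems(1) m(2,1) Cons.hyps(1)])
        (use Cons.prems(2) in simp)
    also have "\<dots> = assoc_inv_raw x ((us @ [t']) @ ts)" by simp
    also have "\<dots> = assoc_inv_raw x ((us @ [t']) @ ts')"
      by (rule Cons.IH[of "us @ [t']" "ns @ [m]", OF _ _ m(2)])
        (use Cons.prems(1,2) t' in \<open>auto simp: tuples_def intro: list_all2_appendI\<close>)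
    finally show ?case by simp
  qed simp
  from this[of "[]" "[]"] x show ?thesis by simp
qed

definition assoc_inv_fun :: "nat list \<Rightarrow> 'u \<Rightarrow> 'u list \<Rightarrow> 'u" where
  "assoc_inv_fun ms x qs = assoc_inv_raw x (map2 (subst_rep code L Y Z) ms qs)"

text \<open>The representatives picked by \<open>subst_rep\<close> are equivalent, entry by entry,
  to the ones displayed here.\<close>

lemma assoc_inv_fun_eq:
  assumes a: "gen_args X Y Z kss x ys zss" and gs: "gs \<in> tuples (ops L) (map sum_list kss)"
  shows "assoc_inv_fun (map sum_list kss) x
      (map3 (cact (Y \<odot> Z)) (map sum_list kss) (map3 (gen Y Z) kss ys zss) gs)
    = assoc_inv_val kss x ys zss gs"
proof -
  let ?ms = "map sum_list kss"
  let ?qs = "map3 (cact (Y \<odot> Z)) ?ms (map3 (gen Y Z) kss ys zss) gs"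
  have ys: "ys \<in> tuples (cset Y) (map length kss)" and zss: "tuple_lists (cset Z) zss kss"
    using a by (simp_all add: gen_args_def)
  have l: "length ys = length kss" "length zss = length kss" "length gs = length kss"
    using length_tuples[OF ys] list_all2_lengthD[OF zss] length_tuples[OF gs] by simp_all
  have r: "(kss ! i, ys ! i, zss ! i, gs ! i) \<in> raws L Y Z (sum_list (kss ! i))" if "i < length kss" for i
    using that ys zss gs by (simp add: raws_def tuple_lists_iff tuples_iff[of ys] tuples_iff[of gs])
  have t: "zip4 kss ys zss gs \<in> tuples (raws L Y Z) ?ms"
    using r l by (simp add: tuples_iff zip4_def)
  have "list_all2 (equivclp (subst_step L Y Z)) (zip4 kss ys zss gs) (map2 (subst_rep code L Y Z) ?ms ?qs)"
    using subst_rep_cls[OF XYZ(2,3) r] cls_gen[OF XYZ(2,3) r] l by (simp add: list_all2_conv_all_nth zip4_def)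
  from assoc_inv_raw_invariant[OF _ t this] a l show ?thesis
    by (simp add: assoc_inv_fun_def assoc_inv_raw_zip4) (simp add: zip4_def gen_args_def)
qed

lemma balanced_assoc_inv_fun: "balanced X (Y \<odot> Z) ((X \<odot> Y) \<odot> Z) assoc_inv_fun"
  unfolding balanced_def
proof (intro allI ballI conjI)
  fix ms x qs assume x: "x \<in> cset X (length ms)" and qs: "qs \<in> tuples (cset (Y \<odot> Z)) ms"
  obtain kss ys zss gs where k: "ms = map sum_list kss" and ys: "ys \<in> tuples (cset Y) (map length kss)"
    and zss: "tuple_lists (cset Z) zss kss" and gs: "gs \<in> tuples (ops L) ms"
    and q: "qs = map3 (cact (Y \<odot> Z)) ms (map3 (gen Y Z) kss ys zss) gs"
    by (rule gen_tuples_cases[OF XYZ(2,3) qs])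
  have a: "gen_args X Y Z kss x ys zss" using x ys zss k by (simp add: gen_args_def)
  have l: "length ys = length kss" "length zss = length kss" "length gs = length kss"
    using length_tuples[OF ys] list_all2_lengthD[OF zss] length_tuples[OF gs] k by simp_all
  have eq: "assoc_inv_fun ms x (map3 (cact (Y \<odot> Z)) ms (map3 (gen Y Z) kss ys zss) gs)
      = cact ((X \<odot> Y) \<odot> Z) (sum_list ms) (left_gen X Y Z kss x ys zss) (beta L ms gs)"
    if "gen_args X Y Z kss x ys zss" "gs \<in> tuples (ops L) ms" "ms = map sum_list kss" for ms kss x ys zss gs
    using assoc_inv_fun_eq[OF that(1)] that(2,3) by (simp add: assoc_inv_val_def)
  note lg = left_gen_in[OF a, folded k]
  show "assoc_inv_fun ms x qs \<in> cset ((X \<odot> Y) \<odot> Z) (sum_list ms)"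
    unfolding q eq[OF a gs k] using lg gs by simp
  {
    fix h assume hm: "h \<in> ops L (length ms)"
    let ?n = "length kss"
    have h: "h \<in> ops L ?n" and lm: "length ms = ?n" using hm k by simp_all
    have ah: "gen_args X Y Z kss (cact X ?n x h) ys zss" using a h by (simp add: gen_args_def)
    have a': "gen_args X Y Z (pm ?n h kss) x (pm ?n h ys) (pm ?n h zss)" by (rule gen_args_act[OF a h])
    have m: "pm ?n h ms = map sum_list (pm ?n h kss)"
      using permute_map[of "pr L ?n h" kss sum_list] h k by simp
    have gs': "pm ?n h gs \<in> tuples (ops L) (pm ?n h ms)" using pm_tuples[of h ms gs] h gs lm by simp
    have pq: "pm ?n h qs = map3 (cact (Y \<odot> Z)) (pm ?n h ms)
        (map3 (gen Y Z) (pm ?n h kss) (pm ?n h ys) (pm ?n h zss)) (pm ?n h gs)"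
      unfolding q using permute_map3[of "pr L ?n h" ms _ gs "cact (Y \<odot> Z)"] permute_map3[of "pr L ?n h" kss ys zss "gen Y Z"]
        h l lm by simp
    have s: "sum_list (pm ?n h ms) = sum_list ms" using sum_list_pm[of h ms] h lm by simp
    have "delta L ms h \<in> ops L (sum_list ms)" using delta_in[of h ms] h lm by simp
    moreover have "beta L (pm ?n h ms) (pm ?n h gs) \<in> ops L (sum_list ms)" using beta_in[OF gs'] s by simp
    \<comment> \<open>Acting on x first makes \<delta>(h) come out before \<beta>(gs); acting
      afterwards puts it behind \<beta> of the permuted entries.\<close>
    moreover have "delta L ms h \<otimes>\<^bsub>gr L (sum_list ms)\<^esub> beta L ms gs
        = beta L (pm ?n h ms) (pm ?n h gs) \<otimes>\<^bsub>gr L (sum_list ms)\<^esub> delta L ms h"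
      using delta_beta[of h ms gs] h gs lm by simp
    moreover have "left_gen X Y Z (pm ?n h kss) x (pm ?n h ys) (pm ?n h zss) \<in> cset ((X \<odot> Y) \<odot> Z) (sum_list ms)"
      using left_gen_in[OF a'] s m by simp
    ultimately show "assoc_inv_fun ms (cact X (length ms) x h) qs
      = cact ((X \<odot> Y) \<odot> Z) (sum_list ms) (assoc_inv_fun (pm (length ms) h ms) x (pm (length ms) h qs)) (delta L ms h)"
      unfolding lm pq eq[OF a' gs' m] s unfolding q eq[OF ah gs k] left_gen_outer[OF a h, folded k]
      using gs by (simp add: act_act)
  }
  fix cs assume cs: "cs \<in> tuples (ops L) ms"
  have G: "map3 (gen Y Z) kss ys zss \<in> tuples (cset (Y \<odot> Z)) ms" using gens_in[OF ys zss] k by simp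
  show "assoc_inv_fun ms x (map3 (cact (Y \<odot> Z)) ms qs cs)
    = cact ((X \<odot> Y) \<odot> Z) (sum_list ms) (assoc_inv_fun ms x qs) (beta L ms cs)"
    unfolding q acts_acts[OF coll_sub[OF XYZ(2,3)] G gs cs] eq[OF a gs k] eq[OF a mults_in[OF gs cs] k]
    using lg gs cs by (simp add: act_act beta_mult)
qed

definition assoc_inv :: "nat \<Rightarrow> 'u \<Rightarrow> 'u" where
  "assoc_inv = lift X (Y \<odot> Z) ((X \<odot> Y) \<odot> Z) assoc_inv_fun"

lemma assoc_inv_hom: "assoc_inv \<in> chom (X \<odot> (Y \<odot> Z)) ((X \<odot> Y) \<odot> Z)"
  unfolding assoc_inv_def by (intro lift_hom balanced_assoc_inv_fun coll_sub XYZ)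

lemma assoc_inv_right_gen [simp]:
  assumes a: "gen_args X Y Z kss x ys zss"
  shows "assoc_inv (sum_list (map sum_list kss)) (right_gen X Y Z kss x ys zss) = left_gen X Y Z kss x ys zss"
proof -
  have x: "x \<in> cset X (length (map sum_list kss))"
    and G: "map3 (gen Y Z) kss ys zss \<in> tuples (cset (Y \<odot> Z)) (map sum_list kss)"
    using a by (simp_all add: gen_args_def gens_in)
  have "assoc_inv (sum_list (map sum_list kss)) (right_gen X Y Z kss x ys zss)
    = assoc_inv_fun (map sum_list kss) x (map3 (gen Y Z) kss ys zss)"
    unfolding assoc_inv_def right_gen_def by (intro lift_gen balanced_assoc_inv_fun XYZ coll_sub G x)
  \<comment> \<open>The generators are read as acted on by neutral elements, to fit
    \<open>assoc_inv_fun_eq\<close>.\<close>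
  also have "\<dots> = assoc_inv_val kss x ys zss (map e (map sum_list kss))"
    using assoc_inv_fun_eq[OF a es_in] acts_es[OF coll_sub[OF XYZ(2,3)] G] by simp
  also have "\<dots> = left_gen X Y Z kss x ys zss"
    unfolding assoc_inv_val_def using left_gen_in[OF a] beta_e[of "map sum_list kss"] by simp
  finally show ?thesis .
qed

end

section \<open>The monoidal category of collections\<close>

text \<open>Of the three objects given to \<open>Cmp\<close>, the composite depends only on the
  source, to which it is restricted.\<close>

definition ccomp :: "'u collection \<Rightarrow> (nat \<Rightarrow> 'u \<Rightarrow> 'u) \<Rightarrow> (nat \<Rightarrow> 'u \<Rightarrow> 'u) \<Rightarrow> nat \<Rightarrow> 'u \<Rightarrow> 'u" where
  "ccomp X g f = (\<lambda>n. compose (cset X n) (g n) (f n))"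

definition cid :: "'u collection \<Rightarrow> nat \<Rightarrow> 'u \<Rightarrow> 'u" where
  "cid X = (\<lambda>n. \<lambda>x\<in>cset X n. x)"

lemma coll_cat_simps [simp]:
  "Ob (coll_cat small L) = {X. coll X}" "Hom (coll_cat small L) = coll_hom L"
  "Idn (coll_cat small L) = cid" "Cmp (coll_cat small L) X Y Z g f = ccomp X g f"
  by (auto simp: coll_cat_def cid_def ccomp_def fun_eq_iff)

lemma ccomp_apply [simp]: "x \<in> cset X n \<Longrightarrow> ccomp X g f n x = g n (f n x)"
  by (simp add: ccomp_def compose_def)

lemma cid_apply [simp]: "x \<in> cset X n \<Longrightarrow> cid X n x = x"
  by (simp add: cid_def)

lemma homI:
  assumes "\<And>n. f n \<in> extensional (cset X n)" "\<And>n x. x \<in> cset X n \<Longrightarrow> f n x \<in> cset Y n"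
    and "\<And>n x g. x \<in> cset X n \<Longrightarrow> g \<in> ops L n \<Longrightarrow> f n (cact X n x g) = cact Y n (f n x) g"
  shows "f \<in> chom X Y"
  using assms by (simp add: coll_hom_def PiE_def)

lemma ccomp_hom:
  assumes "coll X" "f \<in> chom X Y" "g \<in> chom Y Z"
  shows "ccomp X g f \<in> chom X Z"
proof (rule homI)
  show "ccomp X g f n \<in> extensional (cset X n)" for n by (simp add: ccomp_def)
qed (use assms in \<open>simp_all add: hom_in hom_act\<close>)

lemma cid_hom [simp]: "coll X \<Longrightarrow> cid X \<in> chom X X"
  by (rule homI) (simp_all add: cid_def)

lemma map2_cid: "xs \<in> tuples (cset X) ks \<Longrightarrow> map2 (cid X) ks xs = xs"
  by (intro nth_equalityI) (simp_all add: tuples_iff)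

lemma map2_ccomp:
  "xs \<in> tuples (cset X) ks \<Longrightarrow> map2 (ccomp X g f) ks xs = map2 g ks (map2 f ks xs)"
  by (intro nth_equalityI) (simp_all add: tuples_iff)

lemma ccomp_cid:
  assumes "coll X" "coll Y" "f \<in> chom X Y"
  shows "ccomp X f (cid X) = f" "ccomp X (cid Y) f = f"
  using assms by (auto intro!: hom_eqI[of _ X Y] ccomp_hom simp: hom_in)

lemma ccomp_assoc:
  assumes "coll X" "coll Y" "f \<in> chom X Y" "g \<in> chom Y Z" "h \<in> chom Z W"
  shows "ccomp X h (ccomp X g f) = ccomp X (ccomp Y h g) f"
  using assms by (intro hom_eqI[of _ X W]) (auto intro!: ccomp_hom simp: hom_in)

lemma category_coll: "category (coll_cat small L)"
  unfolding category_def by (auto intro: ccomp_hom ccomp_cid ccomp_assoc)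

lemma is_isoI:
  assumes "coll X" "coll Y" "f \<in> chom X Y" "g \<in> chom Y X"
    "ccomp X g f = cid X" "ccomp Y f g = cid Y"
  shows "is_iso (coll_cat small L) X Y f"
  unfolding is_iso_def using assms by auto

lemma tens_simps [simp]:
  "tens0 (subst_tensor code L) X Y = X \<odot> Y"
  "tens1 (subst_tensor code L) X X' Y Y' f g = subst_map code L X Y X' Y' f g"
  by (simp_all add: tens0_def tens1_def subst_tensor_def)

abbreviation cmap :: "'u collection \<Rightarrow> 'u collection \<Rightarrow> 'u collection \<Rightarrow> 'u collection \<Rightarrow>
    (nat \<Rightarrow> 'u \<Rightarrow> 'u) \<Rightarrow> (nat \<Rightarrow> 'u \<Rightarrow> 'u) \<Rightarrow> nat \<Rightarrow> 'u \<Rightarrow> 'u"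
  where "cmap \<equiv> subst_map code L"

lemma functor_tensor:
  "is_functor (prod_cat (coll_cat small L) (coll_cat small L)) (coll_cat small L) (subst_tensor code L)"
proof -
  have "cmap X Y X Y (cid X) (cid Y) = cid (X \<odot> Y)" if "coll X" "coll Y" for X Y
    using that
    by (intro hom_sub_eqI[of X Y _ "X \<odot> Y"]) (simp_all add: subst_map_hom subst_map_gen map2_cid)
  moreover have "cmap X Y X'' Y'' (ccomp X g f) (ccomp Y g' f')
      = ccomp (X \<odot> Y) (cmap X' Y' X'' Y'' g g') (cmap X Y X' Y' f f')"
    if "coll X" "coll Y" "coll X'" "coll Y'" "coll X''" "coll Y''" "f \<in> chom X X'" "f' \<in> chom Y Y'"
      "g \<in> chom X' X''" "g' \<in> chom Y' Y''" for X Y X' Y' X'' Y'' f f' g g'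
  proof (rule hom_sub_eqI[OF that(1,2)])
    show "cmap X Y X'' Y'' (ccomp X g f) (ccomp Y g' f') \<in> chom (X \<odot> Y) (X'' \<odot> Y'')"
      using that by (intro subst_map_hom ccomp_hom)
    show "ccomp (X \<odot> Y) (cmap X' Y' X'' Y'' g g') (cmap X Y X' Y' f f') \<in> chom (X \<odot> Y) (X'' \<odot> Y'')"
      using that by (intro ccomp_hom[of _ _ "X' \<odot> Y'"] subst_map_hom coll_sub)
  qed (use that in \<open>simp add: subst_map_gen ccomp_hom map2_ccomp hom_in homs_in\<close>)
  ultimately show ?thesis
    unfolding is_functor_def prod_cat_def subst_tensor_def
    by (simp add: split_paired_Ball_Sigma subst_map_hom)
qed

lemma gen_args_map:
  assumes "gen_args X Y Z kss x ys zss" "f \<in> chom X X'" "g \<in> chom Y Y'" "h \<in> chom Z Z'"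
  shows "gen_args X' Y' Z' kss (f (length kss) x) (map2 g (map length kss) ys) (map2 (map2 h) kss zss)"
proof -
  have "map2 h (kss ! i) (zss ! i) \<in> tuples (cset Z') (kss ! i)" if "i < length kss" for i
    using that assms(1) homs_in[OF assms(4)] by (simp add: gen_args_def tuple_lists_iff)
  then show ?thesis
    using assms by (simp add: gen_args_def hom_in homs_in) (simp add: tuple_lists_iff)
qed

text \<open>Applying maps changes the data of the left form in the same way as those of the right
  form in \<open>map_right_gen\<close>; naturality of the associator is the comparison of the
  two.\<close>

lemma map_left_gen:
  assumes "coll X" "coll Y" "coll Z" "coll X'" "coll Y'" "coll Z'"
    and fgh: "f \<in> chom X X'" "g \<in> chom Y Y'" "h \<in> chom Z Z'"
    and a: "gen_args X Y Z kss x ys zss"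
  shows "cmap (X \<odot> Y) Z (X' \<odot> Y') Z' (cmap X Y X' Y' f g) h (sum_list (map sum_list kss)) (left_gen X Y Z kss x ys zss)
    = left_gen X' Y' Z' kss (f (length kss) x) (map2 g (map length kss) ys) (map2 (map2 h) kss zss)"
proof -
  have x: "x \<in> cset X (length (map length kss))" and ys: "ys \<in> tuples (cset Y) (map length kss)"
    and zss: "tuple_lists (cset Z) zss kss" using a by (simp_all add: gen_args_def)
  have p: "gen X Y (map length kss) x ys \<in> cset (X \<odot> Y) (length (concat kss))"
    using gen_in[OF x ys] by (simp add: length_concat)
  have "list_all2 (\<lambda>zs ks. length zs = length ks) zss kss"
    using zss by (rule list_all2_mono) (rule length_tuples)
  then have c: "map2 h (concat kss) (concat zss) = concat (map2 (map2 h) kss zss)"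
    by (rule map2_concat[symmetric])
  have "cmap X Y X' Y' f g (length (concat kss)) (gen X Y (map length kss) x ys)
      = gen X' Y' (map length kss) (f (length kss) x) (map2 g (map length kss) ys)"
    using subst_map_gen[OF assms(1,2,4,5) fgh(1,2) x ys] by (simp add: length_concat)
  then show ?thesis
    unfolding left_gen_def
    using subst_map_gen[OF coll_sub[OF assms(1,2)] assms(3) coll_sub[OF assms(4,5)] assms(6)
        subst_map_hom[OF assms(1,2,4,5) fgh(1,2)] fgh(3) p list_all2_tuples_concat[OF zss]]
    by (simp add: c sum_list_concat)
qed

lemma map_right_gen:
  assumes "coll X" "coll Y" "coll Z" "coll X'" "coll Y'" "coll Z'"
    and fgh: "f \<in> chom X X'" "g \<in> chom Y Y'" "h \<in> chom Z Z'"
    and a: "gen_args X Y Z kss x ys zss"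
  shows "cmap X (Y \<odot> Z) X' (Y' \<odot> Z') f (cmap Y Z Y' Z' g h) (sum_list (map sum_list kss)) (right_gen X Y Z kss x ys zss)
    = right_gen X' Y' Z' kss (f (length kss) x) (map2 g (map length kss) ys) (map2 (map2 h) kss zss)"
proof -
  have x: "x \<in> cset X (length (map sum_list kss))" and ys: "ys \<in> tuples (cset Y) (map length kss)"
    and zss: "tuple_lists (cset Z) zss kss" using a by (simp_all add: gen_args_def)
  have "map2 (cmap Y Z Y' Z' g h) (map sum_list kss) (map3 (gen Y Z) kss ys zss)
      = map3 (gen Y' Z') kss (map2 g (map length kss) ys) (map2 (map2 h) kss zss)" (is "?l = ?r")
  proof (rule nth_equalityI)
    fix i assume "i < length ?l"
    then have i: "i < length kss" by simp
    then have "ys ! i \<in> cset Y (length (kss ! i))" "zss ! i \<in> tuples (cset Z) (kss ! i)"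
      using ys zss by (simp_all add: tuples_iff[of ys] tuple_lists_iff)
    from subst_map_gen[OF assms(2,3,5,6) fgh(2,3) this]
    show "?l ! i = ?r ! i"
      using i length_tuples[OF ys] list_all2_lengthD[OF zss] by simp
  qed (use length_tuples[OF ys] list_all2_lengthD[OF zss] in simp)
  then show ?thesis
    unfolding right_gen_def
    using subst_map_gen[OF assms(1) coll_sub[OF assms(2,3)] assms(4) coll_sub[OF assms(5,6)] fgh(1)
        subst_map_hom[OF assms(2,3,5,6) fgh(2,3)] x gens_in[OF ys zss]]
    by simp
qed

lemma assoc_iso:
  assumes "coll X" "coll Y" "coll Z"
  shows "is_iso (coll_cat small L) ((X \<odot> Y) \<odot> Z) (X \<odot> (Y \<odot> Z)) (assoc X Y Z)"
proof (rule is_isoI)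
  note h = assoc_hom[OF assms] assoc_inv_hom[OF assms]
  show "ccomp ((X \<odot> Y) \<odot> Z) (assoc_inv X Y Z) (assoc X Y Z) = cid ((X \<odot> Y) \<odot> Z)"
    using assms by (intro left_gen_eqI[OF assms ccomp_hom[OF _ h] cid_hom]) simp_all
  show "ccomp (X \<odot> (Y \<odot> Z)) (assoc X Y Z) (assoc_inv X Y Z) = cid (X \<odot> (Y \<odot> Z))"
    using assms by (intro right_gen_eqI[OF assms ccomp_hom[OF _ h(2,1)] cid_hom]) simp_all
qed (use assms assoc_hom assoc_inv_hom in simp_all)

lemma assoc_natural:
  assumes XYZ: "coll X" "coll Y" "coll Z" "coll X'" "coll Y'" "coll Z'"
    and fgh: "f \<in> chom X X'" "g \<in> chom Y Y'" "h \<in> chom Z Z'"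
  shows "ccomp ((X \<odot> Y) \<odot> Z) (cmap X (Y \<odot> Z) X' (Y' \<odot> Z') f (cmap Y Z Y' Z' g h)) (assoc X Y Z)
    = ccomp ((X \<odot> Y) \<odot> Z) (assoc X' Y' Z') (cmap (X \<odot> Y) Z (X' \<odot> Y') Z' (cmap X Y X' Y' f g) h)"
proof (rule left_gen_eqI[OF XYZ(1-3)])
  show "ccomp ((X \<odot> Y) \<odot> Z) (cmap X (Y \<odot> Z) X' (Y' \<odot> Z') f (cmap Y Z Y' Z' g h)) (assoc X Y Z)
    \<in> chom ((X \<odot> Y) \<odot> Z) (X' \<odot> (Y' \<odot> Z'))"
    using assms by (intro ccomp_hom[OF _ assoc_hom subst_map_hom] subst_map_hom coll_sub)
  show "ccomp ((X \<odot> Y) \<odot> Z) (assoc X' Y' Z') (cmap (X \<odot> Y) Z (X' \<odot> Y') Z' (cmap X Y X' Y' f g) h)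
    \<in> chom ((X \<odot> Y) \<odot> Z) (X' \<odot> (Y' \<odot> Z'))"
    using assms by (intro ccomp_hom[OF _ subst_map_hom assoc_hom] subst_map_hom coll_sub)
next
  fix kss x ys zss assume a: "gen_args X Y Z kss x ys zss"
  show "ccomp ((X \<odot> Y) \<odot> Z) (cmap X (Y \<odot> Z) X' (Y' \<odot> Z') f (cmap Y Z Y' Z' g h)) (assoc X Y Z)
      (sum_list (map sum_list kss)) (left_gen X Y Z kss x ys zss)
    = ccomp ((X \<odot> Y) \<odot> Z) (assoc X' Y' Z') (cmap (X \<odot> Y) Z (X' \<odot> Y') Z' (cmap X Y X' Y' f g) h)
      (sum_list (map sum_list kss)) (left_gen X Y Z kss x ys zss)"
    using assms a gen_args_map[OF a fgh] by (simp add: map_left_gen map_right_gen)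
qed

subsection \<open>Unitors\<close>

abbreviation J :: "'u collection" where "J \<equiv> unit_coll L"

lemma cset_J: "x \<in> cset J n \<longleftrightarrow> n = Suc 0 \<and> x \<in> ops L (Suc 0)"
  by (simp add: unit_coll_def)

lemma cact_J: "x \<in> ops L (Suc 0) \<Longrightarrow> g \<in> ops L (Suc 0) \<Longrightarrow> cact J (Suc 0) x g = x \<otimes>\<^bsub>gr L (Suc 0)\<^esub> g"
  by (simp add: unit_coll_def)

lemma coll_J [simp]: "coll J"
proof -
  have "small (cset J n)" for n using small_ops small_empty by (simp add: unit_coll_def)
  moreover have "right_action (gr L n) (cset J n) (cact J n)" for n
    by (auto simp: right_action_def cset_J cact_J carrier_gr mult_assoc)
  ultimately show ?thesis by (auto simp: is_coll_def unit_coll_def)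
qed

lemma tuples_J: "as \<in> tuples (cset J) ks \<longleftrightarrow> ks = replicate (length ks) (Suc 0) \<and> as \<in> tuples (ops L) ks"
proof (induction ks arbitrary: as)
  case (Cons k ks)
  then show ?case by (auto simp: cset_J)
qed simp

abbreviation ones :: "nat \<Rightarrow> nat list" where "ones n \<equiv> replicate n (Suc 0)"

abbreviation es :: "nat \<Rightarrow> 'u list" where "es n \<equiv> replicate n (e (Suc 0))"

lemma es_J [simp]: "es n \<in> tuples (cset J) (ones n)"
  by (simp add: tuples_iff cset_J)

text \<open>J lives in arity 1, so \<open>xs\<close> has a single entry. Since a is e_1 acted on by
  a, the class of (a; x; e) is that of (e_1; x; e) acted on by \<delta>(a), and the latter should go
  to x.\<close>

definition lunit_fun :: "'u collection \<Rightarrow> nat list \<Rightarrow> 'u \<Rightarrow> 'u list \<Rightarrow> 'u" where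
  "lunit_fun X ks a xs = cact X (sum_list ks) (hd xs) (delta L ks a)"

definition lunit :: "'u collection \<Rightarrow> nat \<Rightarrow> 'u \<Rightarrow> 'u" where
  "lunit X = lift J X X (lunit_fun X)"

definition lunit_inv :: "'u collection \<Rightarrow> nat \<Rightarrow> 'u \<Rightarrow> 'u" where
  "lunit_inv X = (\<lambda>n. \<lambda>x\<in>cset X n. gen J X [n] (e (Suc 0)) [x])"

lemma pm_single: "h \<in> ops L (Suc 0) \<Longrightarrow> pm (Suc 0) h [x] = [x]"
  using pr_permutes[of h "Suc 0"] by (intro permute_singleton) simp

text \<open>Permutations of one point are trivial. Hence on a single block \<delta> is
  multiplicative by \<open>delta_mult\<close>, and its values commute with every element of
  \<Lambda>(k) by \<open>delta_beta\<close>.\<close>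

lemma balanced_lunit_fun:
  assumes X: "coll X"
  shows "balanced J X X (lunit_fun X)"
  unfolding balanced_def
proof (intro ballI allI)
  fix ks a xs assume "a \<in> cset J (length ks)" and xs: "xs \<in> tuples (cset X) ks"
  then obtain k where k: "ks = [k]" and a: "a \<in> ops L (Suc 0)" by (auto simp: cset_J length_Suc_conv)
  with xs obtain x where x: "xs = [x]" "x \<in> cset X k" by auto
  have d: "delta L [k] b \<in> ops L k" if "b \<in> ops L (Suc 0)" for b using delta_in[of b "[k]"] that by simp
  have o: "lunit_fun X ks (cact J (length ks) a h) xs
      = cact X (sum_list ks) (lunit_fun X (pm (length ks) h ks) a (pm (length ks) h xs)) (delta L ks h)"
    if h: "h \<in> ops L (Suc 0)" for h
    using delta_mult[of a "[k]" h] a h x X d by (simp add: k lunit_fun_def cact_J pm_single act_act)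
  have i: "lunit_fun X ks a (map3 (cact X) ks xs gs) = cact X (sum_list ks) (lunit_fun X ks a xs) (beta L ks gs)"
    if gs: "gs \<in> tuples (ops L) ks" for gs
  proof -
    obtain g where g: "gs = [g]" "g \<in> ops L k" using gs k by auto
    then show ?thesis
      using delta_beta[of a "[k]" "[g]"] a x X d by (simp add: k lunit_fun_def pm_single act_act)
  qed
  show "lunit_fun X ks a xs \<in> cset X (sum_list ks) \<and>
    (\<forall>h\<in>ops L (length ks). lunit_fun X ks (cact J (length ks) a h) xs
      = cact X (sum_list ks) (lunit_fun X (pm (length ks) h ks) a (pm (length ks) h xs)) (delta L ks h)) \<and>
    (\<forall>gs\<in>tuples (ops L) ks. lunit_fun X ks a (map3 (cact X) ks xs gs)
      = cact X (sum_list ks) (lunit_fun X ks a xs) (beta L ks gs))"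
    using o i a x X d by (auto simp: k lunit_fun_def)
qed

lemma lunit_hom: "coll X \<Longrightarrow> lunit X \<in> chom (J \<odot> X) X"
  unfolding lunit_def by (intro lift_hom balanced_lunit_fun coll_J)

lemma delta_single_e [simp]: "delta L [n] (e (Suc 0)) = e n"
  using delta_e[of "[n]"] by simp

lemma gen_unit_left_in [simp]: "x \<in> cset X n \<Longrightarrow> gen J X [n] (e (Suc 0)) [x] \<in> cset (J \<odot> X) n"
  using gen_in[of "e (Suc 0)" J "[n]" "[x]" X] by (simp add: cset_J)

lemma lunit_gen [simp]: "coll X \<Longrightarrow> x \<in> cset X n \<Longrightarrow> lunit X n (gen J X [n] (e (Suc 0)) [x]) = x"
  using lift_gen[of J X X "lunit_fun X" "e (Suc 0)" "[n]" "[x]"]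
  by (simp add: lunit_def balanced_lunit_fun cset_J) (simp add: lunit_fun_def)

lemma lunit_inv_hom:
  assumes "coll X" shows "lunit_inv X \<in> chom X (J \<odot> X)"
proof (rule homI)
  fix n x g assume "x \<in> cset X n" "g \<in> ops L n"
  then show "lunit_inv X n (cact X n x g) = cact (J \<odot> X) n (lunit_inv X n x) g"
    using gen_inner[of J X "e (Suc 0)" "[n]" "[g]" "[x]"] assms by (simp add: lunit_inv_def cset_J)
qed (simp_all add: lunit_inv_def)

lemma hom_unit_left_eqI:
  assumes X: "coll X" and fg: "f \<in> chom (J \<odot> X) W" "g \<in> chom (J \<odot> X) W"
    and eq: "\<And>n x. x \<in> cset X n \<Longrightarrow> f n (gen J X [n] (e (Suc 0)) [x]) = g n (gen J X [n] (e (Suc 0)) [x])"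
  shows "f = g"
proof (rule hom_sub_eqI[OF coll_J X fg])
  fix ks a xs assume "a \<in> cset J (length ks)" and xs: "xs \<in> tuples (cset X) ks"
  then obtain k where k: "ks = [k]" and a: "a \<in> ops L (Suc 0)" by (auto simp: cset_J length_Suc_conv)
  with xs obtain x where x: "xs = [x]" "x \<in> cset X k" by auto
  have "gen J X [k] a [x] = cact (J \<odot> X) k (gen J X [k] (e (Suc 0)) [x]) (delta L [k] a)"
    using gen_outer[OF coll_J X, of "e (Suc 0)" "[k]" a "[x]"] a x by (simp add: cset_J cact_J pm_single)
  then show "f (sum_list ks) (gen J X ks a xs) = g (sum_list ks) (gen J X ks a xs)"
    using k x eq a delta_in[of a "[k]"] hom_act[OF fg(1)] hom_act[OF fg(2)] by simp
qed

lemma lunit_iso: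
  assumes X: "coll X" shows "is_iso (coll_cat small L) (J \<odot> X) X (lunit X)"
proof (rule is_isoI)
  note h = lunit_hom[OF X] lunit_inv_hom[OF X]
  show "ccomp (J \<odot> X) (lunit_inv X) (lunit X) = cid (J \<odot> X)"
    by (rule hom_unit_left_eqI[OF X ccomp_hom[OF _ h] cid_hom]) (simp_all add: X, simp add: lunit_inv_def)
  show "ccomp X (lunit X) (lunit_inv X) = cid X"
    by (rule hom_eqI[OF ccomp_hom[OF X h(2,1)] cid_hom[OF X]]) (use X in \<open>simp add: lunit_inv_def\<close>)
qed (use X lunit_hom lunit_inv_hom in simp_all)

lemma lunit_natural:
  assumes "coll X" "coll Y" "f \<in> chom X Y"
  shows "ccomp (J \<odot> X) f (lunit X) = ccomp (J \<odot> X) (lunit Y) (cmap J X J Y (cid J) f)"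
proof (rule hom_unit_left_eqI[OF assms(1)])
  show "ccomp (J \<odot> X) f (lunit X) \<in> chom (J \<odot> X) Y"
    using assms by (intro ccomp_hom[OF _ lunit_hom]) simp_all
  show "ccomp (J \<odot> X) (lunit Y) (cmap J X J Y (cid J) f) \<in> chom (J \<odot> X) Y"
    using assms by (intro ccomp_hom[OF _ subst_map_hom lunit_hom]) simp_all
  fix n x assume x: "x \<in> cset X n"
  show "ccomp (J \<odot> X) f (lunit X) n (gen J X [n] (e (Suc 0)) [x])
    = ccomp (J \<odot> X) (lunit Y) (cmap J X J Y (cid J) f) n (gen J X [n] (e (Suc 0)) [x])"
    using subst_map_gen[OF coll_J assms(1) coll_J assms(2) cid_hom[OF coll_J] assms(3), of "e (Suc 0)" "[n]" "[x]"]
      x assms by (simp add: cset_J hom_in)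
qed

text \<open>All arities in \<open>ks\<close> are 1, and acting on J is multiplication, so (x; as; e)
  is (x; e_1, ..., e_1; e) acted on by \<beta>(as).\<close>

definition runit_fun :: "'u collection \<Rightarrow> nat list \<Rightarrow> 'u \<Rightarrow> 'u list \<Rightarrow> 'u" where
  "runit_fun X ks x as = cact X (sum_list ks) x (beta L ks as)"

definition runit :: "'u collection \<Rightarrow> nat \<Rightarrow> 'u \<Rightarrow> 'u" where
  "runit X = lift X J X (runit_fun X)"

definition runit_inv :: "'u collection \<Rightarrow> nat \<Rightarrow> 'u \<Rightarrow> 'u" where
  "runit_inv X = (\<lambda>n. \<lambda>x\<in>cset X n. gen X J (ones n) x (es n))"

lemma pm_replicate: "h \<in> ops L n \<Longrightarrow> pm n h (replicate n x) = replicate n x"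
  by (intro permute_replicate) simp

lemma cacts_J:
  assumes "as \<in> tuples (ops L) (ones n)" "gs \<in> tuples (ops L) (ones n)"
  shows "map3 (cact J) (ones n) as gs = muls (ones n) as gs"
  using assms by (intro nth_equalityI) (simp_all add: tuples_iff cact_J)

lemma balanced_runit_fun:
  assumes X: "coll X"
  shows "balanced X J X (runit_fun X)"
  unfolding balanced_def
proof (intro ballI allI)
  fix ks x as assume x: "x \<in> cset X (length ks)" and "as \<in> tuples (cset J) ks"
  then obtain n where n: "ks = ones n" and as: "as \<in> tuples (ops L) (ones n)"
    using tuples_J by metis
  have x: "x \<in> cset X n" using x n by simp
  have b: "beta L (ones n) gs \<in> ops L n" if "gs \<in> tuples (ops L) (ones n)" for gs
    using beta_in[OF that] by (simp add: sum_list_replicate)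
  have pa: "pm n h as \<in> tuples (ops L) (ones n)" if "h \<in> ops L n" for h
    using pm_tuples[of h "ones n" as] that as by (simp add: pm_replicate)
  \<comment> \<open>On blocks of length one \<delta>(h) is h itself, so \<open>delta_beta\<close>
    moves \<beta> past h.\<close>
  have o: "runit_fun X ks (cact X n x h) as
      = cact X n (runit_fun X (pm n h ks) x (pm n h as)) (delta L ks h)"
    if h: "h \<in> ops L n" for h
    using delta_beta[of h "ones n" as] as x h X b pa
    by (simp add: n runit_fun_def pm_replicate act_act sum_list_replicate)
  have i: "runit_fun X ks x (map3 (cact J) ks as gs) = cact X n (runit_fun X ks x as) (beta L ks gs)"
    if "gs \<in> tuples (ops L) ks" for gs
    using beta_mult[OF as, of gs] that as x X b
    by (simp add: n runit_fun_def act_act sum_list_replicate cacts_J)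
  have "length ks = n" "sum_list ks = n" using n by (simp_all add: sum_list_replicate)
  then show "runit_fun X ks x as \<in> cset X (sum_list ks) \<and>
    (\<forall>h\<in>ops L (length ks). runit_fun X ks (cact X (length ks) x h) as
      = cact X (sum_list ks) (runit_fun X (pm (length ks) h ks) x (pm (length ks) h as)) (delta L ks h)) \<and>
    (\<forall>gs\<in>tuples (ops L) ks. runit_fun X ks x (map3 (cact J) ks as gs)
      = cact X (sum_list ks) (runit_fun X ks x as) (beta L ks gs))"
    using o i as x X b n by (auto simp: runit_fun_def)
qed

lemma runit_hom: "coll X \<Longrightarrow> runit X \<in> chom (X \<odot> J) X"
  unfolding runit_def by (intro lift_hom balanced_runit_fun coll_J)

lemma gen_unit_right_in [simp]:
  "x \<in> cset X n \<Longrightarrow> gen X J (ones n) x (es n) \<in> cset (X \<odot> J) n"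
  using gen_in[of x X "ones n" "es n" J] by (simp add: sum_list_replicate)

lemma runit_gen [simp]:
  assumes "coll X" "x \<in> cset X n"
  shows "runit X n (gen X J (ones n) x (es n)) = x"
proof -
  have "beta L (ones n) (es n) = e n"
    using beta_e[of "ones n"] by (simp add: sum_list_replicate)
  then show ?thesis
    using lift_gen[of X J X "runit_fun X" x "ones n" "es n"] assms
    by (simp add: runit_def balanced_runit_fun sum_list_replicate) (simp add: runit_fun_def sum_list_replicate)
qed

lemma runit_inv_hom:
  assumes "coll X" shows "runit_inv X \<in> chom X (X \<odot> J)"
proof (rule homI)
  fix n x g assume "x \<in> cset X n" "g \<in> ops L n"
  then show "runit_inv X n (cact X n x g) = cact (X \<odot> J) n (runit_inv X n x) g"
    using gen_outer[of X J x "ones n" g "es n"] assms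
    by (simp add: runit_inv_def pm_replicate sum_list_replicate)
qed (simp_all add: runit_inv_def)

lemma gen_unit_right:
  assumes X: "coll X" and x: "x \<in> cset X n" and as: "as \<in> tuples (ops L) (ones n)"
  shows "gen X J (ones n) x as
    = cact (X \<odot> J) n (gen X J (ones n) x (es n)) (beta L (ones n) as)"
proof -
  have "map3 (cact J) (ones n) (es n) as = as"
    using as by (intro nth_equalityI) (simp_all add: tuples_iff cact_J)
  then show ?thesis
    using gen_inner[OF X coll_J, of x "ones n" as "es n"] as x
    by (simp add: sum_list_replicate)
qed

lemma hom_unit_right_eqI:
  assumes X: "coll X" and fg: "f \<in> chom (X \<odot> J) W" "g \<in> chom (X \<odot> J) W"
    and eq: "\<And>n x. x \<in> cset X n \<Longrightarrow> f n (gen X J (ones n) x (es n))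
      = g n (gen X J (ones n) x (es n))"
  shows "f = g"
proof (rule hom_sub_eqI[OF X coll_J fg])
  fix ks x as assume x: "x \<in> cset X (length ks)" and "as \<in> tuples (cset J) ks"
  then obtain n where n: "ks = ones n" and as: "as \<in> tuples (ops L) (ones n)"
    using tuples_J by metis
  have x: "x \<in> cset X n" using x n by simp
  have "beta L (ones n) as \<in> ops L n" using beta_in[OF as] by (simp add: sum_list_replicate)
  then show "f (sum_list ks) (gen X J ks x as) = g (sum_list ks) (gen X J ks x as)"
    using eq[OF x] hom_act[OF fg(1)] hom_act[OF fg(2)] x
    by (simp add: n gen_unit_right[OF X x as] sum_list_replicate)
qed

lemma runit_inv_runit: "coll X \<Longrightarrow> ccomp (X \<odot> J) (runit_inv X) (runit X) = cid (X \<odot> J)"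
  by (rule hom_unit_right_eqI[OF _ ccomp_hom[OF _ runit_hom runit_inv_hom] cid_hom])
    (simp_all, simp add: runit_inv_def)

lemma runit_iso:
  assumes X: "coll X" shows "is_iso (coll_cat small L) (X \<odot> J) X (runit X)"
proof (rule is_isoI)
  show "ccomp X (runit X) (runit_inv X) = cid X"
    by (rule hom_eqI[OF ccomp_hom[OF X runit_inv_hom[OF X] runit_hom[OF X]] cid_hom[OF X]])
      (use X in \<open>simp add: runit_inv_def\<close>)
qed (use X runit_hom runit_inv_hom runit_inv_runit in simp_all)

lemma runit_natural:
  assumes "coll X" "coll Y" "f \<in> chom X Y"
  shows "ccomp (X \<odot> J) f (runit X) = ccomp (X \<odot> J) (runit Y) (cmap X J Y J f (cid J))"
proof (rule hom_unit_right_eqI[OF assms(1)])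
  show "ccomp (X \<odot> J) f (runit X) \<in> chom (X \<odot> J) Y"
    using assms by (intro ccomp_hom[OF _ runit_hom]) simp_all
  show "ccomp (X \<odot> J) (runit Y) (cmap X J Y J f (cid J)) \<in> chom (X \<odot> J) Y"
    using assms by (intro ccomp_hom[OF _ subst_map_hom runit_hom]) simp_all
  fix n x assume x: "x \<in> cset X n"
  show "ccomp (X \<odot> J) f (runit X) n (gen X J (ones n) x (es n))
    = ccomp (X \<odot> J) (runit Y) (cmap X J Y J f (cid J)) n (gen X J (ones n) x (es n))"
    using subst_map_gen[OF assms(1) coll_J assms(2) coll_J assms(3) cid_hom[OF coll_J],
        of x "ones n" "es n"]
      x assms by (simp add: hom_in sum_list_replicate cset_J)
qed

subsection \<open>Coherence\<close>

context
  fixes A B D E :: "'u collection"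
  assumes ABDE [simp]: "coll A" "coll B" "coll D" "coll E"
begin

text \<open>Fourfold data regrouped with B and D, or D and E, already composed. G is
  \<open>left_gen\<close>, \<open>right_gen\<close> or \<open>gen_args\<close>, so one notation
  covers the element, its rebracketing and the admissibility of the data.\<close>

abbreviation "middle_bracket G ksss a bs dss esss \<equiv>
  G A (B \<odot> D) E (map concat ksss) a (map3 (gen B D) (map (map length) ksss) bs dss) (map concat esss)"

abbreviation "right_bracket G ksss a bs dss esss \<equiv>
  G A B (D \<odot> E) (map (map sum_list) ksss) a bs (map3 (map3 (gen D E)) ksss dss esss)"

text \<open>The generator of ((A \<circ> B) \<circ> D) \<circ> E with all group coordinates neutral.
  The outer level of \<open>ksss\<close> runs over the entries of \<open>bs\<close>, the next one
  over the operations from D plugged into them, and the innermost lists hold the arities of the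
  operations from E.\<close>

definition triple_gen :: "nat list list list \<Rightarrow> 'u \<Rightarrow> 'u list \<Rightarrow> 'u list list \<Rightarrow> 'u list list list \<Rightarrow> 'u" where
  "triple_gen ksss a bs dss esss = left_gen (A \<odot> B) D E (concat ksss)
     (gen A B (map length ksss) a bs) (concat dss) (concat esss)"

definition triple_args :: "nat list list list \<Rightarrow> 'u \<Rightarrow> 'u list \<Rightarrow> 'u list list \<Rightarrow> 'u list list list \<Rightarrow> bool" where
  "triple_args ksss a bs dss esss \<longleftrightarrow> a \<in> cset A (length ksss) \<and>
     bs \<in> tuples (cset B) (map length ksss) \<and> tuple_lists (cset D) dss (map (map length) ksss) \<and>
     list_all2 (tuple_lists (cset E)) esss ksss"

lemma triple_args_outer:
  assumes "triple_args ksss a bs dss esss"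
  shows "gen_args (A \<odot> B) D E (concat ksss) (gen A B (map length ksss) a bs) (concat dss) (concat esss)"
  using assms gen_in[of a A "map length ksss" bs B] list_all2_tuples_concat[of "cset D" dss "map (map length) ksss"]
    list_all2_concat_lists[of _ esss ksss]
  by (simp add: triple_args_def gen_args_def length_concat map_concat)

text \<open>\<open>left_gen_eqI\<close> leaves an arbitrary class p of A \<circ> B in front. Its
  group coordinate is carried outside by \<open>left_gen_outer\<close>, and the permuted lists are
  then cut along the generator in p.\<close>

lemma triple_gen_eqI:
  assumes fg: "f \<in> chom (((A \<odot> B) \<odot> D) \<odot> E) W" "g \<in> chom (((A \<odot> B) \<odot> D) \<odot> E) W"
    and eq: "\<And>ksss a bs dss esss. triple_args ksss a bs dss esss \<Longrightarrow>
      f (sum_list (map sum_list (concat ksss))) (triple_gen ksss a bs dss esss)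
      = g (sum_list (map sum_list (concat ksss))) (triple_gen ksss a bs dss esss)"
  shows "f = g"
proof (rule left_gen_eqI[OF coll_sub[OF ABDE(1,2)] ABDE(3,4) fg])
  fix kss p ds ess assume a: "gen_args (A \<odot> B) D E kss p ds ess"
  then have p: "p \<in> cset (A \<odot> B) (length kss)" by (simp add: gen_args_def)
  obtain ks a bs h where t: "length kss = sum_list ks" "a \<in> cset A (length ks)" "bs \<in> tuples (cset B) ks"
    "h \<in> ops L (sum_list ks)" "p = cact (A \<odot> B) (sum_list ks) (gen A B ks a bs) h"
    by (rule sub_cases[OF ABDE(1,2) p])
  have h: "h \<in> ops L (length kss)" using t by simp
  have pq: "p = cact (A \<odot> B) (length kss) (gen A B ks a bs) h" using t by simp
  have q: "gen_args (A \<odot> B) D E kss (gen A B ks a bs) ds ess" using a t by (simp add: gen_args_def)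
  note q' = gen_args_act[OF coll_sub[OF ABDE(1,2)] ABDE(3,4) q h]
  define ksss where "ksss = split ks (pm (length kss) h kss)"
  have k: "concat ksss = pm (length kss) h kss" "map length ksss = ks"
    unfolding ksss_def using t by (simp_all add: concat_split map_length_split)
  have "pm (length kss) h ds \<in> tuples (cset D) (concat (map (map length) ksss))"
    using q' k(1) by (simp add: gen_args_def flip: map_concat)
  then obtain dss where d: "pm (length kss) h ds = concat dss" "tuple_lists (cset D) dss (map (map length) ksss)"
    by (rule ex_tuple_lists)
  have "tuple_lists (cset E) (pm (length kss) h ess) (concat ksss)"
    using q' k(1) by (simp add: gen_args_def)
  then obtain esss where e: "pm (length kss) h ess = concat esss" "list_all2 (tuple_lists (cset E)) esss ksss"
    by (rule list_all2_concat_right)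
  have "length ksss = length ks" using k(2) by auto
  then have ta: "triple_args ksss a bs dss esss"
    using t k d e by (simp add: triple_args_def)
  have "left_gen (A \<odot> B) D E kss p ds ess = cact (((A \<odot> B) \<odot> D) \<odot> E) (sum_list (map sum_list kss))
      (triple_gen ksss a bs dss esss) (delta L (map sum_list kss) h)"
    unfolding pq left_gen_outer[OF coll_sub[OF ABDE(1,2)] ABDE(3,4) q h]
    by (simp add: triple_gen_def k d(1) e(1))
  moreover have s: "sum_list (map sum_list (concat ksss)) = sum_list (map sum_list kss)"
    using permute_map[of "pr L (length kss) h" kss sum_list] sum_list_pm[of h "map sum_list kss"] h k(1) by simp
  moreover have "triple_gen ksss a bs dss esss \<in> cset (((A \<odot> B) \<odot> D) \<odot> E) (sum_list (map sum_list kss))"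
    using left_gen_in[OF triple_args_outer[OF ta]] s by (simp add: triple_gen_def)
  moreover have "delta L (map sum_list kss) h \<in> ops L (sum_list (map sum_list kss))"
    using delta_in[of h "map sum_list kss"] h by simp
  ultimately show "f (sum_list (map sum_list kss)) (left_gen (A \<odot> B) D E kss p ds ess)
      = g (sum_list (map sum_list kss)) (left_gen (A \<odot> B) D E kss p ds ess)"
    using eq[OF ta] hom_act[OF fg(1)] hom_act[OF fg(2)] by simp
qed

text \<open>The class reached by the first associator on the two-step side is both a right form for
  (A \<circ> B, D, E) and a left form for (A, B, D \<circ> E); in the second guise the next
  associator applies.\<close>

lemma pentagon_right:
  assumes t: "triple_args ksss a bs dss esss"
  shows "right_gen (A \<odot> B) D E (concat ksss) (gen A B (map length ksss) a bs) (concat dss) (concat esss)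
      = right_bracket left_gen ksss a bs dss esss"
    and "right_bracket gen_args ksss a bs dss esss"
proof -
  have d: "tuple_lists (cset D) dss (map (map length) ksss)" and e: "list_all2 (tuple_lists (cset E)) esss ksss"
    using t by (simp_all add: triple_args_def)
  have "list_all2 (\<lambda>ys xs. length ys = length xs) dss ksss"
    using d by (auto simp: list_all2_conv_all_nth tuples_iff)
  moreover have "list_all2 (\<lambda>ys xs. length ys = length xs) esss ksss"
    using e by (auto simp: list_all2_conv_all_nth)
  ultimately have "concat (map3 (map3 (gen D E)) ksss dss esss) = map3 (gen D E) (concat ksss) (concat dss) (concat esss)"
    by (rule concat_map3_length)
  then show "right_gen (A \<odot> B) D E (concat ksss) (gen A B (map length ksss) a bs) (concat dss) (concat esss)
      = right_bracket left_gen ksss a bs dss esss"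
    by (simp add: right_gen_def left_gen_def map_concat comp_def)
  have "map3 (gen D E) (ksss ! i) (dss ! i) (esss ! i) \<in> tuples (cset (D \<odot> E)) (map sum_list (ksss ! i))"
    if "i < length ksss" for i
    using list_all2_nthD2[OF d, of i] list_all2_nthD2[OF e, of i] that by (intro gens_in) simp_all
  then have "tuple_lists (cset (D \<odot> E)) (map3 (map3 (gen D E)) ksss dss esss) (map (map sum_list) ksss)"
    using list_all2_lengthD[OF d] list_all2_lengthD[OF e] by (simp add: list_all2_conv_all_nth)
  then show "right_bracket gen_args ksss a bs dss esss"
    using t by (simp add: gen_args_def triple_args_def comp_def)
qed

text \<open>The first coordinate of the generator is a left form for (A, B, D), where the associator
  acts. The outcome is regrouped as a left form for (A, B \<circ> D, E).\<close>

lemma pentagon_left: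
  assumes t: "triple_args ksss a bs dss esss"
  shows "cmap ((A \<odot> B) \<odot> D) E (A \<odot> (B \<odot> D)) E (assoc A B D) (cid E) (sum_list (map sum_list (concat ksss)))
        (triple_gen ksss a bs dss esss)
      = middle_bracket left_gen ksss a bs dss esss"
    and "middle_bracket gen_args ksss a bs dss esss"
proof -
  have a: "a \<in> cset A (length ksss)" and b: "bs \<in> tuples (cset B) (map length ksss)"
    and d: "tuple_lists (cset D) dss (map (map length) ksss)" and e: "list_all2 (tuple_lists (cset E)) esss ksss"
    using t by (simp_all add: triple_args_def)
  have ga: "gen_args A B D (map (map length) ksss) a bs dss"
    using a b d by (simp add: gen_args_def comp_def)
  let ?p = "left_gen A B D (map (map length) ksss) a bs dss"
  have p: "gen (A \<odot> B) D (map length (concat ksss)) (gen A B (map length ksss) a bs) (concat dss) = ?p"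
    by (simp add: left_gen_def map_concat comp_def)
  have n: "sum_list (map sum_list (map (map length) ksss)) = length (concat (concat ksss))"
    by (simp only: length_concat map_concat sum_list_concat)
  \<comment> \<open>The arity of each composite of an operation from B with operations from D,
    counted by the operations from E plugged into it.\<close>
  have m: "map length (map concat ksss) = map sum_list (map (map length) ksss)"
    by (simp add: length_concat comp_def)
  have pin: "?p \<in> cset ((A \<odot> B) \<odot> D) (length (concat (concat ksss)))"
    using left_gen_in[OF ga] unfolding n .
  have es: "concat (concat esss) \<in> tuples (cset E) (concat (concat ksss))"
    by (rule list_all2_tuples_concat[OF list_all2_concat_lists[OF e]])
  have "triple_gen ksss a bs dss esss = gen ((A \<odot> B) \<odot> D) E (concat (concat ksss)) ?p (concat (concat esss))"
    unfolding triple_gen_def p[symmetric] by (rule left_gen_def)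
  moreover have "assoc A B D (length (concat (concat ksss))) ?p = right_gen A B D (map (map length) ksss) a bs dss"
    using assoc_left_gen[OF ABDE(1-3) ga] unfolding n .
  ultimately have "cmap ((A \<odot> B) \<odot> D) E (A \<odot> (B \<odot> D)) E (assoc A B D) (cid E) (sum_list (concat (concat ksss)))
        (triple_gen ksss a bs dss esss)
      = gen (A \<odot> (B \<odot> D)) E (concat (concat ksss)) (right_gen A B D (map (map length) ksss) a bs dss) (concat (concat esss))"
    using subst_map_gen[OF _ _ _ _ assoc_hom[OF ABDE(1-3)] cid_hom[OF ABDE(4)] pin es] ABDE(1-4)
    by (simp add: map2_cid[OF es])
  then show "cmap ((A \<odot> B) \<odot> D) E (A \<odot> (B \<odot> D)) E (assoc A B D) (cid E) (sum_list (map sum_list (concat ksss)))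
        (triple_gen ksss a bs dss esss)
      = middle_bracket left_gen ksss a bs dss esss"
    unfolding sum_list_concat left_gen_def m concat_map_concat right_gen_def .
  have "tuple_lists (cset E) (map concat esss) (map concat ksss)"
    using list_all2_lengthD[OF e] list_all2_nthD2[OF e]
    by (auto simp: list_all2_conv_all_nth[of _ "map _ _"] intro!: list_all2_tuples_concat)
  then show "middle_bracket gen_args ksss a bs dss esss"
    using a gens_in[OF _ d, of bs B] b unfolding gen_args_def m by (simp add: comp_def)
qed

text \<open>Each entry of the tuple after a is itself a left form for (B, D, E), so the associator
  is evaluated entry by entry.\<close>

lemma pentagon_middle:
  assumes t: "triple_args ksss a bs dss esss"
  shows "cmap A ((B \<odot> D) \<odot> E) A (B \<odot> (D \<odot> E)) (cid A) (assoc B D E) (sum_list (map sum_list (concat ksss)))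
        (middle_bracket right_gen ksss a bs dss esss)
      = right_bracket right_gen ksss a bs dss esss"
proof -
  have a: "a \<in> cset A (length ksss)" and b: "bs \<in> tuples (cset B) (map length ksss)"
    and d: "tuple_lists (cset D) dss (map (map length) ksss)" and e: "list_all2 (tuple_lists (cset E)) esss ksss"
    using t by (simp_all add: triple_args_def)
  have l: "length bs = length ksss" "length dss = length ksss" "length esss = length ksss"
    using length_tuples[OF b] list_all2_lengthD[OF d] list_all2_lengthD[OF e] by simp_all
  have m: "map sum_list (map concat ksss) = map sum_list (map (map sum_list) ksss)"
    by (simp add: sum_list_concat)
  let ?qs = "map3 (gen (B \<odot> D) E) (map concat ksss) (map3 (gen B D) (map (map length) ksss) bs dss) (map concat esss)"
  have ga: "middle_bracket gen_args ksss a bs dss esss"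
    by (rule pentagon_left(2)[OF t])
  then have qs: "?qs \<in> tuples (cset ((B \<odot> D) \<odot> E)) (map sum_list (map concat ksss))"
    unfolding gen_args_def by (intro gens_in) simp_all
  have "map2 (assoc B D E) (map sum_list (map concat ksss)) ?qs
      = map3 (gen B (D \<odot> E)) (map (map sum_list) ksss) bs (map3 (map3 (gen D E)) ksss dss esss)" (is "?l = ?r")
  proof (rule nth_equalityI)
    fix i assume "i < length ?l"
    then have i: "i < length ksss" by simp
    then have "gen_args B D E (ksss ! i) (bs ! i) (dss ! i) (esss ! i)"
      using b list_all2_nthD2[OF d, of i] list_all2_nthD2[OF e, of i]
      by (simp add: gen_args_def tuples_iff[of bs])
    from assoc_left_gen[OF ABDE(2-4) this]
    show "?l ! i = ?r ! i"
      using i l by (simp add: left_gen_def right_gen_def sum_list_concat)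
  qed (use l in simp)
  moreover have "sum_list (map sum_list (concat ksss)) = sum_list (map sum_list (map concat ksss))"
    by (simp only: concat_map_concat flip: sum_list_concat)
  ultimately show ?thesis
    using subst_map_gen[OF ABDE(1) _ ABDE(1) _ cid_hom[OF ABDE(1)] assoc_hom[OF ABDE(2-4)] _ qs, of a] a ABDE(1-4)
    unfolding right_gen_def by (simp only: m length_map coll_sub cid_apply)
qed

lemma pentagon:
  "ccomp (((A \<odot> B) \<odot> D) \<odot> E) (cmap A ((B \<odot> D) \<odot> E) A (B \<odot> (D \<odot> E)) (cid A) (assoc B D E))
      (ccomp (((A \<odot> B) \<odot> D) \<odot> E) (assoc A (B \<odot> D) E)
        (cmap ((A \<odot> B) \<odot> D) E (A \<odot> (B \<odot> D)) E (assoc A B D) (cid E)))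
    = ccomp (((A \<odot> B) \<odot> D) \<odot> E) (assoc A B (D \<odot> E)) (assoc (A \<odot> B) D E)"
proof (rule triple_gen_eqI)
  let ?S = "((A \<odot> B) \<odot> D) \<odot> E"
  note h = assoc_hom subst_map_hom coll_sub cid_hom
  show "ccomp ?S (cmap A ((B \<odot> D) \<odot> E) A (B \<odot> (D \<odot> E)) (cid A) (assoc B D E))
      (ccomp ?S (assoc A (B \<odot> D) E) (cmap ((A \<odot> B) \<odot> D) E (A \<odot> (B \<odot> D)) E (assoc A B D) (cid E)))
    \<in> chom ?S (A \<odot> (B \<odot> (D \<odot> E)))"
    using ABDE by (intro ccomp_hom[where Y = "A \<odot> ((B \<odot> D) \<odot> E)"] ccomp_hom[where Y = "(A \<odot> (B \<odot> D)) \<odot> E"] h)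
  show "ccomp ?S (assoc A B (D \<odot> E)) (assoc (A \<odot> B) D E) \<in> chom ?S (A \<odot> (B \<odot> (D \<odot> E)))"
    using ABDE by (intro ccomp_hom[where Y = "(A \<odot> B) \<odot> (D \<odot> E)"] h)
  fix ksss a bs dss esss assume t: "triple_args ksss a bs dss esss"
  let ?N = "sum_list (map sum_list (concat ksss))"
  \<comment> \<open>Morphisms take the arity as an argument, so the total arities of the different
    bracketings have to be identified.\<close>
  have N: "sum_list (map sum_list (map concat ksss)) = ?N" "sum_list (map sum_list (map (map sum_list) ksss)) = ?N"
    using sum_list_concat[of "map concat ksss"] sum_list_concat[of "concat ksss"]
      sum_list_concat[of "map (map sum_list) ksss"]
    by (simp_all only: concat_map_concat map_concat)
  note R = pentagon_right[OF t] and Le = pentagon_left[OF t]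
  have in': "triple_gen ksss a bs dss esss \<in> cset ?S ?N"
    unfolding triple_gen_def by (rule left_gen_in[OF triple_args_outer[OF t]])
  have 1: "assoc A (B \<odot> D) E ?N (middle_bracket left_gen ksss a bs dss esss)
     = middle_bracket right_gen ksss a bs dss esss"
    using assoc_left_gen[OF ABDE(1) coll_sub[OF ABDE(2,3)] ABDE(4) Le(2)] unfolding N .
  have 2: "assoc A B (D \<odot> E) ?N (right_bracket left_gen ksss a bs dss esss)
     = right_bracket right_gen ksss a bs dss esss"
    using assoc_left_gen[OF ABDE(1,2) coll_sub[OF ABDE(3,4)] R(2)] unfolding N .
  have 3: "assoc (A \<odot> B) D E ?N (triple_gen ksss a bs dss esss)
     = right_bracket left_gen ksss a bs dss esss"
    unfolding triple_gen_def R(1)[symmetric]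
    by (rule assoc_left_gen[OF coll_sub[OF ABDE(1,2)] ABDE(3,4) triple_args_outer[OF t]])
  show "ccomp ?S (cmap A ((B \<odot> D) \<odot> E) A (B \<odot> (D \<odot> E)) (cid A) (assoc B D E))
      (ccomp ?S (assoc A (B \<odot> D) E) (cmap ((A \<odot> B) \<odot> D) E (A \<odot> (B \<odot> D)) E (assoc A B D) (cid E)))
      ?N (triple_gen ksss a bs dss esss)
    = ccomp ?S (assoc A B (D \<odot> E)) (assoc (A \<odot> B) D E) ?N (triple_gen ksss a bs dss esss)"
    using in' by (simp only: ccomp_apply Le(1) 1 2 3 pentagon_middle[OF t])
qed

end

lemma triangle:
  assumes A: "coll A" and B: "coll B"
  shows "ccomp ((A \<odot> J) \<odot> B) (cmap A (J \<odot> B) A B (cid A) (lunit B)) (assoc A J B)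
    = cmap (A \<odot> J) B A B (runit A) (cid B)"
proof -
  let ?S = "(A \<odot> J) \<odot> B"
  let ?f = "ccomp ?S (cmap A (J \<odot> B) A B (cid A) (lunit B)) (assoc A J B)"
  let ?g = "cmap (A \<odot> J) B A B (runit A) (cid B)"
  note h = assoc_hom subst_map_hom lunit_hom runit_hom coll_sub coll_J cid_hom
  have f: "?f \<in> chom ?S (A \<odot> B)"
    using A B by (intro ccomp_hom[where Y = "A \<odot> (J \<odot> B)"] h)
  have g: "?g \<in> chom ?S (A \<odot> B)"
    using A B by (intro h)
  show ?thesis
  proof (rule hom_sub_eqI[OF coll_sub[OF A coll_J] B f g])
    fix ls p zs assume p: "p \<in> cset (A \<odot> J) (length ls)" and zs: "zs \<in> tuples (cset B) ls"
    let ?n = "length ls"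
    \<comment> \<open>The right unitor is invertible, so p must be the class of (x; e_1, ..., e_1;
      e) for its image x.\<close>
    define x where "x = runit A ?n p"
    have x: "x \<in> cset A ?n" unfolding x_def by (rule hom_in[OF runit_hom[OF A] p])
    \<comment> \<open>Each e_1 has one input, so \<open>zs\<close> is cut into singletons.\<close>
    let ?kss = "map (\<lambda>k. [k]) ls" and ?zss = "map (\<lambda>z. [z]) zs" and ?es = "replicate ?n (e (Suc 0))"
    have "runit_inv A ?n (runit A ?n p) = p"
      using runit_inv_runit[OF A] p by (metis ccomp_apply cid_apply)
    then have pg: "p = gen A J (replicate ?n (Suc 0)) x ?es"
      using x by (simp add: runit_inv_def flip: x_def)
    have lz: "length zs = ?n" by (rule length_tuples[OF zs])
    have m: "map length ?kss = replicate ?n (Suc 0)" "map sum_list ?kss = ls" "concat ?kss = ls" "concat ?zss = zs"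
      by (simp_all add: comp_def map_replicate_const)
    have ga: "gen_args A J B ?kss x ?es ?zss"
      unfolding gen_args_def m using x zs by (simp add: list_all2_conv_all_nth tuples_iff[of zs])
    have lg: "gen (A \<odot> J) B ls p zs = left_gen A J B ?kss x ?es ?zss"
      unfolding left_gen_def m pg ..
    have in': "gen (A \<odot> J) B ls p zs \<in> cset ?S (sum_list ls)" by (rule gen_in[OF p zs])
    have G: "map3 (gen J B) ?kss ?es ?zss \<in> tuples (cset (J \<odot> B)) ls"
      using gens_in[of ?es J ?kss B ?zss] ga unfolding gen_args_def m by simp
    have "map2 (lunit B) ls (map3 (gen J B) ?kss ?es ?zss) = zs"
      using zs B by (intro nth_equalityI) (simp_all add: tuples_iff)
    then have "cmap A (J \<odot> B) A B (cid A) (lunit B) (sum_list ls) (right_gen A J B ?kss x ?es ?zss) = gen A B ls x zs"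
      using subst_map_gen[OF A _ A B cid_hom[OF A] lunit_hom[OF B] x G] x A B unfolding right_gen_def m by simp
    then have "?f (sum_list ls) (gen (A \<odot> J) B ls p zs) = gen A B ls x zs"
      using in' assoc_left_gen[OF A coll_J B ga] unfolding lg m by simp
    also have "\<dots> = ?g (sum_list ls) (gen (A \<odot> J) B ls p zs)"
      using subst_map_gen[OF _ B A B runit_hom[OF A] cid_hom[OF B] p zs] A map2_cid[OF zs] by (simp add: x_def)
    finally show "?f (sum_list ls) (gen (A \<odot> J) B ls p zs) = ?g (sum_list ls) (gen (A \<odot> J) B ls p zs)" .
  qed
qed

abbreviation assoc_iso_family :: "('u collection \<times> 'u collection) \<times> 'u collection \<Rightarrow> nat \<Rightarrow> 'u \<Rightarrow> 'u" where
  "assoc_iso_family \<equiv> \<lambda>((X, Y), Z). assoc X Y Z"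

lemma monoidal_category_coll:
  "monoidal_category (coll_cat small L) (subst_tensor code L) J assoc_iso_family lunit runit"
proof -
  let ?C = "coll_cat small L" and ?T = "subst_tensor code L"
  have "nat_iso (prod_cat (prod_cat ?C ?C) ?C) ?C (tens_left ?T) (tens_right ?T) assoc_iso_family"
    unfolding nat_iso_def tens_left_def tens_right_def
    by (simp add: prod_cat_def split_paired_Ball_Sigma assoc_iso assoc_natural)
  moreover have "nat_iso ?C ?C (unit_left ?C ?T J) id_fctr lunit"
    unfolding nat_iso_def unit_left_def id_fctr_def by (simp add: lunit_iso lunit_natural)
  moreover have "nat_iso ?C ?C (unit_right ?C ?T J) id_fctr runit"
    unfolding nat_iso_def unit_right_def id_fctr_def by (simp add: runit_iso runit_natural)
  ultimately show ?thesis
    unfolding monoidal_category_def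
    using category_coll functor_tensor pentagon triangle by (simp add: Let_def)
qed

section \<open>Monoids and operads\<close>

abbreviation lam_operad :: "'u acted_operad \<Rightarrow> bool" where "lam_operad \<equiv> is_lambda_operad small L"

abbreviation monoid_coll :: "('u collection, nat \<Rightarrow> 'u \<Rightarrow> 'u) mon_obj \<Rightarrow> bool" where
  "monoid_coll \<equiv> is_monoid (coll_cat small L) (subst_tensor code L) J assoc_iso_family lunit runit"

abbreviation mon_coll_cat :: "(('u collection, nat \<Rightarrow> 'u \<Rightarrow> 'u) mon_obj, nat \<Rightarrow> 'u \<Rightarrow> 'u) cat" where
  "mon_coll_cat \<equiv> mon_cat (coll_cat small L) (subst_tensor code L) J assoc_iso_family lunit runit"

definition coll_of :: "'u acted_operad \<Rightarrow> 'u collection" where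
  "coll_of P = \<lparr>cset = ops P, cact = oact P\<rparr>"

lemma coll_of_simps [simp]: "cset (coll_of P) = ops P" "cact (coll_of P) = oact P"
  by (simp_all add: coll_of_def)

lemma coll_coll_of: "lam_operad P \<Longrightarrow> coll (coll_of P)"
  by (simp add: is_lambda_operad_def is_coll_def)

lemma lambda_operad_hom_iff:
  "f \<in> lambda_operad_hom L P Q \<longleftrightarrow> f \<in> chom (coll_of P) (coll_of Q) \<and> f (Suc 0) (oid P) = oid Q \<and>
     (\<forall>ks. \<forall>p\<in>ops P (length ks). \<forall>qs\<in>tuples (ops P) ks.
       f (sum_list ks) (mu P ks p qs) = mu Q ks (f (length ks) p) (map2 f ks qs))"
  by (auto simp: lambda_operad_hom_def operad_map_def coll_hom_def PiE_def)

lemma lam_operad_mu_in: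
  "lam_operad P \<Longrightarrow> p \<in> ops P (length ks) \<Longrightarrow> qs \<in> tuples (ops P) ks \<Longrightarrow> mu P ks p qs \<in> ops P (sum_list ks)"
  by (simp add: is_lambda_operad_def operad_def)

lemma category_lambda_operad: "category (lambda_operad_cat small L)"
proof -
  have s: "Ob (lambda_operad_cat small L) = {P. lam_operad P}"
    "Hom (lambda_operad_cat small L) = lambda_operad_hom L"
    "Idn (lambda_operad_cat small L) P = cid (coll_of P)"
    "Cmp (lambda_operad_cat small L) P Q R g f = ccomp (coll_of P) g f" for P Q R g f
    by (simp_all add: lambda_operad_cat_def cid_def ccomp_def fun_eq_iff)
  have oid: "oid P \<in> ops P (Suc 0)" if "lam_operad P" for P
    using that by (simp add: is_lambda_operad_def operad_def)
  have id: "cid (coll_of P) \<in> lambda_operad_hom L P P" if P: "lam_operad P" for P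
    using map2_cid[of _ "coll_of P"] cid_hom[OF coll_coll_of[OF P]] oid[OF P] lam_operad_mu_in[OF P]
    by (simp add: lambda_operad_hom_iff)
  have comp: "ccomp (coll_of P) g f \<in> lambda_operad_hom L P R"
    if P: "lam_operad P" and Q: "lam_operad Q" and f: "f \<in> lambda_operad_hom L P Q" and g: "g \<in> lambda_operad_hom L Q R"
    for P Q R f g
  proof -
    have f': "f \<in> chom (coll_of P) (coll_of Q)" and g': "g \<in> chom (coll_of Q) (coll_of R)"
      using f g by (simp_all add: lambda_operad_hom_iff)
    have "ccomp (coll_of P) g f (sum_list ks) (mu P ks p qs)
        = mu R ks (ccomp (coll_of P) g f (length ks) p) (map2 (ccomp (coll_of P) g f) ks qs)"
      if p: "p \<in> ops P (length ks)" and qs: "qs \<in> tuples (ops P) ks" for ks p qs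
    proof -
      have "f (length ks) p \<in> ops Q (length ks)" "map2 f ks qs \<in> tuples (ops Q) ks"
        using hom_in[OF f', of p] homs_in[OF f', of qs] p qs by simp_all
      then show ?thesis
        using f g p qs lam_operad_mu_in[OF P p qs] map2_ccomp[of qs "coll_of P" ks g f]
        by (simp add: lambda_operad_hom_iff)
    qed
    then show ?thesis
      using ccomp_hom[OF coll_coll_of[OF P] f' g'] f g oid[OF P] by (simp add: lambda_operad_hom_iff)
  qed
  have chom: "f \<in> chom (coll_of P) (coll_of Q)" if "f \<in> lambda_operad_hom L P Q" for P Q f
    using that by (simp add: lambda_operad_hom_iff)
  have "ccomp (coll_of P) f (cid (coll_of P)) = f \<and> ccomp (coll_of P) (cid (coll_of Q)) f = f"
    if "lam_operad P" "lam_operad Q" "f \<in> lambda_operad_hom L P Q" for P Q f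
    using ccomp_cid[OF that(1,2)[THEN coll_coll_of] chom[OF that(3)]] by simp
  moreover have "ccomp (coll_of P) h (ccomp (coll_of P) g f) = ccomp (coll_of P) (ccomp (coll_of Q) h g) f"
    if "lam_operad P" "lam_operad Q" "f \<in> lambda_operad_hom L P Q" "g \<in> lambda_operad_hom L Q R"
      "h \<in> lambda_operad_hom L R S" for P Q R S f g h
    by (rule ccomp_assoc[OF that(1,2)[THEN coll_coll_of] that(3-5)[THEN chom]])
  ultimately show ?thesis
    unfolding category_def s using id comp by simp
qed

text \<open>J is the free collection on e_1: every x in \<Lambda>(1) is e_1 acted on by x.\<close>

lemma hom_J_eqI:
  assumes "f \<in> chom J W" "g \<in> chom J W" "f (Suc 0) (e (Suc 0)) = g (Suc 0) (e (Suc 0))"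
  shows "f = g"
proof (rule hom_eqI[OF assms(1,2)])
  fix n x assume "x \<in> cset J n"
  then have n: "n = Suc 0" and x: "x \<in> ops L (Suc 0)" by (simp_all add: cset_J)
  have "x = cact J (Suc 0) (e (Suc 0)) x" using x by (simp add: cact_J)
  then show "f n x = g n x"
    using hom_act[OF assms(1), of "e (Suc 0)" "Suc 0" x] hom_act[OF assms(2), of "e (Suc 0)" "Suc 0" x] assms(3) x
    by (simp add: n cset_J)
qed

lemma e_J: "e (Suc 0) \<in> cset J (Suc 0)"
  by (simp add: cset_J)

section \<open>The monoid axioms on generators\<close>

definition assoc_law :: "'u collection \<Rightarrow> (nat \<Rightarrow> 'u \<Rightarrow> 'u) \<Rightarrow> bool" where
  "assoc_law X m \<longleftrightarrow> (\<forall>kss p qs rss. gen_args X X X kss p qs rss \<longrightarrow>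
     m (sum_list (concat kss)) (gen X X (concat kss)
       (m (sum_list (map length kss)) (gen X X (map length kss) p qs)) (concat rss))
     = m (sum_list (map sum_list kss)) (gen X X (map sum_list kss) p
       (map2 m (map sum_list kss) (map3 (gen X X) kss qs rss))))"

text \<open>Both composites are morphisms out of (X \<circ> X) \<circ> X, hence determined by left
  forms. The associator turns these into right forms, on which the second composite is
  evaluated.\<close>

lemma monoid_coll_assoc_iff:
  assumes X: "coll X" and m: "m \<in> chom (X \<odot> X) X"
  shows "ccomp ((X \<odot> X) \<odot> X) m (cmap (X \<odot> X) X X X m (cid X))
      = ccomp ((X \<odot> X) \<odot> X) m (ccomp ((X \<odot> X) \<odot> X) (cmap X (X \<odot> X) X X (cid X) m) (assoc X X X))
    \<longleftrightarrow> assoc_law X m"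
    (is "?f = ?g \<longleftrightarrow> _")
proof -
  have f: "?f \<in> chom ((X \<odot> X) \<odot> X) X" "?g \<in> chom ((X \<odot> X) \<odot> X) X"
    using X m by (auto intro!: ccomp_hom[OF _ subst_map_hom m]
      ccomp_hom[OF _ ccomp_hom[OF _ assoc_hom subst_map_hom] m])
  have "?f (sum_list (map sum_list kss)) (left_gen X X X kss p qs rss)
      = m (sum_list (concat kss)) (gen X X (concat kss)
        (m (sum_list (map length kss)) (gen X X (map length kss) p qs)) (concat rss))"
    (is ?f_eq)
    and "?g (sum_list (map sum_list kss)) (left_gen X X X kss p qs rss)
      = m (sum_list (map sum_list kss)) (gen X X (map sum_list kss) p
        (map2 m (map sum_list kss) (map3 (gen X X) kss qs rss)))"
    (is ?g_eq)
    if a: "gen_args X X X kss p qs rss" for kss p qs rss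
  proof -
    have rs: "concat rss \<in> tuples (cset X) (concat kss)"
      using a by (simp add: gen_args_def list_all2_tuples_concat)
    have p: "gen X X (map length kss) p qs \<in> cset (X \<odot> X) (length (concat kss))"
      using a gen_in[of p X "map length kss" qs X] by (simp add: gen_args_def length_concat)
    show ?f_eq
      using subst_map_gen[OF coll_sub[OF X X] X X X m cid_hom[OF X] p rs] left_gen_in[OF a] map2_cid[OF rs]
      by (simp add: left_gen_def sum_list_concat length_concat)
    have qs: "map3 (gen X X) kss qs rss \<in> tuples (cset (X \<odot> X)) (map sum_list kss)"
      using a by (simp add: gen_args_def gens_in)
    have p: "p \<in> cset X (length (map sum_list kss))" using a by (simp add: gen_args_def)
    show ?g_eq
      using subst_map_gen[OF X coll_sub[OF X X] X X cid_hom[OF X] m p qs] left_gen_in[OF a]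
        assoc_left_gen[OF X X X a] p
      by (simp add: right_gen_def)
  qed
  then show ?thesis
    unfolding assoc_law_def using left_gen_eqI[OF X X X f] by metis
qed

text \<open>The unit laws are tested on the generators (e_1; p; e) and (p; e_1, ..., e_1; e), where
  the unitors return p. So u enters only through its value at e_1.\<close>

lemma monoid_coll_iff:
  "monoid_coll (X, m, u) \<longleftrightarrow> coll X \<and> m \<in> chom (X \<odot> X) X \<and> u \<in> chom J X \<and>
    assoc_law X m \<and>
    (\<forall>n. \<forall>p\<in>cset X n. m n (gen X X [n] (u (Suc 0) (e (Suc 0))) [p]) = p \<and>
      m n (gen X X (ones n) p (replicate n (u (Suc 0) (e (Suc 0))))) = p)"
proof (cases "coll X \<and> m \<in> chom (X \<odot> X) X \<and> u \<in> chom J X")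
  case True
  then have X: "coll X" and m: "m \<in> chom (X \<odot> X) X" and u: "u \<in> chom J X" by simp_all
  have l: "ccomp (J \<odot> X) m (cmap J X X X u (cid X)) n (gen J X [n] (e (Suc 0)) [p])
      = m n (gen X X [n] (u (Suc 0) (e (Suc 0))) [p])" if "p \<in> cset X n" for n p
    using subst_map_gen[OF coll_J X X X u cid_hom[OF X], of "e (Suc 0)" "[n]" "[p]"] that e_J by simp
  have r: "ccomp (X \<odot> J) m (cmap X J X X (cid X) u) n (gen X J (ones n) p (es n))
      = m n (gen X X (ones n) p (replicate n (u (Suc 0) (e (Suc 0)))))" if "p \<in> cset X n" for n p
    using subst_map_gen[OF X coll_J X X cid_hom[OF X] u, of p "ones n" "es n"] that
    by (simp add: sum_list_replicate)
  have lh: "ccomp (J \<odot> X) m (cmap J X X X u (cid X)) \<in> chom (J \<odot> X) X"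
    "ccomp (X \<odot> J) m (cmap X J X X (cid X) u) \<in> chom (X \<odot> J) X"
    using X m u by (auto intro!: ccomp_hom[where Y = "X \<odot> X"] subst_map_hom)
  have "ccomp (J \<odot> X) m (cmap J X X X u (cid X)) = lunit X \<longleftrightarrow>
      (\<forall>n. \<forall>p\<in>cset X n. m n (gen X X [n] (u (Suc 0) (e (Suc 0))) [p]) = p)"
    using hom_unit_left_eqI[OF X lh(1) lunit_hom[OF X]] l lunit_gen[OF X] by metis
  moreover have "ccomp (X \<odot> J) m (cmap X J X X (cid X) u) = runit X \<longleftrightarrow>
      (\<forall>n. \<forall>p\<in>cset X n. m n (gen X X (ones n) p (replicate n (u (Suc 0) (e (Suc 0))))) = p)"
    using hom_unit_right_eqI[OF X lh(2) runit_hom[OF X]] r runit_gen[OF X] by metis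
  ultimately show ?thesis
    using monoid_coll_assoc_iff[OF X m] True unfolding is_monoid_def by auto
next
  case False
  then show ?thesis unfolding is_monoid_def by auto
qed

section \<open>From monoids to operads and back\<close>

definition operad_of :: "('u collection, nat \<Rightarrow> 'u \<Rightarrow> 'u) mon_obj \<Rightarrow> 'u acted_operad" where
  "operad_of = (\<lambda>(X, m, u). \<lparr>ops = cset X, oid = u (Suc 0) (e (Suc 0)),
     mu = (\<lambda>ks p qs. if p \<in> cset X (length ks) \<and> qs \<in> tuples (cset X) ks
                     then m (sum_list ks) (gen X X ks p qs) else undefined),
     oact = cact X\<rparr>)"

text \<open>The unit is the only equivariant map from J that sends e_1 to the operadic identity, the
  reverse of the reading in \<open>operad_of\<close>.\<close>

definition monoid_of :: "'u acted_operad \<Rightarrow> ('u collection, nat \<Rightarrow> 'u \<Rightarrow> 'u) mon_obj" where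
  "monoid_of P = (coll_of P, lift (coll_of P) (coll_of P) (coll_of P) (mu P),
     \<lambda>n. \<lambda>g\<in>cset J n. oact P (Suc 0) (oid P) g)"

lemma operad_of_simps [simp]:
  "ops (operad_of (X, m, u)) = cset X" "oid (operad_of (X, m, u)) = u (Suc 0) (e (Suc 0))"
  "oact (operad_of (X, m, u)) = cact X" "coll_of (operad_of (X, m, u)) = X"
  "p \<in> cset X (length ks) \<Longrightarrow> qs \<in> tuples (cset X) ks \<Longrightarrow>
    mu (operad_of (X, m, u)) ks p qs = m (sum_list ks) (gen X X ks p qs)"
  by (simp_all add: operad_of_def coll_of_def)

lemma balanced_mu:
  assumes "lam_operad P"
  shows "balanced (coll_of P) (coll_of P) (coll_of P) (mu P)"
  unfolding balanced_def coll_of_simps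
  using assms lam_operad_mu_in[OF assms] unfolding is_lambda_operad_def by blast

lemma lam_operad_operad_of:
  assumes M: "monoid_coll (X, m, u)"
  shows "lam_operad (operad_of (X, m, u))"
proof -
  let ?P = "operad_of (X, m, u)"
  note M' = M[unfolded monoid_coll_iff]
  from M' have X: "coll X" and m: "m \<in> chom (X \<odot> X) X" and u: "u \<in> chom J X" by simp_all
  have uin: "u (Suc 0) (e (Suc 0)) \<in> cset X (Suc 0)" by (rule hom_in[OF u e_J])
  have min: "m (sum_list ks) (gen X X ks p qs) \<in> cset X (sum_list ks)"
    if "p \<in> cset X (length ks)" "qs \<in> tuples (cset X) ks" for ks p qs
    using that m by (simp add: hom_in)
  have "mu ?P (concat kss) (mu ?P (map length kss) p qs) (concat rss) = mu ?P (map sum_list kss) p (map3 (mu ?P) kss qs rss)"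
    if a: "gen_args X X X kss p qs rss" for kss p qs rss
  proof -
    have p: "p \<in> cset X (length kss)" and qs: "qs \<in> tuples (cset X) (map length kss)" and rss: "tuple_lists (cset X) rss kss"
      using a by (simp_all add: gen_args_def)
    have l: "length qs = length kss" "length rss = length kss"
      using length_tuples[OF qs] list_all2_lengthD[OF rss] by simp_all
    have n: "sum_list (map length kss) = length (concat kss)" by (simp add: length_concat)
    have 1: "m (length (concat kss)) (gen X X (map length kss) p qs) \<in> cset X (length (concat kss))"
      using min[of p "map length kss" qs] p qs unfolding n by simp
    have 2: "map3 (mu ?P) kss qs rss = map2 m (map sum_list kss) (map3 (gen X X) kss qs rss)" (is "?l = ?r")
    proof (rule nth_equalityI)
      fix i assume "i < length ?l"
      then have i: "i < length kss" by simp
      then have "qs ! i \<in> cset X (length (kss ! i))" "rss ! i \<in> tuples (cset X) (kss ! i)"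
        using qs list_all2_nthD2[OF rss i] by (simp_all add: tuples_iff[of qs])
      then show "?l ! i = ?r ! i"
        using i l by simp
    qed (use l in simp)
    have 3: "map2 m (map sum_list kss) (map3 (gen X X) kss qs rss) \<in> tuples (cset X) (map sum_list kss)"
      by (rule homs_in[OF m gens_in[OF qs rss]])
    have "m (sum_list (concat kss)) (gen X X (concat kss)
        (m (length (concat kss)) (gen X X (map length kss) p qs)) (concat rss))
      = m (sum_list (map sum_list kss)) (gen X X (map sum_list kss) p
        (map2 m (map sum_list kss) (map3 (gen X X) kss qs rss)))"
      using M' a unfolding assoc_law_def n[symmetric] by blast
    then show ?thesis
      using 1 3 p qs list_all2_tuples_concat[OF rss] unfolding 2 by (simp add: n)
  qed
  then have "operad ?P"
    using M' uin min unfolding operad_def gen_args_def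
    by (simp add: tuples_iff[of "replicate _ _"] sum_list_replicate)
  moreover have "balanced X X X (\<lambda>ks x ys. m (sum_list ks) (gen X X ks x ys))"
    by (rule balanced_hom[OF X X m])
  then have "\<forall>ks. \<forall>p\<in>cset X (length ks). \<forall>qs\<in>tuples (cset X) ks. \<forall>gs\<in>tuples (ops L) ks.
      mu ?P ks p (map3 (cact X) ks qs gs) = cact X (sum_list ks) (mu ?P ks p qs) (beta L ks gs)"
    "\<forall>ks. \<forall>p\<in>cset X (length ks). \<forall>qs\<in>tuples (cset X) ks. \<forall>g\<in>ops L (length ks).
      mu ?P ks (cact X (length ks) p g) qs
      = cact X (sum_list ks) (mu ?P (pm (length ks) g ks) p (pm (length ks) g qs)) (delta L ks g)"
    using X unfolding balanced_def by simp_all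
  moreover have "mu ?P ks p qs = undefined" if "\<not> (p \<in> cset X (length ks) \<and> qs \<in> tuples (cset X) ks)" for ks p qs
    using that by (auto simp: operad_of_def)
  ultimately show ?thesis
    using X unfolding is_lambda_operad_def is_coll_def operad_of_simps by blast
qed

lemma monoid_coll_monoid_of:
  assumes P: "lam_operad P"
  shows "monoid_coll (monoid_of P)"
proof -
  let ?X = "coll_of P" and ?m = "lift (coll_of P) (coll_of P) (coll_of P) (mu P)"
  let ?u = "\<lambda>n. \<lambda>g\<in>cset J n. oact P (Suc 0) (oid P) g"
  have X: "coll ?X" by (rule coll_coll_of[OF P])
  have oid: "oid P \<in> ops P (Suc 0)" and op: "operad P"
    using P by (simp_all add: is_lambda_operad_def operad_def)
  have m: "?m \<in> chom (?X \<odot> ?X) ?X" by (rule lift_hom[OF X X X balanced_mu[OF P]])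
  have mg: "?m (sum_list ks) (gen ?X ?X ks p qs) = mu P ks p qs"
    if "p \<in> ops P (length ks)" "qs \<in> tuples (ops P) ks" for ks p qs
    using lift_gen[OF X X X balanced_mu[OF P]] that by simp
  have u: "?u \<in> chom J ?X"
  proof (rule homI)
    fix n x g assume "x \<in> cset J n" "g \<in> ops L n"
    then show "?u n (cact J n x g) = cact ?X n (?u n x) g"
      using act_act[OF X, of "oid P" "Suc 0" x g] oid by (simp add: cset_J cact_J)
  next
    fix n x assume "x \<in> cset J n"
    then show "?u n x \<in> cset ?X n" using act_in[OF X, of "oid P" "Suc 0" x] oid by (simp add: cset_J)
  qed simp
  have u1: "?u (Suc 0) (e (Suc 0)) = oid P"
    using act_e[OF X, of "oid P" "Suc 0"] oid by (simp add: cset_J)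
  have unit: "?m n (gen ?X ?X [n] (oid P) [p]) = p"
    "?m n (gen ?X ?X (ones n) p (replicate n (oid P))) = p" if "p \<in> ops P n" for n p
    using mg[of "oid P" "[n]" "[p]"] mg[of p "ones n" "replicate n (oid P)"] that oid op
    unfolding operad_def by (simp_all add: sum_list_replicate tuples_iff[of "replicate _ _"])
  have "?m (sum_list (concat kss)) (gen ?X ?X (concat kss)
        (?m (sum_list (map length kss)) (gen ?X ?X (map length kss) p qs)) (concat rss))
      = ?m (sum_list (map sum_list kss)) (gen ?X ?X (map sum_list kss) p
        (map2 ?m (map sum_list kss) (map3 (gen ?X ?X) kss qs rss)))"
    if a: "gen_args ?X ?X ?X kss p qs rss" for kss p qs rss
  proof -
    have p: "p \<in> ops P (length kss)" and qs: "qs \<in> tuples (ops P) (map length kss)" and rss: "tuple_lists (ops P) rss kss"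
      using a by (simp_all add: gen_args_def)
    have l: "length qs = length kss" "length rss = length kss"
      using length_tuples[OF qs] list_all2_lengthD[OF rss] by simp_all
    have n: "sum_list (map length kss) = length (concat kss)" by (simp add: length_concat)
    have 1: "mu P (map length kss) p qs \<in> ops P (length (concat kss))"
      using lam_operad_mu_in[OF P, of p "map length kss" qs] p qs n by simp
    have 2: "map2 ?m (map sum_list kss) (map3 (gen ?X ?X) kss qs rss) = map3 (mu P) kss qs rss" (is "?l = ?r")
    proof (rule nth_equalityI)
      fix i assume "i < length ?l"
      then have i: "i < length kss" by simp
      then have "qs ! i \<in> ops P (length (kss ! i))" "rss ! i \<in> tuples (ops P) (kss ! i)"
        using qs list_all2_nthD2[OF rss i] by (simp_all add: tuples_iff[of qs])
      then show "?l ! i = ?r ! i"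
        using i l mg by simp
    qed (use l in simp)
    have 3: "map3 (mu P) kss qs rss \<in> tuples (ops P) (map sum_list kss)"
      using homs_in[OF m gens_in[of qs ?X kss ?X rss]] qs rss unfolding 2 by simp
    have "mu P (concat kss) (mu P (map length kss) p qs) (concat rss) = mu P (map sum_list kss) p (map3 (mu P) kss qs rss)"
      using op p qs rss unfolding operad_def by blast
    then show ?thesis
      using mg[of p "map length kss" qs] mg[OF 1 list_all2_tuples_concat[OF rss]] mg[OF _ 3, of p] p qs
      unfolding 2 by simp
  qed
  then show ?thesis
    unfolding monoid_of_def monoid_coll_iff assoc_law_def u1 using X m u unit by simp
qed

text \<open>m is recovered by \<open>lift_unique\<close> from its values on generators, and u by
  equivariance from its value at e_1; outside J extensionality makes u \<open>undefined\<close>, as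
  in \<open>monoid_of\<close>.\<close>

lemma monoid_of_operad_of:
  assumes M: "monoid_coll (X, m, u)"
  shows "monoid_of (operad_of (X, m, u)) = (X, m, u)"
proof -
  let ?P = "operad_of (X, m, u)"
  from M have X: "coll X" and m: "m \<in> chom (X \<odot> X) X" and u: "u \<in> chom J X"
    by (simp_all add: monoid_coll_iff)
  have b: "balanced X X X (mu ?P)" using balanced_mu[OF lam_operad_operad_of[OF M]] by simp
  have "m = lift X X X (mu ?P)"
    by (rule lift_unique[OF X X X b m]) simp
  moreover have "(\<lambda>n. \<lambda>g\<in>cset J n. cact X (Suc 0) (u (Suc 0) (e (Suc 0))) g) = u"
  proof (intro ext)
    fix n g
    show "(\<lambda>g\<in>cset J n. cact X (Suc 0) (u (Suc 0) (e (Suc 0))) g) g = u n g"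
    proof (cases "g \<in> cset J n")
      case True
      then show ?thesis
        using hom_act[OF u e_J, of g] by (simp add: cset_J cact_J)
    next
      case False
      have "u n \<in> extensional (cset J n)" using u by (auto simp: coll_hom_def PiE_def)
      with False show ?thesis by (simp add: extensional_def)
    qed
  qed
  ultimately show ?thesis by (simp add: monoid_of_def)
qed

lemma operad_of_monoid_of:
  assumes P: "lam_operad P"
  shows "operad_of (monoid_of P) = P"
proof -
  have X: "coll (coll_of P)" by (rule coll_coll_of[OF P])
  have oid: "oid P \<in> ops P (Suc 0)" using P by (simp add: is_lambda_operad_def operad_def)
  have "oact P (Suc 0) (oid P) (e (Suc 0)) = oid P"
    using act_e[OF X, of "oid P" "Suc 0"] oid by simp
  \<comment> \<open>Equality as functions uses that the composition of a \<Lambda>-operad is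
    \<open>undefined\<close> outside its domain.\<close>
  moreover have "(\<lambda>ks p qs. if p \<in> ops P (length ks) \<and> qs \<in> tuples (ops P) ks
      then lift (coll_of P) (coll_of P) (coll_of P) (mu P) (sum_list ks) (gen (coll_of P) (coll_of P) ks p qs)
      else undefined) = mu P"
    using P lift_gen[OF X X X balanced_mu[OF P]] by (intro ext) (auto simp: is_lambda_operad_def)
  ultimately show ?thesis
    by (simp add: operad_of_def monoid_of_def cset_J)
qed

text \<open>Compatibility with multiplications is an equality of morphisms out of X \<circ> X,
  tested on generators; compatibility with units is one of morphisms out of J, tested at
  e_1.\<close>

lemma mon_hom_eq:
  assumes M: "monoid_coll (X, m, u)" and M': "monoid_coll (X', m', u')"
  shows "mon_hom (coll_cat small L) (subst_tensor code L) J (X, m, u) (X', m', u')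
    = lambda_operad_hom L (operad_of (X, m, u)) (operad_of (X', m', u'))"
proof -
  from M have X: "coll X" and m: "m \<in> chom (X \<odot> X) X" and u: "u \<in> chom J X"
    by (simp_all add: monoid_coll_iff)
  from M' have X': "coll X'" and m': "m' \<in> chom (X' \<odot> X') X'" and u': "u' \<in> chom J X'"
    by (simp_all add: monoid_coll_iff)
  have "f \<in> mon_hom (coll_cat small L) (subst_tensor code L) J (X, m, u) (X', m', u')
      \<longleftrightarrow> f \<in> lambda_operad_hom L (operad_of (X, m, u)) (operad_of (X', m', u'))" for f
  proof (cases "f \<in> chom X X'")
    case f: True
    have 1: "ccomp (X \<odot> X) f m \<in> chom (X \<odot> X) X'" "ccomp (X \<odot> X) m' (cmap X X X' X' f f) \<in> chom (X \<odot> X) X'"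
      using X X' m m' f by (auto intro!: ccomp_hom[OF _ m] ccomp_hom[OF _ subst_map_hom m'])
    have 2: "ccomp (X \<odot> X) f m (sum_list ks) (gen X X ks p qs) = f (sum_list ks) (mu (operad_of (X, m, u)) ks p qs)"
      "ccomp (X \<odot> X) m' (cmap X X X' X' f f) (sum_list ks) (gen X X ks p qs)
        = mu (operad_of (X', m', u')) ks (f (length ks) p) (map2 f ks qs)"
      if "p \<in> cset X (length ks)" "qs \<in> tuples (cset X) ks" for ks p qs
      using that X X' f by (simp_all add: subst_map_gen hom_in homs_in)
    have "ccomp (X \<odot> X) f m = ccomp (X \<odot> X) m' (cmap X X X' X' f f) \<longleftrightarrow>
        (\<forall>ks. \<forall>p\<in>cset X (length ks). \<forall>qs\<in>tuples (cset X) ks.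
          f (sum_list ks) (mu (operad_of (X, m, u)) ks p qs)
          = mu (operad_of (X', m', u')) ks (f (length ks) p) (map2 f ks qs))"
      using hom_sub_eqI[OF X X 1] 2 by metis
    moreover have "ccomp J f u = u' \<longleftrightarrow> f (Suc 0) (u (Suc 0) (e (Suc 0))) = u' (Suc 0) (e (Suc 0))"
      using hom_J_eqI[OF ccomp_hom[OF coll_J u f] u'] ccomp_apply[OF e_J] by metis
    ultimately show ?thesis
      using f by (auto simp: mon_hom_def lambda_operad_hom_iff)
  next
    case False
    then show ?thesis by (auto simp: mon_hom_def lambda_operad_hom_iff)
  qed
  then show ?thesis by blast
qed

lemma equivalent_monoids_operads: "equivalent_categories mon_coll_cat (lambda_operad_cat small L)"
proof (rule equivalent_categoriesI[where F = operad_of and G = monoid_of])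
  show "category (lambda_operad_cat small L)" by (rule category_lambda_operad)
next
  fix M assume "M \<in> Ob mon_coll_cat"
  then show "operad_of M \<in> Ob (lambda_operad_cat small L) \<and> monoid_of (operad_of M) = M"
    by (cases M) (simp add: mon_cat_def lambda_operad_cat_def lam_operad_operad_of monoid_of_operad_of)
next
  fix P assume "P \<in> Ob (lambda_operad_cat small L)"
  then show "monoid_of P \<in> Ob mon_coll_cat \<and>
      operad_of (monoid_of P) = P"
    by (simp add: mon_cat_def lambda_operad_cat_def monoid_coll_monoid_of operad_of_monoid_of)
next
  fix M M' assume "M \<in> Ob mon_coll_cat"
    "M' \<in> Ob mon_coll_cat"
  then show "Hom mon_coll_cat M M'
      = Hom (lambda_operad_cat small L) (operad_of M) (operad_of M')"
    by (cases M; cases M') (simp add: mon_cat_def lambda_operad_cat_def mon_hom_eq)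
next
  fix M show "Idn mon_coll_cat M
      = Idn (lambda_operad_cat small L) (operad_of M)"
    by (cases M) (simp add: mon_cat_def lambda_operad_cat_def cid_def)
next
  fix M M' M'' g f
  show "Cmp mon_coll_cat M M' M'' g f
      = Cmp (lambda_operad_cat small L) (operad_of M) (operad_of M') (operad_of M'') g f"
    by (cases M; cases M'; cases M'') (simp add: mon_cat_def lambda_operad_cat_def ccomp_def)
qed

end

theorem theorem9p4:
  fixes small :: "'u set \<Rightarrow> bool"
    and code :: "'u set \<Rightarrow> 'u"
    and \<Lambda> :: "'u group_operad"
  assumes "set_universe small code"
    and "action_operad \<Lambda>"
    and "\<And>n. small (ops \<Lambda> n)"
  shows "\<exists>a l r.
    monoidal_category (coll_cat small \<Lambda>) (subst_tensor code \<Lambda>) (unit_coll \<Lambda>) a l r \<and>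
    equivalent_categories
      (mon_cat (coll_cat small \<Lambda>) (subst_tensor code \<Lambda>) (unit_coll \<Lambda>) a l r)
      (lambda_operad_cat small \<Lambda>)"
proof -
  interpret action_op_universe small code \<Lambda>
    using assms by (intro action_op_universe.intro action_op.intro action_op_universe_axioms.intro)
  show ?thesis using monoidal_category_coll equivalent_monoids_operads by blast
qed

end
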